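(* Let $K$ be an algebraically closed field. Then there is no nontrivial finite-dimensional linear representation of $\mathrm{Cr}_2(K)$ over any field; that is, for every field $F$ and every integer $n\ge 1$, every group homomorphism $\mathrm{Cr}_2(K)\to \mathrm{GL}_n(F)$ is trivial.
   Context: For a field $K$, the planar Cremona group $\mathrm{Cr}_2(K)$ is the group (under composition) of birational transformations of the 2-dimensional affine space over $K$, equivalently the group of $K$-automorphisms of the field of rational functions $K(t_1,t_2)$. It is regarded as an abstract (discrete) group, and the field $F$ is arbitrary and unrelated to $K$. *)

theory Defs
  imports
    "HOL-Algebra.Group"
    "HOL-Computational_Algebra.Polynomial_Factorial"
    "Jordan_Normal_Form.Matrix"
begin

text \<open>
  The field \<open>K(t\<^sub>1,t\<^sub>2)\<close> is the fraction field of \<open>K[t\<^sub>1][t\<^sub>2]\<close>: the inner polynomial variable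
  is \<open>t\<^sub>1\<close>, the outer one is \<open>t\<^sub>2\<close>.
\<close>

type_synonym 'k ratfun2 = "'k poly poly fract"

definition ratfun2_const :: "'k::field \<Rightarrow> 'k ratfun2"
  where "ratfun2_const c = to_fract [:[:c:]:]"

text \<open>
  The planar Cremona group, as the group of \<open>K\<close>-automorphisms of \<open>K(t\<^sub>1,t\<^sub>2)\<close>. Pull-back of
  functions reverses composition, so a birational transformation \<open>f\<close> of the plane corresponds
  to the automorphism \<open>u \<mapsto> u \<circ> f\<^sup>-\<^sup>1\<close>.
\<close>

definition Cr2 :: "('k::field ratfun2 \<Rightarrow> 'k ratfun2) monoid"
  where "Cr2 =
    \<lparr>carrier = {\<phi>. bij \<phi> \<and>
        (\<forall>x y. \<phi> (x + y) = \<phi> x + \<phi> y) \<and>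
        (\<forall>x y. \<phi> (x * y) = \<phi> x * \<phi> y) \<and>
        (\<forall>c. \<phi> (ratfun2_const c) = ratfun2_const c)},
     mult = (\<circ>),
     one = id\<rparr>"

definition GL :: "nat \<Rightarrow> 'f::field mat monoid"
  where "GL n = units_of (ring_mat TYPE('f) n ())"

lemma group_Cr2: "group (Cr2 :: ('k::field ratfun2 \<Rightarrow> 'k ratfun2) monoid)"
proof (rule groupI)
  fix \<phi> :: "'k ratfun2 \<Rightarrow> 'k ratfun2"
  assume "\<phi> \<in> carrier Cr2"
  then have b: "bij \<phi>" and a: "\<And>x y. \<phi> (x + y) = \<phi> x + \<phi> y"
    and m: "\<And>x y. \<phi> (x * y) = \<phi> x * \<phi> y"
    and c: "\<And>c. \<phi> (ratfun2_const c) = ratfun2_const c"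
    by (auto simp: Cr2_def)
  have inv_eq: "inv_into UNIV \<phi> z = w" if "\<phi> w = z" for z w
    using b that by (auto simp: bij_def)
  have "inv_into UNIV \<phi> \<in> carrier Cr2"
    unfolding Cr2_def using b
    by (auto simp: bij_imp_bij_inv a m c bij_is_surj surj_f_inv_f intro!: inv_eq)
  moreover have "inv_into UNIV \<phi> \<circ> \<phi> = id"
    using b by (simp add: bij_is_inj)
  ultimately show "\<exists>\<psi>\<in>carrier Cr2. \<psi> \<otimes>\<^bsub>Cr2\<^esub> \<phi> = \<one>\<^bsub>Cr2\<^esub>"
    by (auto simp: Cr2_def)
qed (auto simp: Cr2_def bij_comp o_assoc)

lemma group_GL: "group (GL n :: 'f::field mat monoid)"
proof -
  interpret ring "ring_mat TYPE('f) n ()" by (rule ring_mat)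
  show ?thesis unfolding GL_def by (rule units_group)
qed

lemma carrier_GL:
  "carrier (GL n :: 'f::field mat monoid) = {A \<in> carrier_mat n n. invertible_mat A}"
proof (intro equalityI subsetI)
  fix A :: "'f mat"
  assume "A \<in> carrier (GL n)"
  then obtain B where "A \<in> carrier_mat n n" "B \<in> carrier_mat n n" "B * A = 1\<^sub>m n" "A * B = 1\<^sub>m n"
    unfolding GL_def units_of_def Units_def ring_mat_def by auto
  then show "A \<in> {A \<in> carrier_mat n n. invertible_mat A}"
    unfolding invertible_mat_def inverts_mat_def by auto
next
  fix A :: "'f mat"
  assume "A \<in> {A \<in> carrier_mat n n. invertible_mat A}"
  then obtain B where A: "A \<in> carrier_mat n n" and AB: "A * B = 1\<^sub>m n"
    and BA: "B * A = 1\<^sub>m (dim_row B)"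
    unfolding invertible_mat_def inverts_mat_def by auto
  have "dim_col B = n" using arg_cong[OF AB, of dim_col] by simp
  moreover have "dim_row B = n" using arg_cong[OF BA, of dim_col] A by simp
  ultimately have "B \<in> carrier_mat n n" by auto
  then show "A \<in> carrier (GL n)"
    unfolding GL_def units_of_def Units_def ring_mat_def using A AB BA by auto
qed

lemma GL_simps [simp]: "mult (GL n) = (*)" "one (GL n) = 1\<^sub>m n"
  by (simp_all add: GL_def units_of_def ring_mat_def)

end

theory Submission
  imports Defs "Jordan_Normal_Form.Char_Poly"
begin

text \<open>
  The kernel of a representation contains the elementary transformations, and these generate the
  group (Noether-Castelnuovo).

  Kernel: the scalings \<open>B : t\<^sub>1 \<mapsto> c t\<^sub>1\<close> and \<open>C : t\<^sub>2 \<mapsto> c t\<^sub>2\<close> and the monomial map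
  \<open>A : t\<^sub>2 \<mapsto> t\<^sub>1 t\<^sub>2\<close> satisfy \<open>B A B\<^sup>-\<^sup>1 = C A\<close>, and \<open>C\<close> commutes with \<open>A\<close> and \<open>B\<close>.
  Conjugating a linear relation between powers of the matrix of \<open>A\<close> by that of \<open>B\<close> shows that a
  power of \<open>C\<close> is unipotent; if the corresponding power of \<open>c\<close> has finite order prime to the
  characteristic of \<open>F\<close>, then that power of \<open>C\<close> lies in the kernel. A nontrivial scaling in the
  kernel forces the translations, the inversion, \<open>A\<close> and the swap into it.

  Generation: for \<open>S\<close> stable under composition with elementary transformations, write \<open>t\<^sub>1\<close> as a
  quotient of two sections of a line bundle on a Hirzebruch surface with coordinates
  \<open>x = \<phi>(t\<^sub>1)\<close>, \<open>y = \<phi>(t\<^sub>2)\<close>, \<open>\<phi> \<in> S\<close>. Choose first the degree on the ruling and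
  then the anticanonical degree minimal. If the former were positive, all multiplicities would be
  small, and a power of \<open>dx \<and> dy\<close> divided by a power of the denominator would give a regular
  pluricanonical form on the generic fibre of \<open>t\<^sub>1\<close>, a projective line. Hence \<open>t\<^sub>1\<close> is a
  function of \<open>x\<close>, so \<open>x\<close> is a Moebius transform of \<open>t\<^sub>1\<close> over \<open>K\<close> and \<open>y\<close> one of \<open>t\<^sub>2\<close> over
  \<open>K(t\<^sub>1)\<close>, and both can be undone by elementary transformations.
\<close>

section \<open>Polynomials in two rational functions\<close>

text \<open>Generation enters contrapositively. For a nontrivial representation the complement of
  the kernel is nonempty and stable under right composition with kernel elements, so it suffices
  that such a set \<open>S\<close> contains \<open>id\<close>; the descent changes coordinates
  freely and records no word of moves.

  The exponents in the forms come from adjunction: with \<open>L\<close> the class of the sections,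
  \<open>2 L + d K\<close> on \<open>F_n\<close> is \<open>2 e - n d - 2 d\<close> fibres, and
  \<open>3 L + e K\<close> vanishes on the plane. Multiplicities up to \<open>d / 2\<close> or
  \<open>e / 3\<close> keep the forms regular after blowing up; a larger one allows an elementary
  transformation or a projection that lowers the minimised degree. If
  \<open>2 e - n d < 2 d\<close>, only \<open>n = 0\<close> and \<open>n = 1\<close> remain up to
  sign, the latter being the blown-up plane.

  Regularity is tested one valuation at a time, following its centre through blow-ups, so no surface
  is constructed.

  On the kernel side a unipotent matrix need not be trivial. Here algebraic closedness of
  \<open>K\<close> helps: the length \<open>r\<close> of the relation depends on \<open>A\<close>
  alone, so a root of unity is fixed first and an \<open>r!\<close>-th root of it taken
  afterwards.\<close>

lemma field_hom_ratfun2_const: "field_hom (ratfun2_const :: 'k::field \<Rightarrow> 'k ratfun2)"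
  by unfold_locales (simp_all add: ratfun2_const_def flip: to_fract_add to_fract_mult to_fract_1 to_fract_0 one_pCons)

interpretation const: field_hom ratfun2_const
  by (rule field_hom_ratfun2_const)

definition t1 :: "'k::field ratfun2" where "t1 = to_fract [:[:0, 1:]:]"
definition t2 :: "'k::field ratfun2" where "t2 = to_fract [:0, 1:]"

definition ev1 :: "'k::field ratfun2 \<Rightarrow> 'k poly \<Rightarrow> 'k ratfun2"
  where "ev1 x p = poly (map_poly ratfun2_const p) x"

definition ev :: "'k::field ratfun2 \<Rightarrow> 'k ratfun2 \<Rightarrow> 'k poly poly \<Rightarrow> 'k ratfun2"
  where "ev x y P = poly (map_poly (ev1 x) P) y"

interpretation map_const: map_poly_comm_ring_hom ratfun2_const ..

lemma comm_ring_hom_ev1: "comm_ring_hom (ev1 x)"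
  by unfold_locales (simp_all add: ev1_def hom_distribs)

interpretation ev1: comm_ring_hom "ev1 x" for x
  by (rule comm_ring_hom_ev1)

interpretation map_ev1: map_poly_comm_ring_hom "ev1 x" for x ..

lemma comm_ring_hom_ev: "comm_ring_hom (ev x y)"
  by unfold_locales (simp_all add: ev_def hom_distribs)

interpretation ev: comm_ring_hom "ev x y" for x y
  by (rule comm_ring_hom_ev)

lemma ev1_pCons [simp]: "ev1 x (pCons c p) = ratfun2_const c + x * ev1 x p"
  by (simp add: ev1_def hom_distribs)

lemma ev_pCons [simp]: "ev x y (pCons p P) = ev1 x p + y * ev x y P"
  by (simp add: ev_def hom_distribs)

lemma ev1_monom [simp]: "ev1 x (monom c i) = ratfun2_const c * x ^ i"
  by (simp add: ev1_def poly_monom)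

lemma ev_monom [simp]: "ev x y (monom p j) = ev1 x p * y ^ j"
  by (simp add: ev_def poly_monom)

section \<open>Supports and monomial substitutions\<close>

definition supp :: "'k::zero poly poly \<Rightarrow> (nat \<times> nat) set"
  where "supp P = {(i, j). coeff (coeff P j) i \<noteq> 0}"

lemma supp_iff: "(i, j) \<in> supp P \<longleftrightarrow> coeff (coeff P j) i \<noteq> 0"
  by (simp add: supp_def)

lemma supp_subset: "supp P \<subseteq> (\<Union>j\<le>degree P. {..degree (coeff P j)} \<times> {j})"
proof safe
  fix i j assume "(i, j) \<in> supp P"
  then have "coeff (coeff P j) i \<noteq> 0" "coeff P j \<noteq> 0"
    by (auto simp: supp_iff)
  then show "(i, j) \<in> (\<Union>j\<le>degree P. {..degree (coeff P j)} \<times> {j})"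
    by (auto intro: le_degree)
qed

lemma finite_supp [simp]: "finite (supp P)"
  by (rule finite_subset[OF supp_subset]) auto

lemma supp_empty_iff [simp]: "supp P = {} \<longleftrightarrow> P = 0"
  by (auto simp: supp_def poly_eq_iff)

lemma supp_0 [simp]: "supp 0 = {}" by simp

lemma poly_poly_eq_sum_supp:
  "P = (\<Sum>(i, j)\<in>supp P. monom (monom (coeff (coeff P j) i) i) j)"
proof (rule poly_eqI, rule poly_eqI)
  fix j i
  have "coeff (coeff (\<Sum>(i, j)\<in>supp P. monom (monom (coeff (coeff P j) i) i) j) j) i
     = (\<Sum>q\<in>supp P. if q = (i, j) then coeff (coeff P j) i else 0)"
    unfolding coeff_sum by (intro sum.cong) (auto split: if_splits prod.splits)
  also have "\<dots> = coeff (coeff P j) i"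
    by (simp add: supp_iff)
  finally show "coeff (coeff P j) i = coeff (coeff (\<Sum>(i, j)\<in>supp P. monom (monom (coeff (coeff P j) i) i) j) j) i"
    by simp
qed

text \<open>Common form of all monomial chart changes: blow-ups, inversions, the swap. Injectivity
  of \<open>\<sigma>\<close> is asked on the support only, since the truncated subtractions in these
  maps are not injective globally.\<close>

definition mon_map :: "(nat \<times> nat \<Rightarrow> nat \<times> nat) \<Rightarrow> 'k::comm_monoid_add poly poly \<Rightarrow> 'k poly poly"
  where "mon_map \<sigma> P = (\<Sum>q\<in>supp P. monom (monom (coeff (coeff P (snd q)) (fst q)) (fst (\<sigma> q))) (snd (\<sigma> q)))"

lemma coeff_mon_map:
  assumes "inj_on \<sigma> (supp P)" "(i, j) \<in> supp P"
  shows "coeff (coeff (mon_map \<sigma> P) (snd (\<sigma> (i, j)))) (fst (\<sigma> (i, j))) = coeff (coeff P j) i"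
proof -
  have "coeff (coeff (mon_map \<sigma> P) (snd (\<sigma> (i, j)))) (fst (\<sigma> (i, j)))
     = (\<Sum>q\<in>supp P. if q = (i, j) then coeff (coeff P j) i else 0)"
    unfolding mon_map_def coeff_sum
  proof (intro sum.cong refl)
    fix q assume q: "q \<in> supp P"
    have "\<sigma> q = \<sigma> (i, j) \<longleftrightarrow> q = (i, j)"
      using assms q by (auto dest: inj_onD)
    then show "coeff (coeff (monom (monom (coeff (coeff P (snd q)) (fst q)) (fst (\<sigma> q))) (snd (\<sigma> q)))
       (snd (\<sigma> (i, j)))) (fst (\<sigma> (i, j))) = (if q = (i, j) then coeff (coeff P j) i else 0)"
      by (auto simp: prod_eq_iff)
  qed
  then show ?thesis using assms by simp
qed

lemma supp_mon_map_subset: "supp (mon_map \<sigma> P) \<subseteq> \<sigma> ` supp P"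
proof
  fix r assume r: "r \<in> supp (mon_map \<sigma> P)"
  show "r \<in> \<sigma> ` supp P"
  proof (rule ccontr)
    assume "r \<notin> \<sigma> ` supp P"
    then have "coeff (coeff (mon_map \<sigma> P) (snd r)) (fst r) = 0"
      unfolding mon_map_def coeff_sum
      by (intro sum.neutral) (auto simp: image_iff prod_eq_iff split: if_splits)
    with r show False by (cases r) (simp add: supp_iff)
  qed
qed

lemma supp_mon_map:
  assumes "inj_on \<sigma> (supp P)"
  shows "supp (mon_map \<sigma> P) = \<sigma> ` supp P"
proof
  show "\<sigma> ` supp P \<subseteq> supp (mon_map \<sigma> P)"
  proof
    fix r assume "r \<in> \<sigma> ` supp P"
    then obtain i j where r: "r = \<sigma> (i, j)" and ij: "(i, j) \<in> supp P" by auto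
    have "(fst r, snd r) \<in> supp (mon_map \<sigma> P)"
      unfolding supp_iff r coeff_mon_map[OF assms ij] using ij by (simp add: supp_iff)
    then show "r \<in> supp (mon_map \<sigma> P)" by simp
  qed
qed (rule supp_mon_map_subset)

lemma mon_map_nonzero: "inj_on \<sigma> (supp P) \<Longrightarrow> P \<noteq> 0 \<Longrightarrow> mon_map \<sigma> P \<noteq> 0"
  using supp_mon_map[of \<sigma> P] by auto

lemma ev_sum_supp: "ev x y P = (\<Sum>q\<in>supp P. ratfun2_const (coeff (coeff P (snd q)) (fst q)) * x ^ fst q * y ^ snd q)"
  by (subst poly_poly_eq_sum_supp[of P]) (simp add: ev.hom_sum split_def)

text \<open>\<open>z\<close> is the factor common to all transformed monomials, such as the power of
  the exceptional equation after a blow-up.\<close>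

lemma ev_mon_map:
  assumes "\<And>i j. (i, j) \<in> supp P \<Longrightarrow> z * (x' ^ fst (\<sigma> (i, j)) * y' ^ snd (\<sigma> (i, j))) = x ^ i * y ^ j"
  shows "ev x y P = z * ev x' y' (mon_map \<sigma> P)"
proof -
  have "z * ev x' y' (mon_map \<sigma> P) = (\<Sum>q\<in>supp P. z * (ratfun2_const (coeff (coeff P (snd q)) (fst q)) * x' ^ fst (\<sigma> q) * y' ^ snd (\<sigma> q)))"
    by (simp add: mon_map_def ev.hom_sum sum_distrib_left)
  also have "\<dots> = (\<Sum>q\<in>supp P. ratfun2_const (coeff (coeff P (snd q)) (fst q)) * x ^ fst q * y ^ snd q)"
  proof (intro sum.cong refl)
    fix q assume "q \<in> supp P"
    then have "z * (x' ^ fst (\<sigma> q) * y' ^ snd (\<sigma> q)) = x ^ fst q * y ^ snd q"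
      using assms[of "fst q" "snd q"] by simp
    then show "z * (ratfun2_const (coeff (coeff P (snd q)) (fst q)) * x' ^ fst (\<sigma> q) * y' ^ snd (\<sigma> q)) =
      ratfun2_const (coeff (coeff P (snd q)) (fst q)) * x ^ fst q * y ^ snd q"
      by (metis (no_types, lifting) mult.assoc mult.left_commute)
  qed
  finally show ?thesis by (simp add: ev_sum_supp)
qed

section \<open>Translations of the variables\<close>

definition shift_x :: "'k::comm_ring_1 \<Rightarrow> 'k poly poly \<Rightarrow> 'k poly poly"
  where "shift_x a P = map_poly (\<lambda>p. pcompose p [:a, 1:]) P"

definition shift_y :: "'k::comm_ring_1 \<Rightarrow> 'k poly poly \<Rightarrow> 'k poly poly"
  where "shift_y b P = pcompose P [:[:b:], 1:]"

lemma ev1_pcompose: "ev1 x (pcompose p q) = ev1 (ev1 x q) p"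
  by (induction p) (auto simp: pcompose_pCons hom_distribs algebra_simps)

lemma shift_x_pCons: "shift_x a (pCons p P) = pCons (pcompose p [:a, 1:]) (shift_x a P)"
  by (cases "p = 0 \<and> P = 0") (auto simp: shift_x_def map_poly_pCons)

lemma shift_x_0 [simp]: "shift_x a 0 = 0" by (simp add: shift_x_def)
lemma shift_y_0 [simp]: "shift_y a 0 = 0" by (simp add: shift_y_def)

lemma ev_shift_x: "ev x y (shift_x a P) = ev (x + ratfun2_const a) y P"
  by (induction P) (auto simp: shift_x_pCons ev1_pcompose algebra_simps)

lemma ev_shift_y: "ev x y (shift_y b P) = ev x (y + ratfun2_const b) P"
  unfolding shift_y_def
proof (induction P)
  case (pCons p P)
  then show ?case
    by (simp add: pcompose_pCons ev.hom_add ev.hom_mult algebra_simps del: mult_pCons_left)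
qed simp

lemma shift_x_eq_0_iff [simp]: "shift_x (a::'k::idom) P = 0 \<longleftrightarrow> P = 0"
proof
  assume "shift_x a P = 0"
  then have "pcompose (coeff P j) [:a, 1:] = 0" for j
    by (metis shift_x_def coeff_0 coeff_map_poly pcompose_0)
  then have "coeff P j = 0" for j
    by (simp add: pcompose_eq_0_iff)
  then show "P = 0"
    by (simp add: poly_eq_iff)
qed simp

lemma shift_y_eq_0_iff [simp]: "shift_y (b::'k::idom) P = 0 \<longleftrightarrow> P = 0"
  by (auto simp: shift_y_def pcompose_eq_0_iff)

text \<open>A translation turns a monomial into lower powers of the translated variable, so exponent
  regions closed downwards are preserved.\<close>

lemma supp_shift_x:
  fixes a :: "'k::idom"
  assumes "(i, j) \<in> supp (shift_x a P)"
  shows "\<exists>i'\<ge>i. (i', j) \<in> supp P"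
proof -
  have *: "coeff (shift_x a P) j = pcompose (coeff P j) [:a, 1:]"
    by (simp add: shift_x_def coeff_map_poly)
  with assms have "coeff (pcompose (coeff P j) [:a, 1:]) i \<noteq> 0"
    by (simp add: supp_iff)
  then have "i \<le> degree (coeff P j)" "coeff P j \<noteq> 0"
    by (auto dest: le_degree)
  then show ?thesis by (intro exI[of _ "degree (coeff P j)"]) (auto simp: supp_iff)
qed

lemma supp_pCons: "supp (pCons p P) = {(i, 0) |i. coeff p i \<noteq> 0} \<union> {(i, Suc j) |i j. (i, j) \<in> supp P}"
proof (rule Set.set_eqI)
  show "q \<in> supp (pCons p P) \<longleftrightarrow> q \<in> {(i, 0) |i. coeff p i \<noteq> 0} \<union> {(i, Suc j) |i j. (i, j) \<in> supp P}" for q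
    by (cases q; cases "snd q") (auto simp: supp_def)
qed

lemma supp_add: "supp (P + Q) \<subseteq> supp P \<union> supp Q"
  by (auto simp: supp_def)

lemma supp_shift_y:
  fixes b :: "'k::comm_ring_1"
  assumes "(i, j) \<in> supp (shift_y b P)"
  shows "\<exists>j'\<ge>j. (i, j') \<in> supp P"
  using assms
proof (induction P arbitrary: i j)
  case 0 then show ?case by simp
next
  case (pCons p P)
  have eq: "shift_y b (pCons p P) = [:p:] + (Polynomial.smult [:b:] (shift_y b P) + pCons 0 (shift_y b P))"
    by (simp add: shift_y_def pcompose_pCons)
  consider "(i, j) \<in> supp [:p:]" | "(i, j) \<in> supp (Polynomial.smult [:b:] (shift_y b P))"
    | "(i, j) \<in> supp (pCons 0 (shift_y b P))"
    using pCons.prems supp_add unfolding eq by blast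
  then show ?case
  proof cases
    case 1
    then show ?thesis by (auto simp: supp_pCons)
  next
    case 2
    then have "(i, j) \<in> supp (shift_y b P)"
      by (auto simp: supp_iff)
    from pCons.IH[OF this] obtain j' where "j' \<ge> j" "(i, j') \<in> supp P" by blast
    then show ?thesis by (intro exI[of _ "Suc j'"]) (auto simp: supp_pCons)
  next
    case 3
    then obtain j0 where j0: "j = Suc j0" "(i, j0) \<in> supp (shift_y b P)"
      by (auto simp: supp_pCons)
    from pCons.IH[OF this(2)] obtain j' where "j' \<ge> j0" "(i, j') \<in> supp P" by blast
    then show ?thesis using j0 by (intro exI[of _ "Suc j'"]) (auto simp: supp_pCons)
  qed
qed

text \<open>The restriction of \<open>P\<close> to the line where the first variable
  vanishes.\<close>

definition row_0 :: "'k::zero poly poly \<Rightarrow> 'k poly"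
  where "row_0 P = map_poly (\<lambda>p. coeff p 0) P"

lemma coeff_row_0: "coeff (row_0 P) j = coeff (coeff P j) 0"
  by (simp add: row_0_def coeff_map_poly)

lemma row_0_pCons: "row_0 (pCons p P) = pCons (coeff p 0) (row_0 P)"
  by (rule poly_eqI) (auto simp: coeff_row_0 coeff_pCons split: nat.splits)

lemma row_0_nonzero: "(0, j) \<in> supp P \<Longrightarrow> row_0 P \<noteq> 0"
  by (auto simp: supp_iff simp flip: coeff_row_0)

lemma row_0_shift_y:
  fixes b :: "'k::comm_ring_1"
  shows "row_0 (shift_y b P) = pcompose (row_0 P) [:b, 1:]"
proof (induction P)
  case 0
  show ?case by (simp add: row_0_def)
next
  case (pCons p P)
  have eq: "shift_y b (pCons p P) = [:p:] + (Polynomial.smult [:b:] (shift_y b P) + pCons 0 (shift_y b P))"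
    by (simp add: shift_y_def pcompose_pCons)
  have add: "row_0 (P1 + P2) = row_0 P1 + row_0 P2" for P1 P2 :: "'k poly poly"
    by (rule poly_eqI) (auto simp: coeff_row_0)
  have smult: "row_0 (Polynomial.smult [:b:] P1) = Polynomial.smult b (row_0 P1)" for P1
    by (rule poly_eqI) (auto simp: coeff_row_0)
  have zero: "row_0 0 = (0 :: 'k poly)" by (simp add: row_0_def)
  show ?case unfolding eq add smult row_0_pCons zero pCons.IH by (simp add: pcompose_pCons)
qed

text \<open>Translation keeps the degree of the restriction to the line, so its top monomial is a
  common witness. In the blow-up induction this bounds the multiplicity at the next centre.\<close>

lemma supp_shift_y_row_0:
  fixes b :: "'k::idom"
  assumes "(0, j) \<in> supp P"
  shows "\<exists>j'. (0, j') \<in> supp P \<and> (0, j') \<in> supp (shift_y b P)"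
proof -
  let ?d = "degree (row_0 P)"
  have nz: "row_0 P \<noteq> 0" by (rule row_0_nonzero) fact
  then have "degree (row_0 (shift_y b P)) = ?d" "row_0 (shift_y b P) \<noteq> 0"
    unfolding row_0_shift_y by (auto simp: pcompose_eq_0_iff)
  then have "coeff (row_0 (shift_y b P)) ?d \<noteq> 0" by (metis leading_coeff_neq_0)
  with nz show ?thesis
    by (intro exI[of _ ?d]) (auto simp: supp_iff simp flip: coeff_row_0)
qed

lemma ev_t1_t2: "ev t1 t2 P = to_fract P"
proof -
  have const: "ev1 t1 p = to_fract [:p:]" for p :: "'k::field poly"
  proof (induction p)
    case (pCons c p)
    have "to_fract [:pCons c p:] = to_fract ([:[:c:]:] + [:[:0, 1:]:] * [:p:])" by simp
    then show ?case by (simp only: ev1_pCons pCons.IH ratfun2_const_def t1_def[symmetric] to_fract_mult to_fract_add)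
  qed simp
  show ?thesis
  proof (induction P)
    case (pCons p P)
    have "to_fract (pCons p P) = to_fract ([:p:] + [:0, 1:] * P)" by simp
    then show ?case by (simp only: ev_pCons pCons.IH const t2_def[symmetric] to_fract_mult to_fract_add)
  qed simp
qed

lemma ev_t1_t2_eq_0_iff [simp]: "ev t1 t2 P = 0 \<longleftrightarrow> P = 0"
  by (simp add: ev_t1_t2)

lemma ratfun2_cases:
  obtains A B where "B \<noteq> 0" "f = ev t1 t2 A / ev t1 t2 B"
  by (metis Fract_cases Fract_conv_to_fract ev_t1_t2)

lemma t1_nonzero [simp]: "t1 \<noteq> 0" and t2_nonzero [simp]: "t2 \<noteq> 0"
  by (simp_all add: t1_def t2_def)

section \<open>Elementary Cremona transformations\<close>

locale ratfun2_hom = field_hom \<phi> for \<phi> :: "'k::field ratfun2 \<Rightarrow> 'k ratfun2" +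
  assumes hom_const [simp]: "\<phi> (ratfun2_const c) = ratfun2_const c"
begin

lemma hom_ev1: "\<phi> (ev1 x p) = ev1 (\<phi> x) p"
  by (induction p) (auto simp: hom_distribs)

lemma hom_ev: "\<phi> (ev x y P) = ev (\<phi> x) (\<phi> y) P"
  by (induction P) (auto simp: hom_distribs hom_ev1)

end

lemma ratfun2_hom_ext:
  fixes \<phi> \<psi> :: "'k::field ratfun2 \<Rightarrow> 'k ratfun2"
  assumes "ratfun2_hom \<phi>" "ratfun2_hom \<psi>" "\<phi> t1 = \<psi> t1" "\<phi> t2 = \<psi> t2"
  shows "\<phi> = \<psi>"
proof
  fix f :: "'k ratfun2"
  interpret \<phi>: ratfun2_hom \<phi> by fact
  interpret \<psi>: ratfun2_hom \<psi> by fact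
  obtain A B where "f = ev t1 t2 A / ev t1 t2 B" by (rule ratfun2_cases)
  then show "\<phi> f = \<psi> f"
    by (simp add: \<phi>.hom_div \<psi>.hom_div \<phi>.hom_ev \<psi>.hom_ev assms)
qed

lemma ratfun2_hom_comp: "ratfun2_hom \<phi> \<Longrightarrow> ratfun2_hom \<psi> \<Longrightarrow> ratfun2_hom (\<phi> \<circ> \<psi>)"
proof -
  assume "ratfun2_hom \<phi>" "ratfun2_hom \<psi>"
  then interpret \<phi>: ratfun2_hom \<phi> + \<psi>: ratfun2_hom \<psi> .
  show ?thesis by unfold_locales (simp_all add: \<phi>.hom_add \<psi>.hom_add \<phi>.hom_mult \<psi>.hom_mult)
qed

lemma ratfun2_hom_id: "ratfun2_hom id"
  by unfold_locales simp_all

lemma carrier_Cr2: "carrier Cr2 = {\<phi>. bij \<phi> \<and> ratfun2_hom \<phi>}"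
proof -
  have "ratfun2_hom \<phi>" if "\<forall>x y. \<phi> (x + y) = \<phi> x + \<phi> y" "\<forall>x y. \<phi> (x * y) = \<phi> x * \<phi> y"
    "\<forall>c. \<phi> (ratfun2_const c) = ratfun2_const c" for \<phi> :: "'k::field ratfun2 \<Rightarrow> 'k ratfun2"
    using that(3)[rule_format, of 0] that(3)[rule_format, of 1] that
    by unfold_locales simp_all
  moreover have "\<forall>x y. \<phi> (x + y) = \<phi> x + \<phi> y" "\<forall>x y. \<phi> (x * y) = \<phi> x * \<phi> y"
    "\<forall>c. \<phi> (ratfun2_const c) = ratfun2_const c" if "ratfun2_hom \<phi>" for \<phi> :: "'k::field ratfun2 \<Rightarrow> 'k ratfun2"
  proof -
    interpret \<phi>: ratfun2_hom \<phi> by fact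
    show "\<forall>x y. \<phi> (x + y) = \<phi> x + \<phi> y" "\<forall>x y. \<phi> (x * y) = \<phi> x * \<phi> y"
      "\<forall>c. \<phi> (ratfun2_const c) = ratfun2_const c" by (simp_all add: \<phi>.hom_add \<phi>.hom_mult)
  qed
  ultimately show ?thesis unfolding Cr2_def by simp blast
qed

lemma mult_Cr2 [simp]: "\<phi> \<otimes>\<^bsub>Cr2\<^esub> \<psi> = \<phi> \<circ> \<psi>" and one_Cr2 [simp]: "\<one>\<^bsub>Cr2\<^esub> = id"
  by (simp_all add: Cr2_def)

lemma Cr2I:
  assumes "ratfun2_hom \<phi>" "ratfun2_hom \<psi>"
    and "\<phi> (\<psi> t1) = t1" "\<phi> (\<psi> t2) = t2" "\<psi> (\<phi> t1) = t1" "\<psi> (\<phi> t2) = t2"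
  shows "\<phi> \<in> carrier Cr2"
proof -
  have "\<phi> \<circ> \<psi> = id" "\<psi> \<circ> \<phi> = id"
    using assms by (auto intro!: ratfun2_hom_ext ratfun2_hom_comp ratfun2_hom_id)
  then show ?thesis using assms(1) o_bij by (auto simp: carrier_Cr2)
qed

text \<open>The substitution \<open>t1 \<mapsto> a\<close>, \<open>t2 \<mapsto> b\<close> on
  fractions. The chosen representation does not matter as soon as \<open>ev a b\<close> kills no
  nonzero polynomial, which is the assumption of the following context.\<close>

definition sub :: "'k::field ratfun2 \<Rightarrow> 'k ratfun2 \<Rightarrow> 'k ratfun2 \<Rightarrow> 'k ratfun2"
  where "sub a b f = (let (A, B) = SOME (A, B). B \<noteq> 0 \<and> f = ev t1 t2 A / ev t1 t2 B in ev a b A / ev a b B)"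

context
  fixes a b :: "'k::field ratfun2"
  assumes inj: "\<And>P. P \<noteq> 0 \<Longrightarrow> ev a b P \<noteq> 0"
begin

lemma sub_eq:
  assumes "B \<noteq> 0"
  shows "sub a b (ev t1 t2 A / ev t1 t2 B) = ev a b A / ev a b B"
proof -
  let ?P = "\<lambda>(A', B'). B' \<noteq> 0 \<and> ev t1 t2 A / ev t1 t2 B = ev t1 t2 A' / ev t1 t2 B'"
  obtain A' B' where AB: "(SOME q. ?P q) = (A', B')" by (cases "SOME q. ?P q")
  have "?P (SOME q. ?P q)" by (rule someI[of ?P "(A, B)"]) (use assms in simp)
  then have B': "B' \<noteq> 0" and "ev t1 t2 A / ev t1 t2 B = ev t1 t2 A' / ev t1 t2 B'"
    unfolding AB by auto
  then have "ev t1 t2 (A * B') = ev t1 t2 (A' * B)"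
    using assms by (simp add: frac_eq_eq ev.hom_mult)
  then have "A * B' = A' * B" by (simp only: ev_t1_t2 to_fract_eq_iff)
  then have "ev a b A * ev a b B' = ev a b A' * ev a b B" by (metis ev.hom_mult)
  then have "ev a b A / ev a b B = ev a b A' / ev a b B'"
    using assms B' inj by (simp add: frac_eq_eq)
  then show ?thesis by (simp add: sub_def AB)
qed

lemma sub_ev: "sub a b (ev t1 t2 A) = ev a b A"
  using sub_eq[of 1 A] by simp

lemma sub_t1 [simp]: "sub a b t1 = a"
  using sub_ev[of "[:[:0, 1:]:]"] by simp

lemma sub_t2 [simp]: "sub a b t2 = b"
  using sub_ev[of "[:0, 1:]"] by simp

lemma ratfun2_hom_sub: "ratfun2_hom (sub a b)"
proof
  show "sub a b 0 = 0" "sub a b 1 = 1" using sub_ev[of 0] sub_ev[of 1] by simp_all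
  show "sub a b (ratfun2_const c) = ratfun2_const c" for c
    using sub_ev[of "[:[:c:]:]"] by simp
  fix f g :: "'k ratfun2"
  obtain A B where AB: "B \<noteq> 0" "f = ev t1 t2 A / ev t1 t2 B" by (rule ratfun2_cases)
  obtain C D where CD: "D \<noteq> 0" "g = ev t1 t2 C / ev t1 t2 D" by (rule ratfun2_cases)
  have "f * g = ev t1 t2 (A * C) / ev t1 t2 (B * D)" using AB CD by (simp add: ev.hom_mult)
  moreover have "B * D \<noteq> 0" using AB CD by simp
  ultimately show "sub a b (f * g) = sub a b f * sub a b g"
    using AB CD by (simp add: sub_eq) (simp add: ev.hom_mult)
  have "f + g = ev t1 t2 (A * D + C * B) / ev t1 t2 (B * D)"
    unfolding AB(2) CD(2) using AB(1) CD(1) by (simp add: ev.hom_mult ev.hom_add field_simps)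
  then show "sub a b (f + g) = sub a b f + sub a b g"
    using AB CD inj \<open>B * D \<noteq> 0\<close> by (simp add: sub_eq) (simp add: ev.hom_mult ev.hom_add field_simps)
qed

end

definition swap :: "'k::field ratfun2 \<Rightarrow> 'k ratfun2" where "swap = sub t2 t1"
definition inv_y :: "'k::field ratfun2 \<Rightarrow> 'k ratfun2" where "inv_y = sub t1 (inverse t2)"
definition add_y :: "'k::field \<Rightarrow> 'k ratfun2 \<Rightarrow> 'k ratfun2" where "add_y b = sub t1 (t2 + ratfun2_const b)"
definition scale_y :: "'k::field \<Rightarrow> 'k ratfun2 \<Rightarrow> 'k ratfun2" where "scale_y c = sub t1 (ratfun2_const c * t2)"
definition mul_xy :: "'k::field ratfun2 \<Rightarrow> 'k ratfun2" where "mul_xy = sub t1 (t1 * t2)"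

lemma ev_swap: "ev y x P = ev x y (mon_map (\<lambda>(i, j). (j, i)) P)"
  by (subst ev_mon_map[where x' = x and y' = y and z = 1 and \<sigma> = "\<lambda>(i, j). (j, i)"]) auto

lemma ev_inverse_y:
  assumes "y \<noteq> 0" "\<And>i j. (i, j) \<in> supp P \<Longrightarrow> j \<le> d"
  shows "ev x y P = y ^ d * ev x (inverse y) (mon_map (\<lambda>(i, j). (i, d - j)) P)"
proof (rule ev_mon_map)
  fix i j assume "(i, j) \<in> supp P"
  with assms have "j \<le> d" by auto
  then have "y ^ d = y ^ (d - j) * y ^ j" by (simp flip: power_add)
  then show "y ^ d * (x ^ fst ((\<lambda>(i, j). (i, d - j)) (i, j)) * inverse y ^ snd ((\<lambda>(i, j). (i, d - j)) (i, j))) = x ^ i * y ^ j"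
    using assms(1) by (simp add: power_inverse field_simps)
qed

lemma supp_degree: "(i, j) \<in> supp P \<Longrightarrow> j \<le> degree P"
  using supp_subset by fastforce

lemma swap_inj: "P \<noteq> 0 \<Longrightarrow> ev t2 t1 P \<noteq> 0"
  by (simp add: ev_swap[of t2 t1] mon_map_nonzero inj_on_def split_def prod_eq_iff)

lemma inv_y_inj: assumes "P \<noteq> 0" shows "ev t1 (inverse t2) P \<noteq> 0"
proof -
  have "ev t1 (inverse t2) P = inverse t2 ^ degree P * ev t1 t2 (mon_map (\<lambda>(i, j). (i, degree P - j)) P)"
    using ev_inverse_y[of "inverse t2" P "degree P" t1] by (simp add: supp_degree)
  moreover have "inj_on (\<lambda>(i, j). (i, degree P - j)) (supp P)"
    by (auto intro!: inj_onI dest!: supp_degree)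
  ultimately show ?thesis using assms by (simp add: mon_map_nonzero)
qed

lemma add_y_inj: "P \<noteq> 0 \<Longrightarrow> ev t1 (t2 + ratfun2_const b) P \<noteq> 0"
  by (simp flip: ev_shift_y)

lemma ev_scale_y: "ev x (ratfun2_const c * y) P = ev x y (pcompose P [:0, [:c:]:])"
proof (induction P)
  case (pCons p P)
  then show ?case
    by (simp add: pcompose_pCons ev.hom_add ev.hom_mult algebra_simps del: mult_pCons_left)
qed simp

lemma scale_y_inj: "c \<noteq> 0 \<Longrightarrow> P \<noteq> 0 \<Longrightarrow> ev t1 (ratfun2_const c * t2) P \<noteq> 0"
  by (auto simp: ev_scale_y pcompose_eq_0_iff)

lemma mul_xy_inj: "P \<noteq> 0 \<Longrightarrow> ev t1 (t1 * t2) P \<noteq> 0"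
proof -
  assume "P \<noteq> 0"
  have "ev t1 (t1 * t2) P = 1 * ev t1 t2 (mon_map (\<lambda>(i, j). (i + j, j)) P)"
    by (rule ev_mon_map) (simp add: power_mult_distrib power_add)
  moreover have "inj_on (\<lambda>(i, j). (i + j, j)) (supp P)" by (auto simp: inj_on_def)
  ultimately show ?thesis using \<open>P \<noteq> 0\<close> by (simp add: mon_map_nonzero)
qed

lemma ratfun2_hom_moves:
  "ratfun2_hom swap" "ratfun2_hom inv_y" "ratfun2_hom (add_y b)" "ratfun2_hom mul_xy"
  "c \<noteq> 0 \<Longrightarrow> ratfun2_hom (scale_y c)"
  unfolding swap_def inv_y_def add_y_def scale_y_def mul_xy_def
  by (intro ratfun2_hom_sub swap_inj inv_y_inj add_y_inj mul_xy_inj scale_y_inj; assumption)+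

lemma moves_t1 [simp]:
  "swap t1 = t2" "inv_y t1 = t1" "add_y b t1 = t1" "mul_xy t1 = t1" "c \<noteq> 0 \<Longrightarrow> scale_y c t1 = t1"
  and moves_t2 [simp]:
  "swap t2 = t1" "inv_y t2 = inverse t2" "add_y b t2 = t2 + ratfun2_const b" "mul_xy t2 = t1 * t2"
  "c \<noteq> 0 \<Longrightarrow> scale_y c t2 = ratfun2_const c * t2"
  unfolding swap_def inv_y_def add_y_def scale_y_def mul_xy_def
  by (simp_all add: swap_inj inv_y_inj add_y_inj mul_xy_inj scale_y_inj)

interpretation swap: ratfun2_hom swap by (rule ratfun2_hom_moves)
interpretation inv_y: ratfun2_hom inv_y by (rule ratfun2_hom_moves)
interpretation add_y: ratfun2_hom "add_y b" for b by (rule ratfun2_hom_moves)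
interpretation mul_xy: ratfun2_hom mul_xy by (rule ratfun2_hom_moves)

lemma swap_Cr2 [simp]: "swap \<in> carrier Cr2"
  by (rule Cr2I[OF ratfun2_hom_moves(1) ratfun2_hom_moves(1)]) simp_all

lemma inv_y_Cr2 [simp]: "inv_y \<in> carrier Cr2"
  by (rule Cr2I[OF ratfun2_hom_moves(2) ratfun2_hom_moves(2)]) (simp_all add: inv_y.hom_inverse)

lemma add_y_Cr2 [simp]: "add_y b \<in> carrier Cr2"
  by (rule Cr2I[OF ratfun2_hom_moves(3) ratfun2_hom_moves(3)[of "- b"]])
    (simp_all add: hom_distribs add_y.hom_minus add_y.hom_add const.hom_uminus)

lemma scale_y_Cr2 [simp]: "c \<noteq> 0 \<Longrightarrow> scale_y c \<in> carrier Cr2"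
proof -
  assume c: "c \<noteq> 0"
  interpret s: ratfun2_hom "scale_y c" by (rule ratfun2_hom_moves) fact
  interpret s': ratfun2_hom "scale_y (inverse c)" by (rule ratfun2_hom_moves) (simp add: c)
  show ?thesis
    by (rule Cr2I[OF s.ratfun2_hom_axioms s'.ratfun2_hom_axioms])
      (use c in \<open>simp_all add: s.hom_mult s'.hom_mult const.hom_inverse s.hom_inverse s'.hom_inverse\<close>)
qed

lemma mul_xy_Cr2 [simp]: "mul_xy \<in> carrier Cr2"
  \<comment> \<open>Conjugation by \<open>inv_y\<close> turns multiplication by \<open>t1\<close>
    into division by it.\<close>
  by (rule Cr2I[OF ratfun2_hom_moves(4) ratfun2_hom_comp[OF ratfun2_hom_comp[OF ratfun2_hom_moves(2) ratfun2_hom_moves(4)] ratfun2_hom_moves(2)]])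
    (simp_all add: inv_y.hom_inverse inv_y.hom_mult mul_xy.hom_inverse mul_xy.hom_mult)

section \<open>The Jacobian determinant\<close>

definition num_den :: "'a::idom fract \<Rightarrow> 'a \<times> 'a"
  where "num_den f = (SOME (a, b). b \<noteq> 0 \<and> f = to_fract a / to_fract b)"

definition num :: "'a::idom fract \<Rightarrow> 'a" where "num f = fst (num_den f)"
definition den :: "'a::idom fract \<Rightarrow> 'a" where "den f = snd (num_den f)"

lemma den_nonzero [simp]: "den f \<noteq> 0" and num_den_eq: "to_fract (num f) / to_fract (den f) = f"
proof -
  have "\<exists>q. case q of (a, b) \<Rightarrow> b \<noteq> 0 \<and> f = to_fract a / to_fract b"
    by (cases f) (auto simp: Fract_conv_to_fract)
  from someI_ex[OF this] show "den f \<noteq> 0" "to_fract (num f) / to_fract (den f) = f"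
    by (simp_all add: num_def den_def num_den_def split_def)
qed

lemma num_eq_0_iff [simp]: "num f = 0 \<longleftrightarrow> f = 0"
proof
  assume "num f = 0" then show "f = 0" using num_den_eq[of f] by simp
next
  assume "f = 0"
  then have "to_fract (num f) / to_fract (den f) = 0" by (simp only: num_den_eq)
  then show "num f = 0" by simp
qed

lemma num_den_cross: "b \<noteq> 0 \<Longrightarrow> f = to_fract a / to_fract b \<Longrightarrow> num f * b = a * den f"
proof -
  assume b: "b \<noteq> 0" and f: "f = to_fract a / to_fract b"
  have "to_fract (num f) / to_fract (den f) = to_fract a / to_fract b"
    by (rule trans[OF num_den_eq f])
  then have "to_fract (num f * b) = to_fract (a * den f)"
    using b by (simp add: frac_eq_eq)
  then show ?thesis by (simp only: to_fract_eq_iff)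
qed

locale derivation =
  fixes D :: "'a::idom \<Rightarrow> 'a"
  assumes add: "D (a + b) = D a + D b" and leibniz: "D (a * b) = D a * b + a * D b"
begin

text \<open>Quotient rule in the form \<open>(D a - f * D b) / b\<close>, which avoids the square of
  the denominator.\<close>

definition ext :: "'a fract \<Rightarrow> 'a fract"
  where "ext f = (to_fract (D (num f)) - f * to_fract (D (den f))) / to_fract (den f)"

lemma ext_eq:
  assumes b: "b \<noteq> 0" and f: "f = to_fract a / to_fract b"
  shows "ext f = (to_fract (D a) - f * to_fract (D b)) / to_fract b"
proof -
  let ?t = "to_fract :: 'a \<Rightarrow> 'a fract"
  have "D (num f * b) = D (a * den f)" using num_den_cross[OF b f] by simp
  then have "?t (D (num f) * b + num f * D b) = ?t (D a * den f + a * D (den f))"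
    by (simp only: leibniz)
  then have *: "?t (D (num f)) * ?t b + ?t (num f) * ?t (D b) = ?t (D a) * ?t (den f) + ?t a * ?t (D (den f))"
    by simp
  have n: "?t (num f) = f * ?t (den f)" "?t a = f * ?t b"
    using num_den_eq[of f] nonzero_divide_eq_eq[of "?t (den f)" "?t (num f)" f] b by (simp, simp add: f)
  have "(?t (D (num f)) - f * ?t (D (den f))) * ?t b = (?t (D a) - f * ?t (D b)) * ?t (den f)"
    using * unfolding n by (simp add: algebra_simps)
  then show ?thesis using b by (simp add: ext_def frac_eq_eq)
qed

lemma D_1 [simp]: "D 1 = 0" using leibniz[of 1 1] by (metis add_cancel_right_right mult_1 mult_1_right)
lemma D_0 [simp]: "D 0 = 0" using add[of 0 0] by (metis add_cancel_right_right add_0)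

lemma ext_to_fract: "ext (to_fract a) = to_fract (D a)"
  by (subst ext_eq[of 1 _ a]) simp_all

lemma ext_derivation: "derivation ext"
proof
  fix f g :: "'a fract"
  let ?t = "to_fract :: 'a \<Rightarrow> 'a fract"
  define a b c d where "a = num f" "b = den f" "c = num g" "d = den g"
  have nz: "b \<noteq> 0" "d \<noteq> 0" "b * d \<noteq> 0" by (simp_all add: a_b_c_d_def)
  have f: "f = ?t a / ?t b" and g: "g = ?t c / ?t d"
    by (simp_all add: a_b_c_d_def num_den_eq)
  have ac: "?t a = f * ?t b" "?t c = g * ?t d" using nz by (simp_all add: f g)
  have "f + g = ?t (a * d + c * b) / ?t (b * d)" using nz by (simp add: ac add_divide_distrib)
  note e1 = ext_eq[OF nz(3) this]
  have "f * g = ?t (a * c) / ?t (b * d)" using nz by (simp add: ac)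
  note e2 = ext_eq[OF nz(3) this]
  have ef: "ext f * ?t b = ?t (D a) - f * ?t (D b)" and eg: "ext g * ?t d = ?t (D c) - g * ?t (D d)"
    using ext_eq[OF nz(1) f] ext_eq[OF nz(2) g] nz by simp_all
  have "ext (f + g) * ?t (b * d) = (ext f + ext g) * ?t (b * d)"
  proof -
    have "ext (f + g) * ?t (b * d) = ?t (D (a * d + c * b)) - (f + g) * ?t (D (b * d))"
      unfolding e1 using nz by simp
    also have "\<dots> = (?t (D a) - f * ?t (D b)) * ?t d + (?t (D c) - g * ?t (D d)) * ?t b"
      by (simp add: add leibniz ac algebra_simps)
    also have "\<dots> = (ext f + ext g) * ?t (b * d)"
      unfolding ef[symmetric] eg[symmetric] by (simp add: algebra_simps)
    finally show ?thesis .
  qed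
  then show "ext (f + g) = ext f + ext g" using nz by simp
  have "ext (f * g) * ?t (b * d) = (ext f * g + f * ext g) * ?t (b * d)"
  proof -
    have "ext (f * g) * ?t (b * d) = ?t (D (a * c)) - (f * g) * ?t (D (b * d))"
      unfolding e2 using nz by simp
    also have "\<dots> = (?t (D a) - f * ?t (D b)) * (g * ?t d) + (?t (D c) - g * ?t (D d)) * (f * ?t b)"
      by (simp add: add leibniz ac algebra_simps)
    also have "\<dots> = (ext f * g + f * ext g) * ?t (b * d)"
      unfolding ef[symmetric] eg[symmetric] by (simp add: algebra_simps)
    finally show ?thesis .
  qed
  then show "ext (f * g) = ext f * g + f * ext g" using nz by simp
qed

end

lemma derivation_pderiv: "derivation (pderiv :: 'a::idom poly \<Rightarrow> 'a poly)"
  by unfold_locales (simp_all add: pderiv_add pderiv_mult algebra_simps)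

lemma derivation_map_poly:
  assumes "derivation D"
  shows "derivation (map_poly D)"
proof -
  interpret derivation D by fact
  have add': "map_poly D (P + Q) = map_poly D P + map_poly D Q" for P Q
    by (rule poly_eqI) (simp add: coeff_map_poly add)
  have smult': "map_poly D (Polynomial.smult c P) = Polynomial.smult (D c) P + Polynomial.smult c (map_poly D P)" for c P
    by (rule poly_eqI) (simp add: coeff_map_poly leibniz)
  have pCons': "map_poly D (pCons c P) = pCons (D c) (map_poly D P)" for c P
    by (rule poly_eqI) (simp add: coeff_map_poly coeff_pCons split: nat.splits)
  show ?thesis
  proof
    show "map_poly D (P * Q) = map_poly D P * Q + P * map_poly D Q" for P Q
      by (induction P) (simp_all add: pCons' add' smult' algebra_simps)
  qed (rule add')
qed

interpretation dt1: derivation "map_poly pderiv :: 'k::field poly poly \<Rightarrow> _"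
  by (rule derivation_map_poly[OF derivation_pderiv])

interpretation dt2: derivation "pderiv :: 'k::field poly poly \<Rightarrow> _"
  by (rule derivation_pderiv)

interpretation ext_dt1: derivation "dt1.ext :: 'k::field ratfun2 \<Rightarrow> _"
  by (rule dt1.ext_derivation)

interpretation ext_dt2: derivation "dt2.ext :: 'k::field ratfun2 \<Rightarrow> _"
  by (rule dt2.ext_derivation)

text \<open>The coefficient of \<open>df \<and> dg\<close> with respect to
  \<open>dt1 \<and> dt2\<close>.\<close>

definition jac :: "'k::field ratfun2 \<Rightarrow> 'k ratfun2 \<Rightarrow> 'k ratfun2"
  where "jac f g = dt1.ext f * dt2.ext g - dt2.ext f * dt1.ext g"

lemma jac_add: "jac (f + g) h = jac f h + jac g h" "jac h (f + g) = jac h f + jac h g"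
  by (simp_all add: jac_def ext_dt1.add ext_dt2.add algebra_simps)

lemma jac_mult: "jac (f * g) h = f * jac g h + g * jac f h" "jac h (f * g) = f * jac h g + g * jac h f"
  by (simp_all add: jac_def ext_dt1.leibniz ext_dt2.leibniz algebra_simps)

lemma jac_self [simp]: "jac f f = 0"
  by (simp add: jac_def algebra_simps)

lemma jac_antisym: "jac g f = - jac f g"
  by (simp add: jac_def algebra_simps)

lemma jac_const [simp]: "jac (ratfun2_const c) f = 0" "jac f (ratfun2_const c) = 0"
proof -
  have "map_poly pderiv [:[:c:]:] = 0"
    by (rule poly_eqI) (simp add: coeff_map_poly coeff_pCons pderiv_pCons split: nat.splits)
  then show "jac (ratfun2_const c) f = 0" "jac f (ratfun2_const c) = 0"
    by (simp_all add: jac_def ratfun2_const_def dt1.ext_to_fract dt2.ext_to_fract pderiv_pCons)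
qed

lemma jac_1 [simp]: "jac 1 f = 0" "jac f 1 = 0" and jac_0 [simp]: "jac 0 f = 0" "jac f 0 = 0"
  using jac_const(1)[of 1 f] jac_const(1)[of 0 f] jac_const(2)[of f 1] jac_const(2)[of f 0] by simp_all

lemma jac_t1_t2: "jac t1 t2 = 1"
proof -
  have "map_poly pderiv [:[:0, 1:]:] = (1 :: 'k::field poly poly)"
    by (rule poly_eqI) (auto simp: coeff_map_poly coeff_pCons pderiv_pCons one_pCons split: nat.splits)
  moreover have "map_poly pderiv [:0, 1:] = (0 :: 'k::field poly poly)"
    by (rule poly_eqI) (simp add: coeff_map_poly coeff_pCons split: nat.splits)
  ultimately show ?thesis
    by (simp add: jac_def t1_def t2_def dt1.ext_to_fract dt2.ext_to_fract pderiv_pCons flip: one_pCons)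
qed

lemma jac_inverse:
  assumes "f \<noteq> 0"
  shows "jac (inverse f) g = - jac f g / f ^ 2" "jac g (inverse f) = - jac g f / f ^ 2"
proof -
  have "f * jac (inverse f) g + inverse f * jac f g = jac (f * inverse f) g"
    by (simp only: jac_mult)
  then show *: "jac (inverse f) g = - jac f g / f ^ 2"
    using assms by (simp add: field_simps power2_eq_square add_eq_0_iff)
  show "jac g (inverse f) = - jac g f / f ^ 2"
    unfolding jac_antisym[of g "inverse f"] jac_antisym[of g f] * by simp
qed

lemma jac_power_self [simp]: "jac f (f ^ n) = 0"
  by (induction n) (simp_all add: jac_mult)

lemma jac_power_int_self [simp]: "jac f (f powi n) = 0"
proof (cases "f = 0")
  case False
  have "jac f (inverse f ^ m) = 0" for m
    using False by (induction m) (simp_all add: jac_mult jac_inverse)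
  then show ?thesis by (simp add: power_int_def)
qed simp

text \<open>\<open>jac _ h\<close> is a derivation killing constants, so its vanishing on two
  elements spreads to the field they generate.\<close>

lemma jac_hom_eq_0:
  assumes "ratfun2_hom \<phi>" "jac (\<phi> t1) h = 0" "jac (\<phi> t2) h = 0"
  shows "jac (\<phi> f) h = 0"
proof -
  interpret ratfun2_hom \<phi> by fact
  have 1: "jac (ev1 (\<phi> t1) p) h = 0" for p
    by (induction p) (simp_all add: jac_add jac_mult assms)
  have 2: "jac (ev (\<phi> t1) (\<phi> t2) P) h = 0" for P
    by (induction P) (simp_all add: jac_add jac_mult assms 1)
  obtain A B where B: "B \<noteq> 0" and f: "f = ev t1 t2 A / ev t1 t2 B" by (rule ratfun2_cases)
  have "ev (\<phi> t1) (\<phi> t2) B \<noteq> 0" using B by (simp flip: hom_ev)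
  moreover have "\<phi> f = ev (\<phi> t1) (\<phi> t2) A * inverse (ev (\<phi> t1) (\<phi> t2) B)"
    by (simp add: f hom_div hom_ev field_simps)
  ultimately show ?thesis by (simp add: jac_mult jac_inverse 2)
qed

text \<open>Surjectivity is what counts: in positive characteristic algebraically independent
  functions can have Jacobian zero. Here a vanishing Jacobian would spread from the images of
  \<open>t1\<close>, \<open>t2\<close> to the whole field, contradicting
  \<open>jac_t1_t2\<close>.\<close>

lemma jac_Cr2_nonzero:
  assumes "\<phi> \<in> carrier Cr2"
  shows "jac (\<phi> t1) (\<phi> t2) \<noteq> 0"
proof
  assume *: "jac (\<phi> t1) (\<phi> t2) = 0"
  have \<phi>: "ratfun2_hom \<phi>" and "surj \<phi>" using assms by (auto simp: carrier_Cr2 bij_def)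
  then obtain f g where fg: "\<phi> f = t1" "\<phi> g = t2" by (metis surjD)
  have "jac (\<phi> f) (\<phi> t2) = 0" by (rule jac_hom_eq_0[OF \<phi> *]) simp
  moreover have "jac (\<phi> f) (\<phi> t1) = 0"
    by (rule jac_hom_eq_0[OF \<phi>]) (simp_all add: jac_antisym[of "\<phi> t2" "\<phi> t1"] *)
  ultimately have "jac (\<phi> g) (\<phi> f) = 0"
    by - (rule jac_hom_eq_0[OF \<phi>], simp_all add: jac_antisym[of "\<phi> t1" "\<phi> f"] jac_antisym[of "\<phi> t2" "\<phi> f"])
  then show False by (simp add: fg jac_antisym[of t2 t1] jac_t1_t2)
qed

section \<open>Places of the generic fibre of \<open>t\<^sub>1\<close>\<close>

text \<open>Discrete valuations of \<open>K(t\<^sub>1,t\<^sub>2)\<close> trivial on \<open>K(t\<^sub>1)\<close>; \<open>\<epsilon>\<close> is the order of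
  \<open>dt\<^sub>1 \<and> dt\<^sub>2\<close> with the opposite sign.\<close>

locale place =
  fixes \<nu> :: "'k::field ratfun2 \<Rightarrow> int" and \<epsilon> :: int
  assumes mult: "a \<noteq> 0 \<Longrightarrow> b \<noteq> 0 \<Longrightarrow> \<nu> (a * b) = \<nu> a + \<nu> b"
    and add: "a \<noteq> 0 \<Longrightarrow> b \<noteq> 0 \<Longrightarrow> a + b \<noteq> 0 \<Longrightarrow> min (\<nu> a) (\<nu> b) \<le> \<nu> (a + b)"
    and const: "c \<noteq> 0 \<Longrightarrow> \<nu> (ratfun2_const c) = 0"
    and t1: "\<nu> t1 = 0"
    and jac: "a = 0 \<or> 0 \<le> \<nu> a \<Longrightarrow> b = 0 \<or> 0 \<le> \<nu> b \<Longrightarrow> jac a b \<noteq> 0 \<Longrightarrow> \<epsilon> \<le> \<nu> (jac a b)"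

definition ext_val :: "('a::idom \<Rightarrow> int) \<Rightarrow> 'a fract \<Rightarrow> int"
  where "ext_val v f = v (num f) - v (den f)"

locale valuation =
  fixes v :: "'a::idom \<Rightarrow> int"
  assumes mult: "a \<noteq> 0 \<Longrightarrow> b \<noteq> 0 \<Longrightarrow> v (a * b) = v a + v b"
    and add: "a \<noteq> 0 \<Longrightarrow> b \<noteq> 0 \<Longrightarrow> a + b \<noteq> 0 \<Longrightarrow> min (v a) (v b) \<le> v (a + b)"
begin

lemma ext_val_eq:
  assumes "a \<noteq> 0" "b \<noteq> 0"
  shows "ext_val v (to_fract a / to_fract b) = v a - v b"
proof -
  let ?f = "to_fract a / to_fract b"
  have "?f \<noteq> 0" using assms by simp
  have "num ?f * b = a * den ?f" by (rule num_den_cross[OF assms(2) refl])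
  then have "v (num ?f * b) = v (a * den ?f)" by simp
  then show ?thesis using assms \<open>?f \<noteq> 0\<close> by (simp add: mult ext_val_def)
qed

lemma ext_val_valuation: "valuation (ext_val v)"
proof
  fix f g :: "'a fract" assume nz: "f \<noteq> 0" "g \<noteq> 0"
  obtain a b where f: "f = to_fract a / to_fract b" "b \<noteq> 0" using num_den_eq den_nonzero by metis
  obtain c d where g: "g = to_fract c / to_fract d" "d \<noteq> 0" using num_den_eq den_nonzero by metis
  have ac: "a \<noteq> 0" "c \<noteq> 0" using f g nz by auto
  have vf: "ext_val v f = v a - v b" and vg: "ext_val v g = v c - v d"
    using f g ac by (simp_all add: ext_val_eq)
  have "f * g = to_fract (a * c) / to_fract (b * d)" by (simp add: f g)
  then have "ext_val v (f * g) = v (a * c) - v (b * d)"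
    by (simp only:) (rule ext_val_eq, use f g ac in auto)
  then show "ext_val v (f * g) = ext_val v f + ext_val v g"
    using f(2) g(2) ac by (simp add: vf vg mult)
  assume s: "f + g \<noteq> 0"
  have eq: "f + g = to_fract (a * d + c * b) / to_fract (b * d)" using f(2) g(2) unfolding f(1) g(1) by (simp add: field_simps)
  with s have nz': "a * d + c * b \<noteq> 0" by (metis to_fract_0 divide_eq_0_iff)
  have "ext_val v (f + g) = v (a * d + c * b) - v (b * d)"
    unfolding eq by (rule ext_val_eq) (use nz' f g in auto)
  moreover have "min (v (a * d)) (v (c * b)) \<le> v (a * d + c * b)"
    using add[of "a * d" "c * b"] f g ac nz' by auto
  ultimately show "min (ext_val v f) (ext_val v g) \<le> ext_val v (f + g)"
    using f(2) g(2) ac by (simp add: mult vf vg)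
qed

end

lemma coeff_mult_degree_le:
  fixes p q :: "'a::idom poly"
  assumes "degree p \<le> m" "degree q \<le> k"
  shows "coeff (p * q) (m + k) = coeff p m * coeff q k"
proof (cases "degree p = m \<and> degree q = k")
  case True
  then show ?thesis using coeff_mult_degree_sum by blast
next
  case False
  then have "degree p < m \<or> degree q < k" using assms by auto
  moreover have "degree (p * q) \<le> degree p + degree q" by (rule degree_mult_le)
  ultimately have "degree (p * q) < m + k" using assms by auto
  with \<open>degree p < m \<or> degree q < k\<close> show ?thesis
    by (auto simp: coeff_eq_0)
qed

text \<open>For \<open>degree q = b + 1\<close> both products have the same coefficient at exponent
  \<open>2 * b + 1\<close>, which cancels. This second lost degree is the double pole of
  \<open>dt2\<close> at infinity.\<close>

lemma degree_wronskian:
  fixes p q :: "'a::idom poly"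
  assumes "degree p \<le> degree q"
  defines "w \<equiv> pderiv p * q - p * pderiv q"
  shows "w = 0 \<or> degree w + 2 \<le> 2 * degree q"
proof (cases "degree q")
  case 0
  then have "pderiv p = 0" "pderiv q = 0"
    using assms pderiv_eq_0_iff by (auto elim!: degree_eq_zeroE simp: pderiv_pCons)
  then show ?thesis by (simp add: w_def)
next
  case (Suc b)
  have d: "degree (pderiv p) \<le> b" "degree (pderiv q) \<le> b"
    using assms Suc degree_pderiv_le[of p] degree_pderiv_le[of q] by auto
  have "coeff w (b + Suc b) = 0"
    using coeff_mult_degree_le[OF d(1), of q "Suc b"] coeff_mult_degree_le[OF _ d(2), of p "Suc b"] assms(1) Suc
    by (simp add: w_def coeff_pderiv add.commute)
  moreover have "degree w \<le> b + Suc b"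
    unfolding w_def
    by (rule degree_diff_le; rule order.trans[OF degree_mult_le]) (use assms(1) Suc d in auto)
  ultimately show ?thesis
    using Suc leading_coeff_neq_0[of w] by (cases "degree w = b + Suc b") auto
qed

lemma (in derivation) ext_eq_to_fract:
  assumes "b \<noteq> 0" "f = to_fract a / to_fract b"
  shows "ext f = to_fract (D a * b - a * D b) / to_fract (b * b)"
  using assms by (simp add: ext_eq) (simp add: field_simps)

lemma jac_eq_to_fract:
  fixes a b c d :: "'k::field poly poly"
  assumes "b \<noteq> 0" "d \<noteq> 0" "f = to_fract a / to_fract b" "g = to_fract c / to_fract d"
  shows "jac f g = to_fract
     ((map_poly pderiv a * b - a * map_poly pderiv b) * (pderiv c * d - c * pderiv d)
    - (pderiv a * b - a * pderiv b) * (map_poly pderiv c * d - c * map_poly pderiv d))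
    / to_fract ((b * b) * (d * d))"
proof -
  define u1 u2 w1 w2 where "u1 = map_poly pderiv a * b - a * map_poly pderiv b"
    "u2 = pderiv a * b - a * pderiv b" "w1 = map_poly pderiv c * d - c * map_poly pderiv d"
    "w2 = pderiv c * d - c * pderiv d"
  have "jac f g = (to_fract u1 / to_fract (b * b)) * (to_fract w2 / to_fract (d * d))
     - (to_fract u2 / to_fract (b * b)) * (to_fract w1 / to_fract (d * d))"
    unfolding jac_def u1_u2_w1_w2_def
    by (simp only: dt1.ext_eq_to_fract[OF assms(1,3)] dt2.ext_eq_to_fract[OF assms(1,3)]
       dt1.ext_eq_to_fract[OF assms(2,4)] dt2.ext_eq_to_fract[OF assms(2,4)])
  also have "\<dots> = to_fract (u1 * w2 - u2 * w1) / to_fract ((b * b) * (d * d))"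
    by (simp add: diff_divide_distrib)
  finally show ?thesis unfolding u1_u2_w1_w2_def .
qed

lemma valuation_neg_degree: "valuation (\<lambda>A::'a::idom poly. - int (degree A))"
proof
  fix a b :: "'a poly" assume "a \<noteq> 0" "b \<noteq> 0"
  then show "- int (degree (a * b)) = - int (degree a) + - int (degree b)" by (simp add: degree_mult_eq)
  show "min (- int (degree a)) (- int (degree b)) \<le> - int (degree (a + b))"
    using degree_add_le_max[of a b] by linarith
qed

lemma degree_map_poly_pderiv_mult:
  fixes a b :: "'k::field poly poly"
  assumes "degree a \<le> degree b"
  shows "degree (map_poly pderiv a * b - a * map_poly pderiv b) \<le> 2 * degree b"
proof -
  have "degree (map_poly pderiv a) \<le> degree b" "degree (map_poly pderiv b) \<le> degree b"
    using degree_map_poly_le[of pderiv a] degree_map_poly_le[of pderiv b] assms by auto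
  then show ?thesis using assms
    by (intro degree_diff_le; intro order.trans[OF degree_mult_le]) auto
qed

text \<open>Each product in the Jacobian contains exactly one Wronskian with respect to
  \<open>t2\<close>, which loses two degrees; the factor differentiated by \<open>t1\<close> need
  not lose any.\<close>

lemma place_infinity: "place (ext_val (\<lambda>A::'k::field poly poly. - int (degree A))) 2"
proof -
  interpret v: valuation "\<lambda>A::'k poly poly. - int (degree A)" by (rule valuation_neg_degree)
  interpret V: valuation "ext_val (\<lambda>A::'k poly poly. - int (degree A))" by (rule v.ext_val_valuation)
  show ?thesis
  proof
    show "ext_val (\<lambda>A::'k poly poly. - int (degree A)) (ratfun2_const c) = 0" if "c \<noteq> 0" for c
      using v.ext_val_eq[of "[:[:c:]:]" 1] that by (simp add: ratfun2_const_def)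
    show "ext_val (\<lambda>A::'k poly poly. - int (degree A)) t1 = 0"
      using v.ext_val_eq[of "[:[:0, 1:]:]" 1] by (simp add: t1_def)
  next
    fix f g :: "'k ratfun2"
    assume f: "f = 0 \<or> 0 \<le> ext_val (\<lambda>A::'k poly poly. - int (degree A)) f"
      and g: "g = 0 \<or> 0 \<le> ext_val (\<lambda>A::'k poly poly. - int (degree A)) g"
      and nz: "jac f g \<noteq> 0"
    have "f \<noteq> 0" "g \<noteq> 0" using nz by auto
    define a b c d where "a = num f" "b = den f" "c = num g" "d = den g"
    have bd: "b \<noteq> 0" "d \<noteq> 0" by (simp_all add: a_b_c_d_def)
    have fg: "f = to_fract a / to_fract b" "g = to_fract c / to_fract d"
      by (simp_all add: a_b_c_d_def num_den_eq)
    have le: "degree a \<le> degree b" "degree c \<le> degree d"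
      using f g \<open>f \<noteq> 0\<close> \<open>g \<noteq> 0\<close> by (simp_all add: ext_val_def a_b_c_d_def)
    define u1 u2 w1 w2 where "u1 = map_poly pderiv a * b - a * map_poly pderiv b"
      "u2 = pderiv a * b - a * pderiv b" "w1 = map_poly pderiv c * d - c * map_poly pderiv d"
      "w2 = pderiv c * d - c * pderiv d"
    have J: "jac f g = to_fract (u1 * w2 - u2 * w1) / to_fract ((b * b) * (d * d))"
      unfolding u1_u2_w1_w2_def by (rule jac_eq_to_fract[OF bd fg])
    have nz': "u1 * w2 - u2 * w1 \<noteq> 0" using nz J by (metis to_fract_0 divide_eq_0_iff)
    have u1: "degree u1 \<le> 2 * degree b" and w1: "degree w1 \<le> 2 * degree d"
      unfolding u1_u2_w1_w2_def using le by (auto intro!: degree_map_poly_pderiv_mult)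
    have u2: "u2 = 0 \<or> degree u2 + 2 \<le> 2 * degree b"
      unfolding u1_u2_w1_w2_def by (rule degree_wronskian[OF le(1)])
    have w2: "w2 = 0 \<or> degree w2 + 2 \<le> 2 * degree d"
      unfolding u1_u2_w1_w2_def by (rule degree_wronskian[OF le(2)])
    have p1: "u1 * w2 = 0 \<or> degree (u1 * w2) + 2 \<le> 2 * degree b + 2 * degree d"
      using u1 w2 degree_mult_le[of u1 w2] by auto
    have p2: "u2 * w1 = 0 \<or> degree (u2 * w1) + 2 \<le> 2 * degree b + 2 * degree d"
      using w1 u2 degree_mult_le[of u2 w1] by auto
    have "degree (u1 * w2 - u2 * w1) \<le> max (degree (u1 * w2)) (degree (u2 * w1))"
      by (rule degree_diff_le_max)
    then have "degree (u1 * w2 - u2 * w1) + 2 \<le> 2 * degree b + 2 * degree d"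
      using p1 p2 nz' by (cases "u1 * w2 = 0"; cases "u2 * w1 = 0") auto
    then show "2 \<le> ext_val (\<lambda>A::'k poly poly. - int (degree A)) (jac f g)"
      unfolding J using bd nz' by (subst v.ext_val_eq) (auto simp: degree_mult_eq)
  qed (auto simp: V.mult intro: V.add)
qed

section \<open>Places from irreducible polynomials over \<open>K(t1)\<close>\<close>

definition pmult :: "'a::idom \<Rightarrow> 'a \<Rightarrow> nat"
  where "pmult R p = (THE n. \<exists>q. p = R ^ n * q \<and> \<not> R dvd q)"

lemma pmult_eq:
  fixes R q :: "'a::idom"
  assumes "R \<noteq> 0" "\<not> R dvd q"
  shows "pmult R (R ^ n * q) = n"
  unfolding pmult_def
proof (rule the_equality)
  show "\<exists>q'. R ^ n * q = R ^ n * q' \<and> \<not> R dvd q'" using assms by blast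
  fix m assume "\<exists>q'. R ^ n * q = R ^ m * q' \<and> \<not> R dvd q'"
  then obtain q' where q': "R ^ n * q = R ^ m * q'" "\<not> R dvd q'" by blast
  show "m = n"
  proof (rule ccontr)
    assume "m \<noteq> n"
    then consider k where "m = n + Suc k" | k where "n = m + Suc k"
      by (metis less_iff_Suc_add add_Suc_right linorder_neqE_nat)
    then show False
    proof cases
      case 1
      then have "q = R * (R ^ k * q')" using q'(1) assms(1) by (simp add: power_add algebra_simps)
      with assms show False by simp
    next
      case 2
      then have "q' = R * (R ^ k * q)" using q'(1) assms(1) by (simp add: power_add algebra_simps)
      with q' show False by simp
    qed
  qed
qed

lemma pmult_decompose:
  fixes R p :: "'a::field poly"
  assumes "degree R > 0" "p \<noteq> 0"
  obtains q where "p = R ^ pmult R p * q" "\<not> R dvd q"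
proof -
  have "\<exists>n q. p = R ^ n * q \<and> \<not> R dvd q"
    using assms(2)
  proof (induction "degree p" arbitrary: p rule: less_induct)
    case less
    show ?case
    proof (cases "R dvd p")
      case True
      then obtain p' where p': "p = R * p'" by (elim dvdE)
      with less.prems have "p' \<noteq> 0" by auto
      moreover have "R \<noteq> 0" using assms(1) by auto
      ultimately have "degree p' < degree p" using p' assms(1) by (simp add: degree_mult_eq)
      from less.hyps[OF this \<open>p' \<noteq> 0\<close>] obtain n q where "p' = R ^ n * q" "\<not> R dvd q" by blast
      with p' have "p = R ^ Suc n * q \<and> \<not> R dvd q" by simp
      then show ?thesis by blast
    next
      case False
      then have "p = R ^ 0 * p \<and> \<not> R dvd p" by simp
      then show ?thesis by blast
    qed
  qed
  then obtain n q where nq: "p = R ^ n * q" "\<not> R dvd q" by blast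
  moreover have "R \<noteq> 0" using assms(1) by auto
  ultimately have n: "pmult R p = n" using pmult_eq[of R q n] by simp
  have "p = R ^ pmult R p * q" unfolding n by (rule nq(1))
  from this nq(2) show thesis by (rule that)
qed

lemma degree_fract_poly: "degree (fract_poly p) = degree p"
  by (rule antisym[OF degree_map_poly_le], cases "p = 0") (auto intro: le_degree simp: coeff_map_poly)

lemma clear_denominators:
  fixes P :: "'a::idom fract poly"
  obtains c Q where "c \<noteq> 0" "fract_poly Q = Polynomial.smult (to_fract c) P"
proof (induction P arbitrary: thesis)
  case 0
  show ?case by (rule 0[of 1 0]) simp_all
next
  case (pCons f P)
  obtain c Q where cQ: "c \<noteq> 0" "fract_poly Q = Polynomial.smult (to_fract c) P"
    using pCons.IH by blast
  have f: "to_fract (num f) = to_fract (den f) * f"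
    using num_den_eq[of f] by (simp add: divide_eq_eq mult.commute)
  have "to_fract (coeff Q i) = to_fract c * coeff P i" for i
    using arg_cong[OF cQ(2), of "\<lambda>p. coeff p i"] by (simp add: coeff_map_poly)
  then have "fract_poly (pCons (c * num f) (Polynomial.smult (den f) Q)) = Polynomial.smult (to_fract (c * den f)) (pCons f P)"
    by (intro poly_eqI) (simp add: coeff_map_poly coeff_pCons f split: nat.splits)
  moreover have "c * den f \<noteq> 0" using cQ by simp
  ultimately show ?case using pCons.prems by blast
qed

lemma valuation_pmult:
  fixes R :: "'a::idom fract poly"
  assumes R: "irreducible R" "degree R > 0"
  shows "valuation (\<lambda>A. int (pmult R (fract_poly A)))"
proof
  have prime: "prime_elem R" using R field_poly_irreducible_imp_prime by blast
  have R0: "R \<noteq> 0" using R by auto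
  fix a b :: "'a poly" assume nz: "a \<noteq> 0" "b \<noteq> 0"
  obtain a' where a': "fract_poly a = R ^ pmult R (fract_poly a) * a'" "\<not> R dvd a'"
    by (rule pmult_decompose[OF R(2), of "fract_poly a"]) (use nz in \<open>auto simp del: fract_poly_add\<close>)
  obtain b' where b': "fract_poly b = R ^ pmult R (fract_poly b) * b'" "\<not> R dvd b'"
    by (rule pmult_decompose[OF R(2), of "fract_poly b"]) (use nz in \<open>auto simp del: fract_poly_add\<close>)
  let ?m = "pmult R (fract_poly a)" and ?n = "pmult R (fract_poly b)"
  have "fract_poly (a * b) = (R ^ ?m * a') * (R ^ ?n * b')" unfolding fract_poly_mult a'(1)[symmetric] b'(1)[symmetric] ..
  also have "\<dots> = R ^ (?m + ?n) * (a' * b')" by (simp add: power_add algebra_simps)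
  finally have "fract_poly (a * b) = R ^ (?m + ?n) * (a' * b')" .
  moreover have "\<not> R dvd a' * b'" using prime a' b' by (simp add: prime_elem_dvd_mult_iff)
  ultimately show "int (pmult R (fract_poly (a * b))) = int ?m + int ?n"
    using pmult_eq[OF R0] by auto
  assume s: "a + b \<noteq> 0"
  obtain c' where c': "fract_poly (a + b) = R ^ pmult R (fract_poly (a + b)) * c'" "\<not> R dvd c'"
    by (rule pmult_decompose[OF R(2), of "fract_poly (a + b)"]) (use s in \<open>simp_all del: fract_poly_add\<close>)
  let ?k = "min ?m ?n"
  have dvd: "R ^ ?k dvd fract_poly a" "R ^ ?k dvd fract_poly b"
    by (subst a'(1), rule dvd_mult2, simp add: le_imp_power_dvd)
       (subst b'(1), rule dvd_mult2, simp add: le_imp_power_dvd)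
  then have d: "R ^ ?k dvd fract_poly (a + b)" by simp
  have "?k \<le> pmult R (fract_poly (a + b))"
  proof (rule ccontr)
    assume "\<not> ?thesis"
    then obtain i where i: "?k = pmult R (fract_poly (a + b)) + Suc i"
      by (metis add_Suc_right less_iff_Suc_add not_le)
    from d obtain e where "fract_poly (a + b) = R ^ ?k * e" by (elim dvdE)
    then have "R ^ pmult R (fract_poly (a + b)) * c' = R ^ pmult R (fract_poly (a + b)) * (R * (R ^ i * e))"
      unfolding i c'(1)[symmetric] by (simp add: power_add algebra_simps)
    then have "c' = R * (R ^ i * e)" using R0 by simp
    with c' show False by simp
  qed
  then show "min (int ?m) (int ?n) \<le> int (pmult R (fract_poly (a + b)))" by linarith
qed

lemma pmult_unit: "is_unit p \<Longrightarrow> irreducible R \<Longrightarrow> pmult R p = 0"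
proof -
  assume "is_unit p" "irreducible R"
  then have "\<not> R dvd p" "R \<noteq> 0" by (auto simp: irreducible_def dest: dvd_unit_imp_unit)
  then show ?thesis using pmult_eq[of R p 0] by simp
qed

lemma pmult_const:
  fixes R :: "'a::idom fract poly"
  shows "c \<noteq> 0 \<Longrightarrow> irreducible R \<Longrightarrow> pmult R (fract_poly [:c:]) = 0"
  by (rule pmult_unit) (simp_all add: map_poly_pCons is_unit_const_poly_iff dvd_field_iff)

text \<open>A function regular at the place has a denominator prime to \<open>R\<close>, and
  differentiating introduces only products of such denominators.\<close>

lemma place_finite:
  fixes R :: "'k::field poly fract poly"
  assumes R: "irreducible R" "degree R > 0"
  shows "place (ext_val (\<lambda>A. int (pmult R (fract_poly A)))) 0"
proof -
  let ?v = "\<lambda>A. int (pmult R (fract_poly A))"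
  interpret v: valuation ?v by (rule valuation_pmult[OF R])
  interpret V: valuation "ext_val ?v" by (rule v.ext_val_valuation)
  have R0: "R \<noteq> 0" using R by auto
  have prime: "prime_elem R" using R field_poly_irreducible_imp_prime by blast
  have integral: "\<exists>A B. f = to_fract A / to_fract B \<and> B \<noteq> 0 \<and> ?v B = 0" if "f = 0 \<or> 0 \<le> ext_val ?v f" for f
  proof (cases "f = 0")
    case True
    then show ?thesis using pmult_unit[of 1 R] R by (intro exI[of _ 0] exI[of _ 1]) auto
  next
    case False
    let ?a = "fract_poly (num f)" and ?b = "fract_poly (den f)"
    have nz: "?a \<noteq> 0" "?b \<noteq> 0" using False by simp_all
    obtain a' where a': "?a = R ^ pmult R ?a * a'" "\<not> R dvd a'"
      using pmult_decompose[OF R(2) nz(1)] by blast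
    obtain b' where b': "?b = R ^ pmult R ?b * b'" "\<not> R dvd b'"
      using pmult_decompose[OF R(2) nz(2)] by blast
    from that False have le: "pmult R ?b \<le> pmult R ?a" by (simp add: ext_val_def)
    obtain c A where A: "c \<noteq> 0" "fract_poly A = Polynomial.smult (to_fract c) (R ^ (pmult R ?a - pmult R ?b) * a')"
      by (rule clear_denominators)
    obtain d B where B: "d \<noteq> 0" "fract_poly B = Polynomial.smult (to_fract d) b'"
      by (rule clear_denominators)
    have "fract_poly (num f * Polynomial.smult c B) = fract_poly (Polynomial.smult d A * den f)"
    proof -
      have *: "?a = R ^ (pmult R ?a - pmult R ?b) * a' * R ^ pmult R ?b"
        using le by (subst a'(1)) (simp add: mult.assoc mult.commute[of a'] flip: power_add mult.assoc)
      have "fract_poly (num f * Polynomial.smult c B) = ?a * Polynomial.smult (to_fract c * to_fract d) b'"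
        by (simp add: B)
      also have "\<dots> = Polynomial.smult (to_fract c * to_fract d) (R ^ (pmult R ?a - pmult R ?b) * a') * (R ^ pmult R ?b * b')"
        by (subst *) (simp add: algebra_simps)
      also have "\<dots> = fract_poly (Polynomial.smult d A * den f)"
        unfolding b'(1)[symmetric] by (simp add: A mult.commute)
      finally show ?thesis .
    qed
    then have cross: "num f * Polynomial.smult c B = Polynomial.smult d A * den f" by (simp only: fract_poly_eq_iff)
    have "b' \<noteq> 0" using b' nz by auto
    then have "B \<noteq> 0" using B by auto
    have "f = to_fract (Polynomial.smult d A) / to_fract (Polynomial.smult c B)"
    proof -
      have "to_fract (num f) / to_fract (den f) = to_fract (Polynomial.smult d A) / to_fract (Polynomial.smult c B)"
        using \<open>B \<noteq> 0\<close> A(1) cross by (simp add: frac_eq_eq flip: to_fract_mult)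
      then show ?thesis by (simp only: num_den_eq)
    qed
    moreover have "?v (Polynomial.smult c B) = 0"
    proof -
      have "\<not> R dvd fract_poly (Polynomial.smult c B)"
        using b'(2) A(1) B(1) by (simp add: B dvd_smult_iff)
      then show ?thesis using pmult_eq[OF R0, of "fract_poly (Polynomial.smult c B)" 0] by simp
    qed
    moreover have "Polynomial.smult c B \<noteq> 0" using \<open>B \<noteq> 0\<close> A(1) by simp
    ultimately show ?thesis by blast
  qed
  show ?thesis
  proof
    show "ext_val ?v (ratfun2_const c) = 0" if "c \<noteq> 0" for c
      using v.ext_val_eq[of "[:[:c:]:]" 1] that R(1) pmult_const[of "[:c:]" R] pmult_unit[of 1 R]
      by (simp add: ratfun2_const_def)
    show "ext_val ?v t1 = 0"
      using v.ext_val_eq[of "[:[:0, 1:]:]" 1] R(1) pmult_const[of "[:0, 1:]" R] pmult_unit[of 1 R]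
      by (simp add: t1_def)
  next
    fix f g :: "'k ratfun2"
    assume f: "f = 0 \<or> 0 \<le> ext_val ?v f" and g: "g = 0 \<or> 0 \<le> ext_val ?v g"
    from integral[OF f] integral[OF g]
    obtain a b c d where fg: "f = to_fract a / to_fract b" "g = to_fract c / to_fract d"
      and bd: "b \<noteq> 0" "d \<noteq> 0" and vbd: "?v b = 0" "?v d = 0" by blast
    assume nz: "jac f g \<noteq> 0"
    obtain w where w: "jac f g = to_fract w / to_fract ((b * b) * (d * d))"
      using jac_eq_to_fract[OF bd fg] by blast
    with nz have "w \<noteq> 0" by auto
    then have "ext_val ?v (jac f g) = ?v w - ?v ((b * b) * (d * d))"
      unfolding w using bd by (intro v.ext_val_eq) auto
    also have "?v ((b * b) * (d * d)) = 0"
      using v.mult[of "b * b" "d * d"] v.mult[of b b] v.mult[of d d] bd vbd by simp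
    finally show "0 \<le> ext_val ?v (jac f g)" by simp
  qed (auto simp: V.mult intro: V.add)
qed

text \<open>\<open>G\<close> stands for the form \<open>G (dt2)^r\<close> on the projective line
  over \<open>K(t1)\<close>. A prime of its reduced denominator is a pole; without such a prime
  \<open>G\<close> is a polynomial in \<open>t2\<close>, and the double pole of \<open>dt2\<close>
  at infinity decides.\<close>

lemma exists_place_less:
  fixes G :: "'k::field ratfun2"
  assumes "G \<noteq> 0" "r > 0"
  shows "\<exists>\<nu> \<epsilon>. place \<nu> \<epsilon> \<and> \<nu> G < r * \<epsilon>"
proof -
  \<comment> \<open>Minimal degree of the denominator takes the place of lowest terms: a common
    factor over \<open>K(t1)\<close> could be cancelled, and clearing denominators afterwards does
    not raise the degree in \<open>t2\<close>.\<close>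
  define P where "P = (\<lambda>n. \<exists>A B. B \<noteq> 0 \<and> G = to_fract A / to_fract B \<and> degree B = n)"
  have "\<exists>n. P n" unfolding P_def using num_den_eq den_nonzero by metis
  then obtain n where "P n" and min: "\<And>m. P m \<Longrightarrow> n \<le> m" using LeastI_ex Least_le by metis
  then obtain A B where B: "B \<noteq> 0" and G: "G = to_fract A / to_fract B" and n: "degree B = n"
    by (auto simp: P_def)
  have A: "A \<noteq> 0" using G assms by auto
  show ?thesis
  proof (cases "n = 0")
    case True
    interpret v: valuation "\<lambda>A::'k poly poly. - int (degree A)" by (rule valuation_neg_degree)
    have "ext_val (\<lambda>A::'k poly poly. - int (degree A)) G \<le> 0"
      unfolding G by (subst v.ext_val_eq) (use A B n True in auto)
    then show ?thesis using place_infinity assms by (intro exI conjI) (auto intro: le_less_trans)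
  next
    case False
    then have "degree (fract_poly B) > 0" using n by (simp add: degree_fract_poly)
    from irreducible_monic_factor[OF this] obtain R C
      where R: "irreducible R" and RC: "fract_poly B = R * C" by blast
    have degR: "degree R > 0"
    proof (rule ccontr)
      assume "\<not> ?thesis"
      moreover have "R \<noteq> 0" using R by (auto simp: irreducible_def)
      ultimately have "is_unit R" by (simp add: is_unit_iff_degree)
      with R show False by (auto simp: irreducible_def)
    qed
    have R0: "R \<noteq> 0" using degR by auto
    interpret v: valuation "\<lambda>A. int (pmult R (fract_poly A))" by (rule valuation_pmult[OF R degR])
    have "\<not> R dvd fract_poly A"
    proof
      assume "R dvd fract_poly A"
      then obtain E where E: "fract_poly A = R * E" by (elim dvdE)
      obtain c A' where A': "c \<noteq> 0" "fract_poly A' = Polynomial.smult (to_fract c) E" by (rule clear_denominators)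
      obtain d B' where B': "d \<noteq> 0" "fract_poly B' = Polynomial.smult (to_fract d) C" by (rule clear_denominators)
      have "fract_poly (A * Polynomial.smult c B') = fract_poly (Polynomial.smult d A' * B)"
        by (simp add: E A' B' RC algebra_simps)
      then have cross: "A * Polynomial.smult c B' = Polynomial.smult d A' * B" by (simp only: fract_poly_eq_iff)
      have "C \<noteq> 0" using RC B by auto
      then have B'0: "B' \<noteq> 0" using B' by auto
      have "degree C < degree (fract_poly B)" unfolding RC using degR \<open>C \<noteq> 0\<close> R0 by (simp add: degree_mult_eq)
      then have "degree (Polynomial.smult c B') < n"
        using A'(1) B' n degree_smult_eq[of "to_fract d" C]
        by (simp add: degree_fract_poly flip: B'(2))
      moreover have "to_fract A / to_fract B = to_fract (Polynomial.smult d A') / to_fract (Polynomial.smult c B')"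
        using B B'0 A'(1) cross by (simp add: frac_eq_eq flip: to_fract_mult)
      then have "P (degree (Polynomial.smult c B'))"
        unfolding P_def G using B'0 A'(1) by (intro exI[of _ "Polynomial.smult d A'"] exI[of _ "Polynomial.smult c B'"]) auto
      ultimately show False using min by fastforce
    qed
    then have "pmult R (fract_poly A) = 0" using pmult_eq[OF R0, of "fract_poly A" 0] by simp
    moreover have "pmult R (fract_poly B) \<noteq> 0"
    proof
      assume 0: "pmult R (fract_poly B) = 0"
      obtain q where "fract_poly B = R ^ pmult R (fract_poly B) * q" "\<not> R dvd q"
        by (rule pmult_decompose[OF degR, of "fract_poly B"]) (use B in auto)
      then show False unfolding 0 using RC by (metis dvd_triv_left mult_1 power_0)
    qed
    moreover have "ext_val (\<lambda>A. int (pmult R (fract_poly A))) G = int (pmult R (fract_poly A)) - int (pmult R (fract_poly B))"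
      unfolding G by (rule v.ext_val_eq[OF A B])
    ultimately have "ext_val (\<lambda>A. int (pmult R (fract_poly A))) G < r * 0" by simp
    then show ?thesis using place_finite[OF R degR] by blast
  qed
qed

section \<open>Multiplicities and discrepancies\<close>

context place
begin

text \<open>Valuation ring and, next, its maximal ideal. Zero is treated separately because
  \<open>\<nu> 0\<close> is an arbitrary integer.\<close>

definition integral :: "'k ratfun2 \<Rightarrow> bool" where "integral f \<longleftrightarrow> f = 0 \<or> 0 \<le> \<nu> f"
definition pos :: "'k ratfun2 \<Rightarrow> bool" where "pos f \<longleftrightarrow> f = 0 \<or> 0 < \<nu> f"

lemma val_1 [simp]: "\<nu> 1 = 0"
  using const[of 1] by simp

lemma val_power: "a \<noteq> 0 \<Longrightarrow> \<nu> (a ^ n) = int n * \<nu> a"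
  by (induction n) (auto simp: mult algebra_simps)

lemma val_inverse: "a \<noteq> 0 \<Longrightarrow> \<nu> (inverse a) = - \<nu> a"
  using mult[of a "inverse a"] by simp

lemma val_divide: "a \<noteq> 0 \<Longrightarrow> b \<noteq> 0 \<Longrightarrow> \<nu> (a / b) = \<nu> a - \<nu> b"
  by (simp add: divide_inverse mult val_inverse)

lemma val_minus: "\<nu> (- a) = \<nu> a"
proof (cases "a = 0")
  case False
  have "\<nu> (ratfun2_const (- 1) * a) = \<nu> a"
    by (subst mult) (use False const[of "-1"] in \<open>auto simp: const.hom_uminus\<close>)
  then show ?thesis by (simp add: const.hom_uminus)
qed simp

lemma val_power_int: "a \<noteq> 0 \<Longrightarrow> \<nu> (a powi n) = n * \<nu> a"
  by (simp add: power_int_def val_power val_inverse)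

lemma pos_imp_integral: "pos f \<Longrightarrow> integral f"
  by (auto simp: pos_def integral_def)

lemma not_pos_iff: "integral f \<Longrightarrow> \<not> pos f \<longleftrightarrow> f \<noteq> 0 \<and> \<nu> f = 0"
  by (auto simp: pos_def integral_def)

lemma integral_add: "integral a \<Longrightarrow> integral b \<Longrightarrow> integral (a + b)"
  using add[of a b] by (cases "a = 0"; cases "b = 0"; cases "a + b = 0") (auto simp: integral_def)

lemma integral_mult: "integral a \<Longrightarrow> integral b \<Longrightarrow> integral (a * b)"
  using mult[of a b] by (cases "a = 0"; cases "b = 0") (auto simp: integral_def)

lemma integral_const [simp]: "integral (ratfun2_const c)"
  using const[of c] by (cases "c = 0") (auto simp: integral_def)

lemma integral_0 [simp]: "integral 0" and pos_0 [simp]: "pos 0"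
  by (simp_all add: integral_def pos_def)

lemma integral_uminus: "integral a \<Longrightarrow> integral (- a)"
  by (simp add: integral_def val_minus)

lemma integral_diff: "integral a \<Longrightarrow> integral b \<Longrightarrow> integral (a - b)"
  using integral_add[of a "- b"] integral_uminus by simp

lemma pos_uminus: "pos a \<Longrightarrow> pos (- a)"
  by (simp add: pos_def val_minus)

lemma pos_add: "pos a \<Longrightarrow> pos b \<Longrightarrow> pos (a + b)"
  using add[of a b] by (cases "a = 0"; cases "b = 0"; cases "a + b = 0") (auto simp: pos_def)

lemma pos_diff: "pos a \<Longrightarrow> pos b \<Longrightarrow> pos (a - b)"
  using pos_add[of a "- b"] pos_uminus by simp

lemma pos_mult: "pos a \<Longrightarrow> integral b \<Longrightarrow> pos (a * b)"
  using mult[of a b] by (cases "a = 0"; cases "b = 0") (auto simp: integral_def pos_def)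

lemma pos_mult_iff: "integral a \<Longrightarrow> integral b \<Longrightarrow> pos (a * b) \<longleftrightarrow> pos a \<or> pos b"
  using mult[of a b] by (cases "a = 0"; cases "b = 0") (auto simp: integral_def pos_def)

lemma not_pos_const: "c \<noteq> 0 \<Longrightarrow> \<not> pos (ratfun2_const c)"
  using const[of c] by (auto simp: pos_def)

lemma integral_ev1: "integral x \<Longrightarrow> integral (ev1 x p)"
  by (induction p) (auto intro: integral_add integral_mult)

lemma integral_ev: "integral x \<Longrightarrow> integral y \<Longrightarrow> integral (ev x y P)"
  by (induction P) (auto intro!: integral_add integral_mult integral_ev1)

lemma pos_ev1_diff: "pos x \<Longrightarrow> pos (ev1 x p - ratfun2_const (coeff p 0))"
  by (cases p) (auto intro: pos_mult integral_ev1 pos_imp_integral)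

lemma pos_ev_diff_0:
  assumes "pos x" "pos y"
  shows "pos (ev x y P - ratfun2_const (coeff (coeff P 0) 0))"
proof (cases P)
  case (pCons p Q)
  have eq: "ev x y P - ratfun2_const (coeff (coeff P 0) 0) = (ev1 x p - ratfun2_const (coeff p 0)) + y * ev x y Q"
    by (simp add: pCons)
  show ?thesis
    unfolding eq by (intro pos_add pos_ev1_diff pos_mult integral_ev pos_imp_integral assms)
qed

lemma val_relation:
  assumes "ev x y P = ratfun2_t * ev x y Q" "ratfun2_t = t1" "ev x y Q \<noteq> 0"
  shows "\<nu> (ev x y P) = \<nu> (ev x y Q)" "ev x y P \<noteq> 0"
  using assms mult[of t1 "ev x y Q"] t1 by auto

end

lemma (in place) pos_ev_diff_row_0:
  assumes "pos x" "integral y"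
  shows "pos (ev x y P - ev1 y (row_0 P))"
proof (induction P)
  case 0
  show ?case by (simp add: row_0_def)
next
  case (pCons p P)
  have eq: "ev x y (pCons p P) - ev1 y (row_0 (pCons p P))
      = (ev1 x p - ratfun2_const (coeff p 0)) + (ev x y P - ev1 y (row_0 P)) * y"
    by (simp add: row_0_pCons algebra_simps)
  show ?case unfolding eq by (intro pos_add pos_ev1_diff pos_mult pCons.IH assms)
qed

locale place_alg_closed = place \<nu> \<epsilon> for \<nu> :: "'k::alg_closed_field ratfun2 \<Rightarrow> int" and \<epsilon>
begin

text \<open>The residue of \<open>y\<close> lies outside \<open>K\<close>, hence is transcendental
  over the algebraically closed \<open>K\<close>: every linear factor of \<open>p\<close> is a unit
  at the place.\<close>

lemma not_pos_ev1:
  assumes y: "integral y" and tr: "\<And>c. \<not> pos (y - ratfun2_const c)" and "p \<noteq> 0"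
  shows "\<not> pos (ev1 y p)"
proof -
  from alg_closed_imp_factorization[OF \<open>p \<noteq> 0\<close>]
  obtain A where A: "p = Polynomial.smult (lead_coeff p) (\<Prod>x\<in>#A. [:- x, 1:])" by blast
  have *: "\<not> pos (ev1 y (\<Prod>x\<in>#A. [:- x, 1:]))"
  proof (induction A)
    case empty
    then show ?case using not_pos_const[of 1] by simp
  next
    case (add a A)
    have "\<not> pos (y - ratfun2_const a)" by (rule tr)
    with add show ?case
      by (simp add: ev1.hom_mult const.hom_uminus pos_mult_iff integral_add integral_ev1 y integral_diff del: mult_pCons_left)
  qed
  have "ev1 y p = ratfun2_const (lead_coeff p) * ev1 y (\<Prod>x\<in>#A. [:- x, 1:])"
    by (subst A) (simp add: ev1_def hom_distribs)
  then show ?thesis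
    using * \<open>p \<noteq> 0\<close> by (simp add: pos_mult_iff integral_ev1 y not_pos_const)
qed

text \<open>The centre is the whole line \<open>x = 0\<close>, so only the restriction to that line
  matters.\<close>

lemma not_pos_ev_row_0:
  assumes "pos x" "integral y" "\<And>c. \<not> pos (y - ratfun2_const c)" "(0, j) \<in> supp P"
  shows "\<not> pos (ev x y P)"
proof
  assume "pos (ev x y P)"
  then have "pos (ev x y P - (ev x y P - ev1 y (row_0 P)))"
    by (rule pos_diff) (rule pos_ev_diff_row_0[OF assms(1,2)])
  then show False using not_pos_ev1[OF assms(2,3) row_0_nonzero[OF assms(4)]] by simp
qed

text \<open>\<open>P\<close> and \<open>Q\<close> differ by the unit \<open>t1\<close>, so if one of
  them does not vanish at the centre, neither does. The left side is then zero and the right side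
  nonnegative by the axiom on \<open>jac\<close>.\<close>

lemma bound_if_not_pos:
  assumes "integral x" "integral y" "jac x y \<noteq> 0" "ev x y P = t1 * ev x y Q" "ev x y Q \<noteq> 0"
    and "\<not> pos (ev x y P) \<or> \<not> pos (ev x y Q)"
  shows "int s * \<nu> (ev x y Q) \<le> int r * (\<nu> (jac x y) - \<epsilon>)"
proof -
  have "\<epsilon> \<le> \<nu> (jac x y)" using jac assms by (auto simp: integral_def)
  moreover have "\<nu> (ev x y Q) = 0"
    using assms val_relation[OF assms(4) refl assms(5)] not_pos_iff[OF integral_ev[OF assms(1,2)]] by metis
  ultimately show ?thesis by simp
qed

text \<open>Discrepancy bound for a point of multiplicity at most \<open>r / s\<close>, by induction over the
  blow-ups that resolve the centre of the place.\<close>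

lemma local_bound:
  assumes "pos x" "pos y" "jac x y \<noteq> 0" "ev x y P = t1 * ev x y Q" "ev x y Q \<noteq> 0"
    and "(i, j) \<in> supp P \<union> supp Q" "s * (i + j) \<le> r"
  shows "int s * \<nu> (ev x y Q) \<le> int r * (\<nu> (jac x y) - \<epsilon>)"
  using assms
proof (induction "nat (\<nu> (ev x y Q))" arbitrary: x y P Q i j rule: less_induct)
  case (less x y Q P i0 j0)
  note x = less.prems(1) and y = less.prems(2) and J = less.prems(3) and PQ = less.prems(4) and Q0 = less.prems(5)
  have x0: "x \<noteq> 0" and y0: "y \<noteq> 0" using J by auto
  have vx: "\<nu> x > 0" and vy: "\<nu> y > 0" using x y x0 y0 by (auto simp: pos_def)
  define S where "S = supp P \<union> supp Q"
  \<comment> \<open>The multiplicity of the pencil at the origin; the given monomial shows only that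
    it is at most \<open>r / s\<close>.\<close>
  define m where "m = (LEAST m. \<exists>(i, j)\<in>S. i + j = m)"
  have ex: "\<exists>m. \<exists>(i, j)\<in>S. i + j = m" using less.prems(6) by (auto simp: S_def)
  obtain i j where ij: "(i, j) \<in> S" "i + j = m" using LeastI_ex[OF ex] unfolding m_def[symmetric] by auto
  have min: "m \<le> i + j" if "(i, j) \<in> S" for i j
    unfolding m_def by (rule Least_le) (use that in auto)
  have "m \<le> i0 + j0" by (rule min) (unfold S_def, rule less.prems(6))
  then have sm: "s * m \<le> r" using less.prems(7) by (meson le_trans mult_le_mono2)
  then have "int (s * m) \<le> int r" by (simp only: of_nat_le_iff)
  then have sm_mult: "int s * (int m * a) \<le> int r * a" if "0 < a" for a
    using mult_right_mono[of "int (s * m)" "int r" a] that by (simp add: mult.assoc)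
  note int = pos_imp_integral[OF x] pos_imp_integral[OF y]
  show ?case
  proof (cases "m = 0")
    case True
    then have "coeff (coeff P 0) 0 \<noteq> 0 \<or> coeff (coeff Q 0) 0 \<noteq> 0"
      using ij by (auto simp: S_def supp_iff)
    moreover have "\<not> pos (ev x y R)" if "coeff (coeff R 0) 0 \<noteq> 0" for R
    proof
      assume "pos (ev x y R)"
      then have "pos (ev x y R - (ev x y R - ratfun2_const (coeff (coeff R 0) 0)))"
        by (rule pos_diff) (rule pos_ev_diff_0[OF x y])
      then show False using not_pos_const[OF that] by simp
    qed
    ultimately show ?thesis using bound_if_not_pos[OF int J PQ Q0] by blast
  next
    case False
    then have m: "m > 0" by simp
    show ?thesis
    \<comment> \<open>The values of \<open>x\<close> and \<open>y\<close> decide which chart of the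
      blow-up contains the new centre.\<close>
    proof (cases "\<nu> x \<le> \<nu> y")
      case True
      define y1 where "y1 = y / x"
      have y1: "integral y1" using True x0 y0 by (simp add: y1_def integral_def val_divide)
      define \<sigma> where "\<sigma> = (\<lambda>(i, j). (i + j - m, j))"
      define P1 Q1 where "P1 = mon_map \<sigma> P" "Q1 = mon_map \<sigma> Q"
      have inj: "inj_on \<sigma> S"
        by (rule inj_onI) (auto simp: \<sigma>_def dest!: min)
      have ev: "ev x y R = x ^ m * ev x y1 (mon_map \<sigma> R)" if "supp R \<subseteq> S" for R
      proof (rule ev_mon_map)
        fix i j assume "(i, j) \<in> supp R"
        then have "m + (i + j - m) = i + j" using min that by auto
        then have "x ^ m * x ^ (i + j - m) = x ^ i * x ^ j" by (simp flip: power_add)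
        then have "x ^ m * x ^ (i + j - m) * (y1 ^ j) = x ^ i * (x ^ j * y1 ^ j)" by simp
        also have "x ^ j * y1 ^ j = y ^ j" using x0 by (simp add: y1_def flip: power_mult_distrib)
        finally show "x ^ m * (x ^ fst (\<sigma> (i, j)) * y1 ^ snd (\<sigma> (i, j))) = x ^ i * y ^ j"
          by (simp add: \<sigma>_def mult.assoc)
      qed
      have evP: "ev x y P = x ^ m * ev x y1 P1" and evQ: "ev x y Q = x ^ m * ev x y1 Q1"
        unfolding P1_Q1_def by (intro ev; simp add: S_def)+
      have PQ1: "ev x y1 P1 = t1 * ev x y1 Q1" using PQ x0 by (simp add: evP evQ)
      have Q10: "ev x y1 Q1 \<noteq> 0" using Q0 evQ by auto
      \<comment> \<open>The exceptional curve occurs once in the Jacobian and \<open>m\<close> times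
        in the pencil; \<open>s * m \<le> r\<close> balances the two.\<close>
      have Jeq: "jac x y = x * jac x y1"
        using x0 jac_mult(2)[of x x y1] by (simp add: y1_def)
      have J1: "jac x y1 \<noteq> 0" using J Jeq by auto
      have supp1: "supp P1 \<union> supp Q1 = \<sigma> ` S"
        unfolding P1_Q1_def S_def image_Un
        by (intro arg_cong2[of _ _ _ _ "(\<union>)"] supp_mon_map inj_on_subset[OF inj]) (auto simp: S_def)
      have "\<sigma> (i, j) \<in> \<sigma> ` S" using ij by blast
      then have row: "(0, j) \<in> supp P1 \<union> supp Q1" unfolding supp1 using ij by (simp add: \<sigma>_def)
      have vQ: "\<nu> (ev x y Q) = int m * \<nu> x + \<nu> (ev x y1 Q1)"
        unfolding evQ using x0 Q10 by (simp add: mult val_power)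
      have vJ: "\<nu> (jac x y) = \<nu> x + \<nu> (jac x y1)"
        unfolding Jeq using x0 J1 by (rule mult)
      have "int s * \<nu> (ev x y1 Q1) \<le> int r * (\<nu> (jac x y1) - \<epsilon>)"
      \<comment> \<open>Without such a \<open>c\<close> the centre is the exceptional curve itself;
        otherwise it is a point on it, where the induction continues.\<close>
      proof (cases "\<exists>c. pos (y1 - ratfun2_const c)")
        case False
        then have "\<not> pos (ev x y1 P1) \<or> \<not> pos (ev x y1 Q1)"
          using row not_pos_ev_row_0[OF x y1] by blast
        then show ?thesis by (rule bound_if_not_pos[OF int(1) y1 J1 PQ1 Q10])
      next
        case True
        then obtain c where c: "pos (y1 - ratfun2_const c)" by blast
        define y2 where "y2 = y1 - ratfun2_const c"
        have evs: "ev x y2 (shift_y c R) = ev x y1 R" for R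
          by (simp add: ev_shift_y y2_def)
        have J2: "jac x y2 = jac x y1"
          using jac_add(2)[of x y1 "- ratfun2_const c"] jac_const(2)[of x "- c"]
          by (simp add: y2_def const.hom_uminus)
        \<comment> \<open>Monomials of \<open>P1\<close>, \<open>Q1\<close> free of \<open>x\<close>
          come from those of total degree \<open>m\<close>, so \<open>j' \<le> m\<close>:
          multiplicities do not grow at infinitely near points.\<close>
        obtain j' where j': "(0, j') \<in> supp P1 \<union> supp Q1" "(0, j') \<in> supp (shift_y c P1) \<union> supp (shift_y c Q1)"
          using row supp_shift_y_row_0 by blast
        from j'(1) obtain a b where ab: "(a, b) \<in> S" "\<sigma> (a, b) = (0, j')" unfolding supp1 by force
        with min[of a b] have "0 + j' \<le> m" by (simp add: \<sigma>_def)
        then have sj: "s * (0 + j') \<le> r" using sm by (meson le_trans mult_le_mono2)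
        \<comment> \<open>Termination: the blow-up removes \<open>m > 0\<close> copies of an element
          of positive value.\<close>
        have "\<nu> (ev x y1 Q1) < \<nu> (ev x y Q)" using vQ vx m by simp
        moreover have "integral (ev x y Q)" by (rule integral_ev[OF int])
        ultimately have lt: "nat (\<nu> (ev x y2 (shift_y c Q1))) < nat (\<nu> (ev x y Q))"
          using Q0 Q10 integral_ev[OF int(1) y1, of Q1] by (auto simp: evs integral_def)
        have "int s * \<nu> (ev x y2 (shift_y c Q1)) \<le> int r * (\<nu> (jac x y2) - \<epsilon>)"
          by (rule less.hyps[OF lt x _ _ _ _ j'(2) sj]) (use c J1 PQ1 Q10 in \<open>simp_all add: J2 evs y2_def[symmetric]\<close>)
        then show ?thesis by (simp add: evs J2)
      qed
      then show ?thesis using sm_mult[OF vx] unfolding vQ vJ by (simp add: algebra_simps)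
    next
      case False
      \<comment> \<open>Here \<open>x / y\<close> has positive value, so the new centre is already
        the origin of the second chart.\<close>
      define x1 where "x1 = x / y"
      have x1: "pos x1" using False x0 y0 by (simp add: x1_def pos_def val_divide)
      define \<sigma> where "\<sigma> = (\<lambda>(i, j). (i, i + j - m))"
      define P1 Q1 where "P1 = mon_map \<sigma> P" "Q1 = mon_map \<sigma> Q"
      have inj: "inj_on \<sigma> S"
        by (rule inj_onI) (auto simp: \<sigma>_def dest!: min)
      have ev: "ev x y R = y ^ m * ev x1 y (mon_map \<sigma> R)" if "supp R \<subseteq> S" for R
      proof (rule ev_mon_map)
        fix i j assume "(i, j) \<in> supp R"
        then have "m + (i + j - m) = i + j" using min that by auto
        then have "y ^ m * y ^ (i + j - m) = y ^ i * y ^ j" by (simp flip: power_add)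
        then have "y ^ m * y ^ (i + j - m) * (x1 ^ i) = (y ^ i * x1 ^ i) * y ^ j" by simp
        also have "y ^ i * x1 ^ i = x ^ i" using y0 by (simp add: x1_def flip: power_mult_distrib)
        finally show "y ^ m * (x1 ^ fst (\<sigma> (i, j)) * y ^ snd (\<sigma> (i, j))) = x ^ i * y ^ j"
          by (simp add: \<sigma>_def mult_ac)
      qed
      have evP: "ev x y P = y ^ m * ev x1 y P1" and evQ: "ev x y Q = y ^ m * ev x1 y Q1"
        unfolding P1_Q1_def by (intro ev; simp add: S_def)+
      have PQ1: "ev x1 y P1 = t1 * ev x1 y Q1" using PQ y0 by (simp add: evP evQ)
      have Q10: "ev x1 y Q1 \<noteq> 0" using Q0 evQ by auto
      have Jeq: "jac x y = y * jac x1 y"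
        using y0 jac_mult(1)[of x1 y y] by (simp add: x1_def)
      have J1: "jac x1 y \<noteq> 0" using J Jeq by auto
      have supp1: "supp P1 \<union> supp Q1 = \<sigma> ` S"
        unfolding P1_Q1_def S_def image_Un
        by (intro arg_cong2[of _ _ _ _ "(\<union>)"] supp_mon_map inj_on_subset[OF inj]) (auto simp: S_def)
      have "\<sigma> (i, j) \<in> \<sigma> ` S" using ij by blast
      then have row: "(i, 0) \<in> supp P1 \<union> supp Q1" unfolding supp1 using ij by (simp add: \<sigma>_def)
      have vQ: "\<nu> (ev x y Q) = int m * \<nu> y + \<nu> (ev x1 y Q1)"
        unfolding evQ using y0 Q10 by (simp add: mult val_power)
      have vJ: "\<nu> (jac x y) = \<nu> y + \<nu> (jac x1 y)"
        unfolding Jeq using y0 J1 by (rule mult)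
      have "i + 0 \<le> m" using ij(2) by simp
      then have si: "s * (i + 0) \<le> r" using sm by (meson le_trans mult_le_mono2)
      have "\<nu> (ev x1 y Q1) < \<nu> (ev x y Q)" using vQ vy m by simp
      moreover have "integral (ev x y Q)" by (rule integral_ev[OF int])
      ultimately have lt: "nat (\<nu> (ev x1 y Q1)) < nat (\<nu> (ev x y Q))"
        using Q0 Q10 integral_ev[OF pos_imp_integral[OF x1] int(2), of Q1] by (auto simp: integral_def)
      have "int s * \<nu> (ev x1 y Q1) \<le> int r * (\<nu> (jac x1 y) - \<epsilon>)"
        by (rule less.hyps[OF lt x1 y J1 PQ1 Q10 row si])
      then show ?thesis using sm_mult[OF vy] unfolding vQ vJ by (simp add: algebra_simps)
    qed
  qed
qed

end

section \<open>The bound for centres of every kind\<close>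

definition shift_xy :: "'k::comm_ring_1 \<Rightarrow> 'k \<Rightarrow> 'k poly poly \<Rightarrow> 'k poly poly"
  where "shift_xy a b P = shift_y b (shift_x a P)"

lemma ev_shift_xy: "ev x y (shift_xy a b P) = ev (x + ratfun2_const a) (y + ratfun2_const b) P"
  by (simp add: shift_xy_def ev_shift_y ev_shift_x)

lemma supp_shift_xy:
  fixes a b :: "'k::idom"
  assumes "(i, j) \<in> supp (shift_xy a b P)"
  shows "\<exists>i' j'. i \<le> i' \<and> j \<le> j' \<and> (i', j') \<in> supp P"
  using assms supp_shift_x supp_shift_y unfolding shift_xy_def by meson

lemma shift_xy_eq_0_iff [simp]: "shift_xy (a::'k::idom) b P = 0 \<longleftrightarrow> P = 0"
  by (simp add: shift_xy_def)

lemma jac_diff_const: "jac (x - ratfun2_const a) (y - ratfun2_const b) = jac x y"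
proof -
  have "jac (x + ratfun2_const (- a)) (y + ratfun2_const (- b)) = jac x y"
    by (simp only: jac_add jac_const add_0_right)
  then show ?thesis by (simp add: const.hom_uminus)
qed

text \<open>Gauss's lemma: \<open>R\<close> has no linear factor in the inner variable alone, so the
  linear factors of \<open>g\<close> can be cancelled against \<open>S\<close> one by one.\<close>

lemma gauss_dvd:
  fixes R F S :: "'k::alg_closed_field poly poly"
  assumes R: "\<And>a. \<not> [:[:- a, 1:]:] dvd R"
    and "g \<noteq> 0" "Polynomial.smult g F = R * S"
  shows "R dvd F"
  using assms(2,3)
proof (induction "degree g" arbitrary: g S rule: less_induct)
  case (less g S)
  show ?case
  proof (cases "degree g = 0")
    case True
    then obtain c where c: "g = [:c:]" by (rule degree_eq_zeroE)
    with less.prems have "c \<noteq> 0" by auto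
    have "F = Polynomial.smult [:inverse c:] (Polynomial.smult g F)"
      using \<open>c \<noteq> 0\<close> by (simp add: c flip: one_pCons)
    also have "\<dots> = R * Polynomial.smult [:inverse c:] S"
      unfolding less.prems by simp
    finally show ?thesis by (rule dvdI)
  next
    case False
    then obtain a where "poly g a = 0" using alg_closed_imp_poly_has_root by blast
    then obtain g' where g': "g = [:- a, 1:] * g'" by (auto simp: poly_eq_0_iff_dvd elim: dvdE)
    have g'0: "g' \<noteq> 0" using less.prems(1) g' by auto
    have "prime_elem [:[:- a, 1:]:]" by (intro lift_prime_elem_poly prime_elem_linear_field_poly) simp
    moreover have "R * S = [:[:- a, 1:]:] * Polynomial.smult g' F"
      unfolding less.prems(2)[symmetric] g' by simp
    then have "[:[:- a, 1:]:] dvd R * S" by (rule dvdI)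
    ultimately have "[:[:- a, 1:]:] dvd S" using R by (simp add: prime_elem_dvd_mult_iff)
    then obtain S' where S': "S = [:[:- a, 1:]:] * S'" by (elim dvdE)
    have "[:[:- a, 1:]:] * Polynomial.smult g' F = [:[:- a, 1:]:] * (R * S')"
      using \<open>R * S = _\<close> unfolding S' by (metis mult.left_commute)
    then have eq: "Polynomial.smult g' F = R * S'" by (subst (asm) mult_cancel_left) auto
    have "degree g' < degree g" unfolding g' using g'0 by (subst degree_mult_eq) auto
    from less.hyps[OF this g'0 eq] show ?thesis .
  qed
qed

context place_alg_closed
begin

text \<open>The residue of \<open>x\<close> is transcendental, so the centre has positive dimension.
  The polynomials vanishing on it are multiples of a single one, which would divide both
  \<open>P\<close> and \<open>Q\<close>.\<close>

lemma coprime_not_pos: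
  assumes "integral x" "integral y" and tr: "\<And>c. \<not> pos (x - ratfun2_const c)" and "coprime P Q"
  shows "\<not> pos (ev x y P) \<or> \<not> pos (ev x y Q)"
proof (rule ccontr)
  assume "\<not> ?thesis"
  then have PQ: "pos (ev x y P)" "pos (ev x y Q)" by auto
  have PQ0: "P \<noteq> 0 \<or> Q \<noteq> 0" using \<open>coprime P Q\<close> by auto
  define I where "I = {R. R \<noteq> 0 \<and> pos (ev x y R)}"
  \<comment> \<open>Minimal \<open>d\<close> makes pseudo-division by \<open>R\<close> exact;
    minimal \<open>e\<close> excludes factors of \<open>R\<close> that depend on \<open>x\<close>
    alone. Together they make \<open>R\<close> a divisor of every polynomial vanishing at the
    centre.\<close>
  define d where "d = (LEAST d. \<exists>R\<in>I. degree R = d)"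
  define e where "e = (LEAST e. \<exists>R\<in>I. degree R = d \<and> degree (lead_coeff R) = e)"
  have "\<exists>d. \<exists>R\<in>I. degree R = d" using PQ PQ0 by (auto simp: I_def)
  then have exd: "\<exists>R\<in>I. degree R = d" unfolding d_def by (rule LeastI_ex)
  have mind: "d \<le> degree R" if "R \<in> I" for R unfolding d_def by (rule Least_le) (use that in blast)
  from exd have "\<exists>e. \<exists>R\<in>I. degree R = d \<and> degree (lead_coeff R) = e" by blast
  then have "\<exists>R\<in>I. degree R = d \<and> degree (lead_coeff R) = e" unfolding e_def by (rule LeastI_ex)
  then obtain R where R: "R \<in> I" "degree R = d" "degree (lead_coeff R) = e" by blast
  have mine: "e \<le> degree (lead_coeff R')" if "R' \<in> I" "degree R' = d" for R'
    unfolding e_def by (rule Least_le) (use that in blast)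
  have R0: "R \<noteq> 0" and Rpos: "pos (ev x y R)" using R by (auto simp: I_def)
  have prim: "\<not> [:[:- a, 1:]:] dvd R" for a
  proof
    assume "[:[:- a, 1:]:] dvd R"
    then obtain R' where R': "R = [:[:- a, 1:]:] * R'" by (elim dvdE)
    with R0 have R'0: "R' \<noteq> 0" by auto
    have "ev x y R = (x - ratfun2_const a) * ev x y R'"
      unfolding R' ev.hom_mult by (simp add: const.hom_uminus)
    then have "pos (ev x y R')"
      using Rpos tr[of a] assms by (simp add: pos_mult_iff integral_diff integral_ev)
    moreover have "degree R' = d" using R(2) unfolding R' using R'0 by (subst (asm) degree_mult_eq) auto
    moreover have "degree (lead_coeff R') < e"
      unfolding R(3)[symmetric] unfolding R' lead_coeff_mult using R'0 by (subst degree_mult_eq) auto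
    ultimately show False using mine[of R'] R'0 by (auto simp: I_def)
  qed
  have dvd: "R dvd F" if F: "pos (ev x y F)" for F
  proof -
    from pseudo_mod(1)[OF R0, of F] obtain g S where gS: "g \<noteq> 0" "Polynomial.smult g F = R * S + pseudo_mod F R" by blast
    have "ev x y (pseudo_mod F R) = ev1 x g * ev x y F - ev x y R * ev x y S"
      using arg_cong[OF gS(2), of "ev x y"] by (simp add: ev.hom_add ev.hom_mult ev_def hom_distribs)
    then have "pos (ev x y (pseudo_mod F R))"
      using F Rpos assms by (auto intro!: pos_diff intro: pos_mult integral_ev integral_ev1 simp: mult.commute[of "ev1 x g"])
    then have "pseudo_mod F R = 0"
      using pseudo_mod(2)[OF R0, of F] mind[of "pseudo_mod F R"] R(2) unfolding I_def by fastforce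
    with gS have "Polynomial.smult g F = R * S" by simp
    from gauss_dvd[OF prim gS(1) this] show ?thesis .
  qed
  have "is_unit R" using \<open>coprime P Q\<close> dvd[OF PQ(1)] dvd[OF PQ(2)] by (rule coprime_common_divisor)
  then obtain c where c: "R = [:[:c:]:]" "c \<noteq> 0"
    by (auto simp: is_unit_poly_iff dvd_field_iff elim!: degree_eq_zeroE)
  then show False using Rpos not_pos_const[of c] by simp
qed

lemma shift_x_row_0:
  fixes P :: "'k poly poly"
  assumes "\<And>j. (0, j) \<notin> supp (shift_x a P)"
  shows "[:[:- a, 1:]:] dvd P"
proof -
  have "poly (coeff P j) a = 0" for j
  proof -
    have "coeff (coeff (shift_x a P) j) 0 = poly (coeff P j) a"
      by (simp add: shift_x_def coeff_map_poly flip: poly_0_coeff_0) (simp add: poly_pcompose)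
    with assms[of j] show ?thesis by (simp add: supp_iff)
  qed
  then show ?thesis by (simp add: const_poly_dvd_iff poly_eq_0_iff_dvd)
qed

text \<open>The centre lies on no line \<open>x = a\<close> (coprimality applies), is such a line
  (it is no common component), or is a point \<open>(a, b)\<close>, where the multiplicity bound
  enters.\<close>

lemma bound:
  assumes int: "integral x" "integral y" and J: "jac x y \<noteq> 0"
    and PQ: "ev x y P = t1 * ev x y Q" "ev x y Q \<noteq> 0" and cop: "coprime P Q"
    and pt: "\<And>a b. pos (x - ratfun2_const a) \<Longrightarrow> pos (y - ratfun2_const b) \<Longrightarrow>
       \<exists>(i, j)\<in>supp (shift_xy a b P) \<union> supp (shift_xy a b Q). s * (i + j) \<le> r"
  shows "int s * \<nu> (ev x y Q) \<le> int r * (\<nu> (jac x y) - \<epsilon>)"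
proof (cases "\<exists>a. pos (x - ratfun2_const a)")
  case False
  then show ?thesis
    using bound_if_not_pos[OF int J PQ coprime_not_pos[OF int _ cop]] by blast
next
  case True
  then obtain a where a: "pos (x - ratfun2_const a)" by blast
  show ?thesis
  proof (cases "\<exists>b. pos (y - ratfun2_const b)")
    case True
    then obtain b where b: "pos (y - ratfun2_const b)" by blast
    from pt[OF a b] obtain i j where ij: "(i, j) \<in> supp (shift_xy a b P) \<union> supp (shift_xy a b Q)" "s * (i + j) \<le> r"
      by blast
    have ev: "ev (x - ratfun2_const a) (y - ratfun2_const b) (shift_xy a b R) = ev x y R" for R
      by (simp add: ev_shift_xy)
    show ?thesis
      using local_bound[OF a b _ _ _ ij] J PQ by (simp add: ev jac_diff_const)
  next
    case False
    have "\<exists>j. (0, j) \<in> supp (shift_x a P) \<union> supp (shift_x a Q)"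
    proof (rule ccontr)
      assume "\<not> ?thesis"
      then have "[:[:- a, 1:]:] dvd P" "[:[:- a, 1:]:] dvd Q" by (auto intro!: shift_x_row_0)
      with cop have "is_unit [:[:- a, 1:]:]" by (rule coprime_common_divisor)
      then show False by (auto simp: is_unit_poly_iff)
    qed
    then obtain j where j: "(0, j) \<in> supp (shift_x a P) \<or> (0, j) \<in> supp (shift_x a Q)" by blast
    have ev: "ev (x - ratfun2_const a) y (shift_x a R) = ev x y R" for R
      by (simp add: ev_shift_x)
    from j have "\<not> pos (ev x y P) \<or> \<not> pos (ev x y Q)"
      using not_pos_ev_row_0[OF a int(2), of j "shift_x a P"] not_pos_ev_row_0[OF a int(2), of j "shift_x a Q"] False
      unfolding ev by blast
    then show ?thesis by (rule bound_if_not_pos[OF int J PQ])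
  qed
qed

end

section \<open>Presentations on Hirzebruch surfaces\<close>

text \<open>Right composition acts on the coordinates: \<open>\<phi> \<circ> mul_xy\<close> replaces
  \<open>\<phi> t2\<close> by \<open>\<phi> t1 * \<phi> t2\<close>. Scalings are absent because
  inversions and translations produce them, see \<open>basis_scale\<close>.\<close>

locale move_closed =
  fixes S :: "('k::alg_closed_field ratfun2 \<Rightarrow> 'k ratfun2) set"
  assumes subset_Cr2: "S \<subseteq> carrier Cr2"
    and swap: "\<phi> \<in> S \<Longrightarrow> \<phi> \<circ> swap \<in> S"
    and inv_y: "\<phi> \<in> S \<Longrightarrow> \<phi> \<circ> inv_y \<in> S"
    and add_y: "\<phi> \<in> S \<Longrightarrow> \<phi> \<circ> add_y b \<in> S"
    and mul_xy: "\<phi> \<in> S \<Longrightarrow> \<phi> \<circ> mul_xy \<in> S"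
begin

definition basis :: "'k ratfun2 \<Rightarrow> 'k ratfun2 \<Rightarrow> bool"
  where "basis x y \<longleftrightarrow> (\<exists>\<phi>\<in>S. \<phi> t1 = x \<and> \<phi> t2 = y)"

lemma basisE:
  assumes "basis x y"
  obtains \<phi> where "\<phi> \<in> S" "ratfun2_hom \<phi>" "\<phi> t1 = x" "\<phi> t2 = y"
  using assms subset_Cr2 by (auto simp: basis_def carrier_Cr2)

lemma basis_swap: assumes "basis x y" shows "basis y x"
proof -
  from assms obtain \<phi> where \<phi>: "\<phi> \<in> S" "ratfun2_hom \<phi>" "\<phi> t1 = x" "\<phi> t2 = y" by (rule basisE)
  show ?thesis unfolding basis_def
    by (rule bexI[OF _ swap[OF \<phi>(1)]]) (simp add: \<phi>)
qed

lemma basis_inverse: assumes "basis x y" shows "basis x (inverse y)"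
proof -
  from assms obtain \<phi> where \<phi>: "\<phi> \<in> S" "ratfun2_hom \<phi>" "\<phi> t1 = x" "\<phi> t2 = y" by (rule basisE)
  interpret ratfun2_hom \<phi> by fact
  show ?thesis unfolding basis_def
    by (rule bexI[OF _ inv_y[OF \<phi>(1)]]) (simp add: \<phi> hom_inverse)
qed

lemma basis_add: assumes "basis x y" shows "basis x (y + ratfun2_const b)"
proof -
  from assms obtain \<phi> where \<phi>: "\<phi> \<in> S" "ratfun2_hom \<phi>" "\<phi> t1 = x" "\<phi> t2 = y" by (rule basisE)
  interpret ratfun2_hom \<phi> by fact
  show ?thesis unfolding basis_def
    by (rule bexI[OF _ add_y[OF \<phi>(1)]]) (simp add: \<phi> hom_add)
qed

lemma basis_mult: assumes "basis x y" shows "basis x (y * x)"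
proof -
  from assms obtain \<phi> where \<phi>: "\<phi> \<in> S" "ratfun2_hom \<phi>" "\<phi> t1 = x" "\<phi> t2 = y" by (rule basisE)
  interpret ratfun2_hom \<phi> by fact
  show ?thesis unfolding basis_def
    by (rule bexI[OF _ mul_xy[OF \<phi>(1)]]) (simp add: \<phi> hom_mult)
qed

lemma basis_nonzero: assumes "basis x y" shows "x \<noteq> 0" "y \<noteq> 0"
proof -
  from assms obtain \<phi> where \<phi>: "\<phi> \<in> S" "ratfun2_hom \<phi>" "\<phi> t1 = x" "\<phi> t2 = y" by (rule basisE)
  interpret ratfun2_hom \<phi> by fact
  show "x \<noteq> 0" "y \<noteq> 0" using \<phi>(3,4) by auto
qed

lemma basis_divide: assumes "basis x y" shows "basis x (y / x)"
  using basis_inverse[OF basis_mult[OF basis_inverse[OF assms]]] by (simp add: divide_inverse)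

lemma basis_diff: "basis x y \<Longrightarrow> basis (x - ratfun2_const a) (y - ratfun2_const b)"
  using basis_add[of x y "- b"] basis_swap basis_add[of _ x "- a"] by (simp add: const.hom_uminus)

lemma basis_inverse_left: "basis x y \<Longrightarrow> basis (inverse x) y"
  using basis_inverse basis_swap by blast

lemma basis_mult_power: assumes "basis x y" shows "basis x (y * x ^ n)" "basis x (y * inverse x ^ n)"
proof -
  show "basis x (y * x ^ n)"
    by (induction n) (use assms basis_mult in \<open>auto simp: mult_ac dest: basis_mult\<close>)
  show "basis x (y * inverse x ^ n)"
    by (induction n) (use assms in \<open>auto simp: divide_inverse mult_ac dest: basis_divide\<close>)
qed

lemma basis_mult_power_int: "basis x y \<Longrightarrow> basis x (y * x powi n)"
  using basis_mult_power by (simp add: power_int_def)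

lemma jac_basis_nonzero: "basis x y \<Longrightarrow> jac x y \<noteq> 0"
  unfolding basis_def using jac_Cr2_nonzero subset_Cr2 by blast

lemma ev_basis_eq_0_iff: assumes "basis x y" shows "ev x y P = 0 \<longleftrightarrow> P = 0"
proof -
  from assms obtain \<phi> where \<phi>: "\<phi> \<in> S" "ratfun2_hom \<phi>" "\<phi> t1 = x" "\<phi> t2 = y" by (rule basisE)
  interpret ratfun2_hom \<phi> by fact
  have "ev x y P = \<phi> (ev t1 t2 P)" by (simp add: hom_ev \<phi>)
  then show ?thesis by simp
qed

text \<open>A presentation \<open>t\<^sub>1 = P(x,y) / Q(x,y)\<close> by sections of a line bundle on the Hirzebruch surface
  \<open>F\<^sub>n\<close>: the fibration \<open>t\<^sub>1\<close> has degree \<open>d\<close> on the fibres \<open>x = const\<close>, and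
  \<open>2e - nd + 2d\<close> is its intersection number with the anticanonical class.\<close>

definition pres :: "'k ratfun2 \<Rightarrow> 'k ratfun2 \<Rightarrow> 'k poly poly \<Rightarrow> 'k poly poly \<Rightarrow> nat \<Rightarrow> int \<Rightarrow> int \<Rightarrow> bool"
  where "pres x y P Q d n e \<longleftrightarrow> basis x y \<and> ev x y P = t1 * ev x y Q \<and> Q \<noteq> 0 \<and>
    (\<forall>(i, j)\<in>supp P \<union> supp Q. j \<le> d \<and> int i \<le> e - n * int j)"

text \<open>Only \<open>d\<close> is at stake: for \<open>n = 0\<close> any finite support fits into
  a rectangle.\<close>

lemma presI_degree:
  assumes "basis x y" "ev x y P = t1 * ev x y Q" "Q \<noteq> 0" "\<And>i j. (i, j) \<in> supp P \<union> supp Q \<Longrightarrow> j \<le> d"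
  shows "\<exists>e. pres x y P Q d 0 e"
proof -
  let ?A = "fst ` (supp P \<union> supp Q)"
  have "i \<le> Max ?A" if "(i, j) \<in> supp P \<union> supp Q" for i j
    by (rule Max_ge) (use that in force)+
  then show ?thesis
    unfolding pres_def using assms by (intro exI[of _ "int (Max ?A)"]) auto
qed

lemma ex_pres: assumes "S \<noteq> {}" shows "\<exists>x y P Q d e. pres x y P Q d 0 e"
proof -
  obtain \<phi> where \<phi>: "\<phi> \<in> S" using assms by blast
  then have "bij \<phi>" "ratfun2_hom \<phi>" using subset_Cr2 by (auto simp: carrier_Cr2)
  interpret ratfun2_hom \<phi> by fact
  obtain f where f: "\<phi> f = t1" using \<open>bij \<phi>\<close> by (metis bij_pointE)
  obtain A B where AB: "B \<noteq> 0" "f = ev t1 t2 A / ev t1 t2 B" by (rule ratfun2_cases)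
  have basis: "basis (\<phi> t1) (\<phi> t2)" using \<phi> by (auto simp: basis_def)
  have "t1 = ev (\<phi> t1) (\<phi> t2) A / ev (\<phi> t1) (\<phi> t2) B"
    using f by (simp add: AB hom_div hom_ev)
  then have "ev (\<phi> t1) (\<phi> t2) A = t1 * ev (\<phi> t1) (\<phi> t2) B"
    using ev_basis_eq_0_iff[OF basis, of B] AB(1) by (simp add: field_simps)
  moreover have "j \<le> max (degree A) (degree B)" if "(i, j) \<in> supp A \<union> supp B" for i j
    using that supp_degree[of i j A] supp_degree[of i j B] by auto
  ultimately show ?thesis using presI_degree[OF basis _ AB(1)] by blast
qed

end

lemma inj_on_Un_supp_mon_map:
  assumes "inj_on \<sigma> (supp P \<union> supp Q)"
  shows "supp (mon_map \<sigma> P) \<union> supp (mon_map \<sigma> Q) = \<sigma> ` (supp P \<union> supp Q)"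
    "Q \<noteq> 0 \<Longrightarrow> mon_map \<sigma> Q \<noteq> 0"
proof -
  have "inj_on \<sigma> (supp P)" "inj_on \<sigma> (supp Q)" using assms by (auto intro: inj_on_subset)
  then show "supp (mon_map \<sigma> P) \<union> supp (mon_map \<sigma> Q) = \<sigma> ` (supp P \<union> supp Q)"
    "Q \<noteq> 0 \<Longrightarrow> mon_map \<sigma> Q \<noteq> 0"
    by (auto simp: supp_mon_map mon_map_nonzero image_Un)
qed

lemma ex_min_monomial:
  assumes "(S :: (nat \<times> nat) set) \<noteq> {}"
  obtains i j m where "(i, j) \<in> S" "i + j = m" "\<forall>i j. (i, j) \<in> S \<longrightarrow> m \<le> i + j"
proof -
  define m where "m = (LEAST m. \<exists>(i, j)\<in>S. i + j = m)"
  from assms obtain a b where "(a, b) \<in> S" by auto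
  then have "\<exists>m. \<exists>(i, j)\<in>S. i + j = m" by (intro exI[of _ "a + b"] bexI[of _ "(a, b)"]) auto
  then have "\<exists>(i, j)\<in>S. i + j = m" unfolding m_def by (rule LeastI_ex)
  moreover have "m \<le> i + j" if "(i, j) \<in> S" for i j
    unfolding m_def by (rule Least_le) (use that in auto)
  ultimately show thesis using that by auto
qed

text \<open>\<open>d\<close> is minimal over all surfaces and bases. The summand \<open>2 d\<close>
  of the anticanonical degree is left out of \<open>\<mu>\<close>, as \<open>d\<close> is fixed by
  then.\<close>

locale minimal_pres = move_closed +
  fixes d :: nat and \<mu> :: int
  assumes d_pos: "d > 0"
    and min_d: "pres x y P Q d' n e \<Longrightarrow> d \<le> d'"
    and min_mu: "pres x y P Q d n e \<Longrightarrow> \<mu> \<le> 2 * e - n * int d"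
begin

definition opt :: "'a ratfun2 \<Rightarrow> 'a ratfun2 \<Rightarrow> 'a poly poly \<Rightarrow> 'a poly poly \<Rightarrow> int \<Rightarrow> int \<Rightarrow> bool"
  where "opt x y P Q n e \<longleftrightarrow> pres x y P Q d n e \<and> 2 * e - n * int d = \<mu>"

lemma min_degree:
  assumes "basis x y" "ev x y P = t1 * ev x y Q" "Q \<noteq> 0" "\<And>i j. (i, j) \<in> supp P \<union> supp Q \<Longrightarrow> j \<le> d'"
  shows "d \<le> d'"
proof -
  obtain e where "pres x y P Q d' 0 e" using presI_degree[OF assms(1-3)] assms(4) by blast
  then show ?thesis by (rule min_d)
qed

lemma top_monomial:
  assumes "pres x y P Q d n e"
  shows "\<exists>i. (i, d) \<in> supp P \<union> supp Q"
proof (rule ccontr)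
  assume *: "\<not> ?thesis"
  have "j \<le> d - 1" if ij: "(i, j) \<in> supp P \<union> supp Q" for i j
  proof -
    have "j \<le> d" using assms ij by (auto simp: pres_def)
    moreover have "j \<noteq> d" using * ij by blast
    ultimately show ?thesis by simp
  qed
  then have "d \<le> d - 1" using assms by (intro min_degree[of x y P Q]) (auto simp: pres_def)
  then show False using d_pos by simp
qed

text \<open>A common factor involving \<open>y\<close> would lower \<open>d\<close>; one in
  \<open>x\<close> alone would lower \<open>e\<close> and with it the anticanonical degree.\<close>

lemma opt_coprime:
  assumes "opt x y P Q n e"
  shows "coprime P Q"
proof (rule coprimeI)
  fix R assume "R dvd P" "R dvd Q"
  then obtain P' Q' where PQ: "P = R * P'" "Q = R * Q'" by (auto elim!: dvdE)
  from assms have b: "basis x y" and rel: "ev x y P = t1 * ev x y Q" and Q: "Q \<noteq> 0"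
    and s: "\<And>i j. (i, j) \<in> supp P \<union> supp Q \<Longrightarrow> j \<le> d \<and> int i \<le> e - n * int j"
    and mu: "2 * e - n * int d = \<mu>"
    by (auto simp: opt_def pres_def)
  have R: "R \<noteq> 0" and Q': "Q' \<noteq> 0" using Q PQ by auto
  have "ev x y R \<noteq> 0" "ev x y Q \<noteq> 0" using R Q b by (simp_all add: ev_basis_eq_0_iff)
  then have rel': "ev x y P' = t1 * ev x y Q'" and P: "P \<noteq> 0"
    using rel by (auto simp: PQ ev.hom_mult)
  then have P': "P' \<noteq> 0" using PQ by auto
  have lead: "(degree (lead_coeff F), degree F) \<in> supp F" if "F \<noteq> 0" for F :: "'a poly poly"
    using that by (simp add: supp_iff)
  have "degree P \<le> d" "degree Q \<le> d" using s lead[OF P] lead[OF Q] by auto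
  then have "degree P' + degree R \<le> d" "degree Q' + degree R \<le> d"
    using R P' Q' by (simp_all add: PQ degree_mult_eq)
  then have "d \<le> d - degree R"
    by (intro min_degree[OF b rel' Q']) (auto dest!: supp_degree)
  then have "degree R = 0" using d_pos \<open>degree Q' + degree R \<le> d\<close> by simp
  then obtain r where r: "R = [:r:]" by (rule degree_eq_zeroE)
  with R have r0: "r \<noteq> 0" by auto
  have bd: "int i \<le> e - int (degree r) - n * int j \<and> j \<le> d"
    if ij: "(i, j) \<in> supp F" and F: "[:r:] * F = P \<or> [:r:] * F = Q" for i j F
  proof -
    from ij have "coeff F j \<noteq> 0" "i \<le> degree (coeff F j)" by (auto simp: supp_iff intro: le_degree)
    moreover have "coeff ([:r:] * F) j = r * coeff F j" by simp
    ultimately have "(degree r + degree (coeff F j), j) \<in> supp ([:r:] * F)"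
      using r0 by (simp add: supp_iff coeff_mult_degree_sum)
    then have "int (degree r + degree (coeff F j)) \<le> e - n * int j \<and> j \<le> d" using s F by fastforce
    then show ?thesis using \<open>i \<le> _\<close> by simp
  qed
  have "pres x y P' Q' d n (e - int (degree r))"
    unfolding pres_def using b rel' Q' bd PQ r by fastforce
  from min_mu[OF this] mu have "degree r = 0" by simp
  then obtain c where c: "r = [:c:]" by (rule degree_eq_zeroE)
  with r0 have "c \<noteq> 0" by auto
  then show "is_unit R" by (simp add: r c is_unit_const_poly_iff dvd_field_iff)
qed

text \<open>Exchanging the sections \<open>y = 0\<close> and \<open>y = \<infinity>\<close>
  identifies \<open>F_n\<close> with \<open>F_{-n}\<close> and preserves both degrees.\<close>

lemma opt_inverse_y:
  assumes "opt x y P Q n e"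
  defines "\<sigma> \<equiv> \<lambda>(i, j). (i, d - j)"
  shows "opt x (inverse y) (mon_map \<sigma> P) (mon_map \<sigma> Q) (- n) (e - n * int d)"
    and "ev x y Q = y ^ d * ev x (inverse y) (mon_map \<sigma> Q)"
proof -
  from assms have b: "basis x y" and rel: "ev x y P = t1 * ev x y Q" and Q: "Q \<noteq> 0"
    and s: "\<And>i j. (i, j) \<in> supp P \<union> supp Q \<Longrightarrow> j \<le> d \<and> int i \<le> e - n * int j"
    and mu: "2 * e - n * int d = \<mu>"
    by (auto simp: opt_def pres_def)
  have y0: "y \<noteq> 0" using basis_nonzero[OF b] by simp
  have ev: "ev x y F = y ^ d * ev x (inverse y) (mon_map \<sigma> F)" if "supp F \<subseteq> supp P \<union> supp Q" for F
    unfolding \<sigma>_def by (rule ev_inverse_y[OF y0]) (use s that in blast)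
  show evQ: "ev x y Q = y ^ d * ev x (inverse y) (mon_map \<sigma> Q)" by (rule ev) simp
  have evP: "ev x y P = y ^ d * ev x (inverse y) (mon_map \<sigma> P)" by (rule ev) simp
  have "inj_on \<sigma> (supp P \<union> supp Q)"
    by (rule inj_onI) (auto simp: \<sigma>_def dest!: s[OF UnI1] s[OF UnI2])
  note supp = inj_on_Un_supp_mon_map[OF this]
  have "pres x (inverse y) (mon_map \<sigma> P) (mon_map \<sigma> Q) d (- n) (e - n * int d)"
    unfolding pres_def supp(1)
  proof (intro conjI)
    show "ev x (inverse y) (mon_map \<sigma> P) = t1 * ev x (inverse y) (mon_map \<sigma> Q)"
      using rel y0 by (simp add: evP evQ)
    show "\<forall>(i, j)\<in>\<sigma> ` (supp P \<union> supp Q). j \<le> d \<and> int i \<le> e - n * int d - (- n) * int j"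
    proof safe
      fix a b i j assume "(a, b) = \<sigma> (i, j)" "(i, j) \<in> supp P"
      with s[of i j] show "b \<le> d" "int a \<le> e - n * int d - (- n) * int b"
        by (auto simp: \<sigma>_def of_nat_diff algebra_simps)
    next
      fix a b i j assume "(a, b) = \<sigma> (i, j)" "(i, j) \<in> supp Q"
      with s[of i j] show "b \<le> d" "int a \<le> e - n * int d - (- n) * int b"
        by (auto simp: \<sigma>_def of_nat_diff algebra_simps)
    qed
  qed (use b Q supp(2) basis_inverse in auto)
  then show "opt x (inverse y) (mon_map \<sigma> P) (mon_map \<sigma> Q) (- n) (e - n * int d)"
    unfolding opt_def using mu by (simp add: algebra_simps)
qed

text \<open>The chart of \<open>F_n\<close> around the fibre \<open>x = \<infinity>\<close>; the
  twist of \<open>y\<close> is the transition function of the ruled surface.\<close>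

lemma opt_inverse_x:
  assumes "opt x y P Q n e"
  defines "\<sigma> \<equiv> \<lambda>(i, j). (nat (e - n * int j) - i, j)"
  shows "opt (inverse x) (y * x powi (- n)) (mon_map \<sigma> P) (mon_map \<sigma> Q) n e"
    and "ev x y Q = x powi e * ev (inverse x) (y * x powi (- n)) (mon_map \<sigma> Q)"
proof -
  from assms have b: "basis x y" and rel: "ev x y P = t1 * ev x y Q" and Q: "Q \<noteq> 0"
    and s: "\<And>i j. (i, j) \<in> supp P \<union> supp Q \<Longrightarrow> j \<le> d \<and> int i \<le> e - n * int j"
    and mu: "2 * e - n * int d = \<mu>"
    by (auto simp: opt_def pres_def)
  have x0: "x \<noteq> 0" using basis_nonzero[OF b] by simp
  let ?x = "inverse x" and ?y = "y * x powi (- n)"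
  have ev: "ev x y F = x powi e * ev ?x ?y (mon_map \<sigma> F)" if "supp F \<subseteq> supp P \<union> supp Q" for F
  proof (rule ev_mon_map)
    fix i j assume "(i, j) \<in> supp F"
    then have le: "int i \<le> e - n * int j" using s that by blast
    define k where "k = nat (e - n * int j) - i"
    have k: "int k = e - n * int j - int i" using le by (simp add: k_def)
    have "x powi e * (?x ^ k * ?y ^ j) = x powi e * (x powi (- int k) * (x powi (- n * int j) * y ^ j))"
      by (simp add: power_int_minus power_mult_distrib power_int_power' power_inverse mult_ac)
    also have "\<dots> = x powi (e + (- int k) + (- n * int j)) * y ^ j"
      unfolding power_int_add[OF disjI1[OF x0]] by (simp only: mult.assoc)
    also have "\<dots> = x ^ i * y ^ j" by (simp add: k)
    finally show "x powi e * (?x ^ fst (\<sigma> (i, j)) * ?y ^ snd (\<sigma> (i, j))) = x ^ i * y ^ j"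
      by (simp add: \<sigma>_def k_def)
  qed
  show evQ: "ev x y Q = x powi e * ev ?x ?y (mon_map \<sigma> Q)" by (rule ev) simp
  have evP: "ev x y P = x powi e * ev ?x ?y (mon_map \<sigma> P)" by (rule ev) simp
  have "inj_on \<sigma> (supp P \<union> supp Q)"
  proof (rule inj_onI, clarify)
    fix a b i j assume "(a, b) \<in> supp P \<union> supp Q" "(i, j) \<in> supp P \<union> supp Q" "\<sigma> (a, b) = \<sigma> (i, j)"
    with s[of a b] s[of i j] show "a = i \<and> b = j" by (auto simp: \<sigma>_def)
  qed
  note supp = inj_on_Un_supp_mon_map[OF this]
  have "pres ?x ?y (mon_map \<sigma> P) (mon_map \<sigma> Q) d n e"
    unfolding pres_def supp(1)
  proof (intro conjI)
    show "ev ?x ?y (mon_map \<sigma> P) = t1 * ev ?x ?y (mon_map \<sigma> Q)"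
      using rel x0 by (simp add: evP evQ)
    show "\<forall>(i, j)\<in>\<sigma> ` (supp P \<union> supp Q). j \<le> d \<and> int i \<le> e - n * int j"
    proof safe
      fix a b i j assume "(a, b) = \<sigma> (i, j)" "(i, j) \<in> supp P"
      with s[of i j] show "b \<le> d" "int a \<le> e - n * int b" by (auto simp: \<sigma>_def)
    next
      fix a b i j assume "(a, b) = \<sigma> (i, j)" "(i, j) \<in> supp Q"
      with s[of i j] show "b \<le> d" "int a \<le> e - n * int b" by (auto simp: \<sigma>_def)
    qed
  qed (use b Q supp(2) basis_inverse_left basis_mult_power_int in auto)
  then show "opt ?x ?y (mon_map \<sigma> P) (mon_map \<sigma> Q) n e"
    unfolding opt_def using mu by simp
qed

end

lemma shift_y_0_eq [simp]: "shift_y 0 P = P"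
  using pcompose_idR[of P] by (simp add: shift_y_def del: pcompose_idR)

lemma supp_shift_xy_Un:
  fixes a b :: "'a::idom"
  assumes "(i, j) \<in> supp (shift_xy a b P) \<union> supp (shift_xy a b Q)"
  shows "\<exists>i' j'. i \<le> i' \<and> j \<le> j' \<and> (b = 0 \<longrightarrow> j' = j) \<and> (i', j') \<in> supp P \<union> supp Q"
proof (cases "b = 0")
  case True
  with assms have "(i, j) \<in> supp (shift_x a P) \<union> supp (shift_x a Q)" by (simp add: shift_xy_def)
  then show ?thesis using supp_shift_x[of i j a] by blast
next
  case False
  with assms show ?thesis using supp_shift_xy[of i j a b] by blast
qed

lemma shift_xy_Un_nonempty:
  fixes a b :: "'a::idom"
  shows "Q \<noteq> 0 \<Longrightarrow> supp (shift_xy a b P) \<union> supp (shift_xy a b Q) \<noteq> {}"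
  by auto

context move_closed
begin

text \<open>A chart of the blow-up at \<open>(a, b)\<close>, with the slope as new coordinate. On
  \<open>F_n\<close> this is the elementary transformation centred at the point; on the plane the
  slope is the projection from it.\<close>

lemma project_from_point:
  fixes a b :: 'k and P Q :: "'k poly poly"
  defines "T \<equiv> supp (shift_xy a b P) \<union> supp (shift_xy a b Q)"
  assumes b: "basis x y" and rel: "ev x y P = t1 * ev x y Q" and Q: "Q \<noteq> 0"
    and m: "\<And>i j. (i, j) \<in> T \<Longrightarrow> m \<le> i + j"
  obtains x1 y1 P1 Q1 where "basis x1 y1" "ev x1 y1 P1 = t1 * ev x1 y1 Q1" "Q1 \<noteq> 0"
    "supp P1 \<union> supp Q1 = (\<lambda>(i, j). (i + j - m, j)) ` T"
proof -
  define x1 y0 y1 where "x1 = x - ratfun2_const a" "y0 = y - ratfun2_const b" "y1 = y0 / x1"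
  have b1: "basis x1 y0" unfolding x1_y0_y1_def by (rule basis_diff[OF b])
  have x1: "x1 \<noteq> 0" using basis_nonzero[OF b1] by simp
  let ?\<sigma> = "\<lambda>(i, j). (i + j - m, j)"
  have inj: "inj_on ?\<sigma> T" by (rule inj_onI) (auto dest!: m)
  have ev: "ev x y F = x1 ^ m * ev x1 y1 (mon_map ?\<sigma> (shift_xy a b F))" if "supp (shift_xy a b F) \<subseteq> T" for F
  proof -
    have "ev x y F = ev x1 y0 (shift_xy a b F)" by (simp add: ev_shift_xy x1_y0_y1_def)
    also have "\<dots> = x1 ^ m * ev x1 y1 (mon_map ?\<sigma> (shift_xy a b F))"
    proof (rule ev_mon_map)
      fix i j assume "(i, j) \<in> supp (shift_xy a b F)"
      then have "m + (i + j - m) = i + j" using m that by auto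
      then have "x1 ^ m * x1 ^ (i + j - m) = x1 ^ i * x1 ^ j" by (simp flip: power_add)
      then have "x1 ^ m * x1 ^ (i + j - m) * y1 ^ j = x1 ^ i * (x1 ^ j * y1 ^ j)" by simp
      also have "x1 ^ j * y1 ^ j = y0 ^ j" using x1 by (simp add: x1_y0_y1_def(3) flip: power_mult_distrib)
      finally show "x1 ^ m * (x1 ^ fst (?\<sigma> (i, j)) * y1 ^ snd (?\<sigma> (i, j))) = x1 ^ i * y0 ^ j"
        by (simp add: mult.assoc)
    qed
    finally show ?thesis .
  qed
  have evP: "ev x y P = x1 ^ m * ev x1 y1 (mon_map ?\<sigma> (shift_xy a b P))" by (rule ev) (simp add: T_def)
  have evQ: "ev x y Q = x1 ^ m * ev x1 y1 (mon_map ?\<sigma> (shift_xy a b Q))" by (rule ev) (simp add: T_def)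
  note supp = inj_on_Un_supp_mon_map[OF inj[unfolded T_def], folded T_def]
  show thesis
  proof (rule that)
    show "basis x1 y1" unfolding x1_y0_y1_def(3) by (rule basis_divide[OF b1])
    show "ev x1 y1 (mon_map ?\<sigma> (shift_xy a b P)) = t1 * ev x1 y1 (mon_map ?\<sigma> (shift_xy a b Q))"
      using rel x1 by (simp add: evP evQ)
    show "mon_map ?\<sigma> (shift_xy a b Q) \<noteq> 0" by (rule supp(2)) (simp add: Q)
  qed (rule supp(1))
qed

lemma swap_pres:
  assumes "basis x y" "ev x y P = t1 * ev x y Q" "Q \<noteq> 0"
  obtains P1 Q1 where "basis y x" "ev y x P1 = t1 * ev y x Q1" "Q1 \<noteq> 0"
    "supp P1 \<union> supp Q1 = (\<lambda>(i, j). (j, i)) ` (supp P \<union> supp Q)"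
proof (rule that)
  have "inj_on (\<lambda>(i, j). (j, i)) (supp P \<union> supp Q)" by (auto simp: inj_on_def)
  note supp = inj_on_Un_supp_mon_map[OF this]
  show "basis y x" by (rule basis_swap) fact
  show "ev y x (mon_map (\<lambda>(i, j). (j, i)) P) = t1 * ev y x (mon_map (\<lambda>(i, j). (j, i)) Q)"
    using assms(2) by (simp flip: ev_swap)
  show "mon_map (\<lambda>(i, j). (j, i)) Q \<noteq> 0" by (rule supp(2)[OF assms(3)])
  show "supp (mon_map (\<lambda>(i, j). (j, i)) P) \<union> supp (mon_map (\<lambda>(i, j). (j, i)) Q) = (\<lambda>(i, j). (j, i)) ` (supp P \<union> supp Q)"
    by (rule supp(1))
qed

end

context minimal_pres
begin

lemma optD:
  assumes "opt x y P Q n e"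
  shows "basis x y" "ev x y P = t1 * ev x y Q" "Q \<noteq> 0" "ev x y Q \<noteq> 0" "jac x y \<noteq> 0"
    "\<And>i j. (i, j) \<in> supp P \<union> supp Q \<Longrightarrow> j \<le> d \<and> int i \<le> e - n * int j"
    "2 * e - n * int d = \<mu>" "x \<noteq> 0" "y \<noteq> 0"
  using assms basis_nonzero[of x y] jac_basis_nonzero[of x y] ev_basis_eq_0_iff[of x y Q]
  by (auto simp: opt_def pres_def)

text \<open>An elementary transformation at a point of multiplicity \<open>m\<close> replaces
  \<open>(n, e)\<close> by \<open>(n - 1, e - m)\<close> and changes \<open>2 e - n d\<close> by
  \<open>d - 2 m\<close>, which must not be negative. For \<open>n < 0\<close> the exponent region
  is not closed under lowering \<open>j\<close>, so the point has to lie on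
  \<open>y = 0\<close>.\<close>

lemma mult_le_half:
  assumes "opt x y P Q n e" and nb: "0 \<le> n \<or> b = 0"
  shows "\<exists>(i, j)\<in>supp (shift_xy a b P) \<union> supp (shift_xy a b Q). 2 * (i + j) \<le> d"
proof (rule ccontr)
  assume *: "\<not> ?thesis"
  define T where "T = supp (shift_xy a b P) \<union> supp (shift_xy a b Q)"
  note o = optD[OF assms(1)]
  obtain i0 j0 m where ij0: "(i0, j0) \<in> T" "i0 + j0 = m" and "\<forall>i j. (i, j) \<in> T \<longrightarrow> m \<le> i + j"
    by (rule ex_min_monomial[OF shift_xy_Un_nonempty[OF o(3)], of a b P, folded T_def])
  then have m: "m \<le> i + j" if "(i, j) \<in> T" for i j using that by blast
  have dm: "d < 2 * m" using * ij0 unfolding T_def by force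
  obtain x1 y1 P1 Q1 where 1: "basis x1 y1" "ev x1 y1 P1 = t1 * ev x1 y1 Q1" "Q1 \<noteq> 0"
    and s1: "supp P1 \<union> supp Q1 = (\<lambda>(i, j). (i + j - m, j)) ` T"
    by (rule project_from_point[OF o(1-3), of a b m, folded T_def], erule m)
  have "pres x1 y1 P1 Q1 d (n - 1) (e - int m)"
    unfolding pres_def s1
  proof (intro conjI 1 ballI)
    fix q assume "q \<in> (\<lambda>(i, j). (i + j - m, j)) ` T"
    then obtain i j where q: "q = (i + j - m, j)" and ij: "(i, j) \<in> T" by auto
    from supp_shift_xy_Un[OF ij[unfolded T_def]] obtain i' j'
      where ij': "i \<le> i'" "j \<le> j'" "b = 0 \<longrightarrow> j' = j" "(i', j') \<in> supp P \<union> supp Q" by blast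
    have "n * int j \<le> n * int j'" using nb ij'(2,3) by (auto intro: mult_left_mono)
    then show "case q of (i, j) \<Rightarrow> j \<le> d \<and> int i \<le> e - int m - (n - 1) * int j"
      using o(6)[OF ij'(4)] ij' m[OF ij] by (auto simp: q of_nat_diff algebra_simps)
  qed
  from min_mu[OF this] o(7) dm show False by (simp add: algebra_simps)
qed

text \<open>Noether-Fano inequality: otherwise \<open>(dx \<and> dy)\<^sup>d / Q\<^sup>2\<close> would be a regular \<open>d\<close>-fold form on
  the generic fibre of \<open>t\<^sub>1\<close>, a projective line.\<close>

lemma opt_bound_integral:
  assumes "opt x y P Q n e" "place \<nu> \<epsilon>" "x = 0 \<or> 0 \<le> \<nu> x" "y = 0 \<or> 0 \<le> \<nu> y" "0 \<le> n \<or> 0 < \<nu> y"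
  shows "2 * \<nu> (ev x y Q) \<le> int d * (\<nu> (jac x y) - \<epsilon>)"
proof -
  interpret place \<nu> \<epsilon> by fact
  interpret place_alg_closed \<nu> \<epsilon> ..
  note o = optD[OF assms(1)]
  have int: "integral x" "integral y" using assms by (auto simp: integral_def)
  have "int 2 * \<nu> (ev x y Q) \<le> int d * (\<nu> (jac x y) - \<epsilon>)"
  proof (rule bound[OF int o(5,2,4) opt_coprime[OF assms(1)]])
    fix a b assume "pos (x - ratfun2_const a)" and yb: "pos (y - ratfun2_const b)"
    have "0 \<le> n \<or> b = 0"
    proof (rule ccontr)
      assume "\<not> ?thesis"
      then have "b \<noteq> 0" "pos y" using assms(5) by (auto simp: pos_def)
      have "pos (y - (y - ratfun2_const b))" by (rule pos_diff[OF \<open>pos y\<close> yb])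
      then show False using not_pos_const[OF \<open>b \<noteq> 0\<close>] by simp
    qed
    then show "\<exists>(i, j)\<in>supp (shift_xy a b P) \<union> supp (shift_xy a b Q). 2 * (i + j) \<le> d"
      by (rule mult_le_half[OF assms(1)])
  qed
  then show ?thesis by simp
qed

text \<open>Inverting \<open>y\<close> divides \<open>Q\<close> by \<open>y^d\<close> and the
  Jacobian by \<open>y^2\<close> up to sign, so the two sides of the bound change by the same
  amount.\<close>

lemma opt_bound_integral_x:
  assumes "opt x y P Q n e" "place \<nu> \<epsilon>" "0 \<le> \<nu> x" "0 \<le> n"
  shows "2 * \<nu> (ev x y Q) \<le> int d * (\<nu> (jac x y) - \<epsilon>)"
proof (cases "0 \<le> \<nu> y")
  case True
  then show ?thesis using assms by (intro opt_bound_integral[OF assms(1,2)]) auto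
next
  case False
  interpret place \<nu> \<epsilon> by fact
  note o = optD[OF assms(1)]
  define Q' where "Q' = mon_map (\<lambda>(i, j). (i, d - j)) Q"
  note o' = opt_inverse_y[OF assms(1), folded Q'_def]
  have "2 * \<nu> (ev x (inverse y) Q') \<le> int d * (\<nu> (jac x (inverse y)) - \<epsilon>)"
    using False assms(3) o(9) by (intro opt_bound_integral[OF o'(1) assms(2)]) (auto simp: val_inverse)
  moreover have "ev x (inverse y) Q' \<noteq> 0" using o'(2) o(4) by auto
  then have "\<nu> (ev x y Q) = int d * \<nu> y + \<nu> (ev x (inverse y) Q')"
    unfolding o'(2) using o(9) by (simp add: mult val_power)
  moreover have "\<nu> (jac x (inverse y)) = \<nu> (jac x y) - 2 * \<nu> y"
    using o(5,9) by (simp add: jac_inverse val_divide val_minus val_power)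
  ultimately show ?thesis by (simp add: algebra_simps)
qed

lemma jac_inverse_twist:
  assumes "x \<noteq> 0"
  shows "jac (inverse x) (y * x powi n) = - (x powi (n - 2)) * jac x y"
proof -
  have "jac (inverse x) (y * x powi n) = - (x powi n * jac x y / x ^ 2)"
    using assms by (simp add: jac_inverse jac_mult)
  moreover have "x powi n = x powi (n - 2) * x ^ 2"
    using assms power_int_add[of x "n - 2" 2] by simp
  ultimately show ?thesis using assms by simp
qed

text \<open>On the fibre \<open>x = \<infinity>\<close> the change of chart leaves the term
  \<open>(\<mu> - 2 d) * \<nu> x\<close>, which has the right sign since \<open>\<nu> x < 0\<close>
  there.\<close>

lemma opt_bound:
  assumes "opt x y P Q n e" "place \<nu> \<epsilon>" "0 \<le> n" "2 * int d \<le> \<mu>"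
  shows "2 * \<nu> (ev x y Q) \<le> int d * (\<nu> (jac x y) - \<epsilon>)"
proof (cases "0 \<le> \<nu> x")
  case True
  then show ?thesis using assms by (intro opt_bound_integral_x[OF assms(1,2)])
next
  case False
  interpret place \<nu> \<epsilon> by fact
  note o = optD[OF assms(1)]
  let ?x = "inverse x" and ?y = "y * x powi (- n)"
  define Q' where "Q' = mon_map (\<lambda>(i, j). (nat (e - n * int j) - i, j)) Q"
  note o' = opt_inverse_x[OF assms(1), folded Q'_def]
  have "2 * \<nu> (ev ?x ?y Q') \<le> int d * (\<nu> (jac ?x ?y) - \<epsilon>)"
    using False o(8) assms(3) by (intro opt_bound_integral_x[OF o'(1) assms(2)]) (auto simp: val_inverse)
  moreover have "ev ?x ?y Q' \<noteq> 0" using o'(2) o(4) by auto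
  then have "\<nu> (ev x y Q) = e * \<nu> x + \<nu> (ev ?x ?y Q')"
    unfolding o'(2) using o(8) by (simp add: mult val_power_int)
  moreover have "\<nu> (jac ?x ?y) = \<nu> (jac x y) - (n + 2) * \<nu> x"
    unfolding jac_inverse_twist[OF o(8)] using o(5,8) by (simp add: mult val_minus val_power_int algebra_simps)
  moreover have "(\<mu> - 2 * int d) * \<nu> x \<le> 0"
    using False assms(4) by (intro mult_nonneg_nonpos) auto
  moreover have "\<mu> * \<nu> x = 2 * (e * \<nu> x) - n * int d * \<nu> x"
    unfolding o(7)[symmetric] by (simp add: algebra_simps)
  ultimately show ?thesis by (simp add: algebra_simps)
qed

lemma exists_place_not_bound:
  assumes "opt x y P Q n e" "r > 0"
  shows "\<exists>\<nu> \<epsilon>. place \<nu> \<epsilon> \<and> int r * (\<nu> (jac x y) - \<epsilon>) < int s * \<nu> (ev x y Q)"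
proof -
  note o = optD[OF assms(1)]
  have "jac x y ^ r / ev x y Q ^ s \<noteq> 0" using o by simp
  from exists_place_less[OF this, of "int r"] assms(2) obtain \<nu> \<epsilon>
    where \<nu>: "place \<nu> \<epsilon>" "\<nu> (jac x y ^ r / ev x y Q ^ s) < int r * \<epsilon>" by auto
  interpret place \<nu> \<epsilon> by fact
  have "\<nu> (jac x y ^ r / ev x y Q ^ s) = int r * \<nu> (jac x y) - int s * \<nu> (ev x y Q)"
    using o by (simp add: val_divide val_power)
  with \<nu> show ?thesis by (intro exI conjI[OF \<nu>(1)]) (simp add: algebra_simps)
qed

lemma mu_less:
  assumes "opt x y P Q n e"
  shows "\<mu> < 2 * int d"
proof (rule ccontr)
  assume *: "\<not> ?thesis"
  \<comment> \<open>\<open>opt_inverse_y\<close> allows the sign of \<open>n\<close> to be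
    chosen.\<close>
  obtain x y P Q n e where o: "opt x y P Q n e" and "n \<ge> 0"
  proof (cases "n \<ge> 0")
    case True
    with assms that show ?thesis by blast
  next
    case False
    then show ?thesis using opt_inverse_y(1)[OF assms] that[of x "inverse y"] by simp
  qed
  then show False
    using opt_bound[OF o] exists_place_not_bound[OF o d_pos, of 2] * by fastforce
qed

text \<open>The same on the projective plane, with forms \<open>(dx \<and> dy)\<^sup>e / Q\<^sup>3\<close>.\<close>

lemma mult_le_third:
  assumes "opt x y P Q 1 e" "2 * e < 3 * int d"
  shows "\<exists>(i, j)\<in>supp (shift_xy a b P) \<union> supp (shift_xy a b Q). 3 * (i + j) \<le> nat e"
proof (rule ccontr)
  assume *: "\<not> ?thesis"
  define T where "T = supp (shift_xy a b P) \<union> supp (shift_xy a b Q)"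
  note o = optD[OF assms(1)]
  obtain i0 j0 m where ij0: "(i0, j0) \<in> T" "i0 + j0 = m" and "\<forall>i j. (i, j) \<in> T \<longrightarrow> m \<le> i + j"
    by (rule ex_min_monomial[OF shift_xy_Un_nonempty[OF o(3)], of a b P, folded T_def])
  then have m: "m \<le> i + j" if "(i, j) \<in> T" for i j using that by blast
  have em: "e < 3 * int m" using * ij0 unfolding T_def by force
  obtain x1 y1 P1 Q1 where 1: "basis x1 y1" "ev x1 y1 P1 = t1 * ev x1 y1 Q1" "Q1 \<noteq> 0"
    and s1: "supp P1 \<union> supp Q1 = (\<lambda>(i, j). (i + j - m, j)) ` T"
    by (rule project_from_point[OF o(1-3), of a b m, folded T_def], erule m)
  \<comment> \<open>The swap makes the lines through the point the ruling. Their degree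
    \<open>e - m\<close> is less than \<open>2 e / 3 < d\<close>, against the minimality of
    \<open>d\<close>.\<close>
  obtain P2 Q2 where 2: "basis y1 x1" "ev y1 x1 P2 = t1 * ev y1 x1 Q2" "Q2 \<noteq> 0"
    and s2: "supp P2 \<union> supp Q2 = (\<lambda>(i, j). (j, i)) ` (supp P1 \<union> supp Q1)"
    by (rule swap_pres[OF 1])
  have "j \<le> nat (e - int m)" if "(i, j) \<in> supp P2 \<union> supp Q2" for i j
  proof -
    from that obtain k where k: "(k, i) \<in> T" "j = k + i - m" unfolding s2 s1 by auto
    from supp_shift_xy_Un[OF k(1)[unfolded T_def]] obtain i' j'
      where ij': "k \<le> i'" "i \<le> j'" "(i', j') \<in> supp P \<union> supp Q" by blast
    show ?thesis using o(6)[OF ij'(3)] ij' k(2) m[OF k(1)] by auto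
  qed
  then have "d \<le> nat (e - int m)" by (rule min_degree[OF 2])
  then show False using em assms(2) d_pos by linarith
qed

lemma plane_bound_integral:
  assumes "opt x y P Q 1 e" "2 * e < 3 * int d" "place \<nu> \<epsilon>" "0 \<le> \<nu> x" "0 \<le> \<nu> y"
  shows "3 * \<nu> (ev x y Q) \<le> int (nat e) * (\<nu> (jac x y) - \<epsilon>)"
proof -
  interpret place \<nu> \<epsilon> by fact
  interpret place_alg_closed \<nu> \<epsilon> ..
  note o = optD[OF assms(1)]
  have int: "integral x" "integral y" using assms by (auto simp: integral_def)
  have "int 3 * \<nu> (ev x y Q) \<le> int (nat e) * (\<nu> (jac x y) - \<epsilon>)"
    by (rule bound[OF int o(5,2,4) opt_coprime[OF assms(1)]]) (rule mult_le_third[OF assms(1,2)])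
  then show ?thesis by simp
qed

lemma plane_bound:
  assumes "opt x y P Q 1 e" "2 * e < 3 * int d" "place \<nu> \<epsilon>"
  shows "3 * \<nu> (ev x y Q) \<le> int (nat e) * (\<nu> (jac x y) - \<epsilon>)"
proof -
  interpret place \<nu> \<epsilon> by fact
  interpret place_alg_closed \<nu> \<epsilon> ..
  note o = optD[OF assms(1)]
  obtain i0 where i0: "(i0, d) \<in> supp P \<union> supp Q"
    using top_monomial assms(1) unfolding opt_def by blast
  from o(6)[OF i0] have e0: "0 \<le> e" "int i0 + int d \<le> e" by auto
  \<comment> \<open>The three standard charts of the plane, according to which of \<open>1\<close>,
    \<open>x\<close>, \<open>y\<close> has the least value.\<close>
  consider "0 \<le> \<nu> x" "0 \<le> \<nu> y" | "\<nu> x < 0" "\<nu> x \<le> \<nu> y" | "\<nu> y < 0" "\<nu> y < \<nu> x" by linarith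
  then show ?thesis
  proof cases
    case 1
    then show ?thesis by (rule plane_bound_integral[OF assms])
  next
    case 2
    let ?x = "inverse x" and ?y = "y * x powi (- 1)"
    define Q' where "Q' = mon_map (\<lambda>(i, j). (nat (e - 1 * int j) - i, j)) Q"
    note o' = opt_inverse_x[OF assms(1), folded Q'_def]
    have y: "?y = y / x" by (simp add: power_int_minus divide_inverse)
    have *: "3 * \<nu> (ev ?x ?y Q') \<le> int (nat e) * (\<nu> (jac ?x ?y) - \<epsilon>)"
      using 2 o(8,9) by (intro plane_bound_integral[OF o'(1) assms(2,3)]) (auto simp: val_inverse val_divide y simp del: power_int_minus1_right)
    have "ev ?x ?y Q' \<noteq> 0" using o'(2) o(4) by auto
    then have vQ: "\<nu> (ev x y Q) = e * \<nu> x + \<nu> (ev ?x ?y Q')"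
      unfolding o'(2) using o(8) by (simp add: mult val_power_int)
    have J: "\<nu> (jac ?x ?y) = \<nu> (jac x y) - 3 * \<nu> x"
      unfolding jac_inverse_twist[OF o(8)] using o(5,8) by (simp add: mult val_minus val_power_int)
    show ?thesis unfolding vQ using *[unfolded J] e0 by (simp add: algebra_simps)
  next
    case 3
    let ?x = "inverse y" and ?y = "x * inverse y"
    define \<sigma> where "\<sigma> = (\<lambda>(i, j). (nat e - i - j, i))"
    have le: "i + j \<le> nat e" if "(i, j) \<in> supp P \<union> supp Q" for i j
      using o(6)[OF that] by auto
    have ev: "ev x y F = y ^ nat e * ev ?x ?y (mon_map \<sigma> F)" if "supp F \<subseteq> supp P \<union> supp Q" for F
    proof (rule ev_mon_map)
      fix i j assume "(i, j) \<in> supp F"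
      then have *: "nat e = (nat e - i - j) + i + j" using le[of i j] that by auto
      have "y ^ nat e = y ^ (nat e - i - j) * y ^ i * y ^ j"
        by (subst *) (simp only: power_add)
      then show "y ^ nat e * (?x ^ fst (\<sigma> (i, j)) * ?y ^ snd (\<sigma> (i, j))) = x ^ i * y ^ j"
        using o(9) by (simp add: \<sigma>_def power_mult_distrib power_inverse field_simps)
    qed
    have evP: "ev x y P = y ^ nat e * ev ?x ?y (mon_map \<sigma> P)" by (rule ev) simp
    have evQ: "ev x y Q = y ^ nat e * ev ?x ?y (mon_map \<sigma> Q)" by (rule ev) simp
    have inj: "inj_on \<sigma> (supp P \<union> supp Q)"
    proof (rule inj_onI, clarify)
      fix a b i j assume "(a, b) \<in> supp P \<union> supp Q" "(i, j) \<in> supp P \<union> supp Q" "\<sigma> (a, b) = \<sigma> (i, j)"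
      with le[of a b] le[of i j] show "a = i \<and> b = j" by (auto simp: \<sigma>_def)
    qed
    have "\<sigma> (i0, d) \<in> supp (mon_map \<sigma> P) \<union> supp (mon_map \<sigma> Q)"
      unfolding inj_on_Un_supp_mon_map(1)[OF inj] using i0 by blast
    then have i1: "(nat e - i0 - d, i0) \<in> supp (mon_map \<sigma> P) \<union> supp (mon_map \<sigma> Q)" by (simp add: \<sigma>_def)
    have pos: "pos ?x" "pos ?y" using 3 o(8,9) by (auto simp: pos_def val_inverse mult)
    have J: "jac ?x ?y = jac x y / y ^ 3"
      using o(9) jac_antisym[of y x] by (simp add: jac_mult jac_inverse divide_inverse power2_eq_square power3_eq_cube)
    have Q': "ev ?x ?y (mon_map \<sigma> Q) \<noteq> 0" using evQ o(4) by auto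
    \<comment> \<open>The centre is the point whose blow-up is \<open>F_1\<close>. The monomial with
      \<open>y\<close>-exponent \<open>d\<close> bounds its multiplicity by \<open>e - d\<close>,
      and \<open>3 (e - d) \<le> e\<close> since \<open>2 e < 3 d\<close>.\<close>
    have "int 3 * \<nu> (ev ?x ?y (mon_map \<sigma> Q)) \<le> int (nat e) * (\<nu> (jac ?x ?y) - \<epsilon>)"
    proof (rule local_bound[OF pos _ _ Q' i1])
      show "jac ?x ?y \<noteq> 0" using J o(5,9) by simp
      show "ev ?x ?y (mon_map \<sigma> P) = t1 * ev ?x ?y (mon_map \<sigma> Q)" using o(2,9) by (simp add: evP evQ)
      have "i0 + d \<le> nat e" "2 * nat e < 3 * d" using e0 assms(2) by linarith+
      moreover from this have "nat e - i0 - d + i0 = nat e - d" by simp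
      ultimately show "3 * (nat e - i0 - d + i0) \<le> nat e" by (simp only:) arith
    qed
    moreover have "\<nu> (ev x y Q) = int (nat e) * \<nu> y + \<nu> (ev ?x ?y (mon_map \<sigma> Q))"
      unfolding evQ using o(9) Q' by (simp add: mult val_power)
    moreover have "\<nu> (jac ?x ?y) = \<nu> (jac x y) - 3 * \<nu> y"
      unfolding J using o(5,9) by (simp add: val_divide val_power)
    ultimately show ?thesis by (simp add: algebra_simps)
  qed
qed

text \<open>A monomial with \<open>j = d\<close> forces \<open>e \<ge> n d\<close>, hence
  \<open>\<mu> \<ge> n d\<close>, and \<open>\<mu> < 2 d\<close> leaves \<open>n = 0\<close> or
  \<open>n = 1\<close>. For \<open>n = 0\<close> the other ruling has degree at most
  \<open>e < d\<close>; for \<open>n = 1\<close> the plane takes over.\<close>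

lemma no_opt: "\<not> opt x y P Q n e"
proof
  assume opt: "opt x y P Q n e"
  obtain x y P Q n e where o1: "opt x y P Q n e" and n: "n \<ge> 0"
  proof (cases "n \<ge> 0")
    case True
    with opt that show ?thesis by blast
  next
    case False
    then show ?thesis using opt_inverse_y(1)[OF opt] that[of x "inverse y"] by simp
  qed
  note o = optD[OF o1]
  obtain i0 where i0: "(i0, d) \<in> supp P \<union> supp Q"
    using top_monomial o1 unfolding opt_def by blast
  from o(6)[OF i0] have e: "n * int d \<le> e" by auto
  with mu_less[OF o1] o(7) have "n * int d < 2 * int d" by linarith
  then have "n < 2" using d_pos by simp
  with n consider "n = 0" | "n = 1" by linarith
  then show False
  proof cases
    case 1
    obtain P2 Q2 where 2: "basis y x" "ev y x P2 = t1 * ev y x Q2" "Q2 \<noteq> 0"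
      and s2: "supp P2 \<union> supp Q2 = (\<lambda>(i, j). (j, i)) ` (supp P \<union> supp Q)"
      by (rule swap_pres[OF o(1-3)])
    have "j \<le> nat e" if "(i, j) \<in> supp P2 \<union> supp Q2" for i j
      using that o(6) 1 unfolding s2 by fastforce
    then have "d \<le> nat e" by (rule min_degree[OF 2])
    moreover have "e < int d" using mu_less[OF o1] o(7) 1 by simp
    ultimately show False using d_pos by linarith
  next
    case 2
    have e3: "2 * e < 3 * int d" using mu_less[OF o1] o(7) 2 by simp
    have "nat e > 0" using e 2 d_pos by simp
    then show False
      using exists_place_not_bound[OF o1, of "nat e" 3] plane_bound[OF o1[unfolded 2] e3] by fastforce
  qed
qed

end

section \<open>Termination of the descent\<close>

context move_closed
begin

text \<open>This makes the second minimum exist. A monomial with \<open>j = d\<close> gives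
  \<open>e \<ge> n d\<close>, one with \<open>j = 0\<close> gives \<open>e \<ge> 0\<close>; lacking
  the first, \<open>d\<close> is not attained, and lacking the second, division by \<open>y\<close>
  lowers it.\<close>

lemma pres_nonneg:
  assumes p: "pres x y P Q d n e" and d: "d > 0" and min: "\<And>x y P Q e. \<not> pres x y P Q (d - 1) 0 e"
  shows "0 \<le> 2 * e - n * int d"
proof -
  define T where "T = supp P \<union> supp Q"
  from p have b: "basis x y" and rel: "ev x y P = t1 * ev x y Q" and Q: "Q \<noteq> 0"
    and s: "\<And>i j. (i, j) \<in> T \<Longrightarrow> j \<le> d \<and> int i \<le> e - n * int j"
    by (auto simp: pres_def T_def)
  have "\<exists>i. (i, d) \<in> T"
  proof (rule ccontr)
    assume *: "\<not> ?thesis"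
    have "j \<le> d - 1" if ij: "(i, j) \<in> T" for i j
    proof -
      have "j \<noteq> d" using * ij by blast
      then show ?thesis using s[OF ij] by linarith
    qed
    then show False using presI_degree[OF b rel Q] min unfolding T_def by blast
  qed
  then obtain i where "(i, d) \<in> T" by blast
  from s[OF this] have top: "n * int d \<le> e" by auto
  have "\<exists>i. (i, 0) \<in> T"
  proof (rule ccontr)
    assume *: "\<not> ?thesis"
    have j0: "j > 0" if ij: "(i, j) \<in> T" for i j
      using * ij by (cases j) auto
    define \<sigma> :: "nat \<times> nat \<Rightarrow> nat \<times> nat" where "\<sigma> = (\<lambda>(i, j). (i, j - 1))"
    have inj: "inj_on \<sigma> T" by (rule inj_onI) (auto simp: \<sigma>_def dest!: j0)
    note supp = inj_on_Un_supp_mon_map[OF inj[unfolded T_def], folded T_def]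
    have ev: "ev x y F = y * ev x y (mon_map \<sigma> F)" if "supp F \<subseteq> T" for F
    proof (rule ev_mon_map)
      fix i j assume "(i, j) \<in> supp F"
      then have "j > 0" using j0 that by blast
      then show "y * (x ^ fst (\<sigma> (i, j)) * y ^ snd (\<sigma> (i, j))) = x ^ i * y ^ j"
        by (cases j) (simp_all add: \<sigma>_def)
    qed
    have evP: "ev x y P = y * ev x y (mon_map \<sigma> P)" by (rule ev) (simp add: T_def)
    have evQ: "ev x y Q = y * ev x y (mon_map \<sigma> Q)" by (rule ev) (simp add: T_def)
    have "ev x y (mon_map \<sigma> P) = t1 * ev x y (mon_map \<sigma> Q)"
      using rel basis_nonzero[OF b] by (simp add: evP evQ)
    moreover have "j \<le> d - 1" if "(i, j) \<in> supp (mon_map \<sigma> P) \<union> supp (mon_map \<sigma> Q)" for i j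
    proof -
      from that obtain k where "(i, k) \<in> T" "j = k - 1" unfolding supp(1) by (auto simp: \<sigma>_def)
      then show ?thesis using s[of i k] by (simp add: diff_le_mono)
    qed
    ultimately show False using presI_degree[OF b _ supp(2)[OF Q]] min by blast
  qed
  then obtain i' where "(i', 0) \<in> T" by blast
  from s[OF this] have "0 \<le> e" by simp
  with top show ?thesis by simp
qed

lemma ex_pres_degree_0:
  assumes "S \<noteq> {}"
  shows "\<exists>x y P Q n e. pres x y P Q 0 n e"
proof -
  define A where "A = (\<lambda>d. \<exists>x y P Q n e. pres x y P Q d n e)"
  have "\<exists>d. A d" using ex_pres[OF assms] unfolding A_def by blast
  then have "A (LEAST d. A d)" by (rule LeastI_ex)
  moreover define d where "d = (LEAST d. A d)"
  ultimately have d: "A d" by simp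
  have min: "d \<le> d'" if "pres x y P Q d' n e" for x y P Q d' n e
    unfolding d_def by (rule Least_le) (unfold A_def, use that in blast)
  show ?thesis
  proof (cases "d = 0")
    case True
    with d show ?thesis by (simp add: A_def)
  next
    case False
    \<comment> \<open>\<open>nonneg\<close> below shows that the truncation by \<open>nat\<close>
      loses nothing.\<close>
    define B where "B = (\<lambda>m. \<exists>x y P Q n e. pres x y P Q d n e \<and> nat (2 * e - n * int d) = m)"
    have "\<exists>m. B m" using d unfolding A_def B_def by blast
    then have "B (LEAST m. B m)" by (rule LeastI_ex)
    moreover define m where "m = (LEAST m. B m)"
    ultimately have m: "B m" by simp
    have nonneg: "0 \<le> 2 * e - n * int d" if p: "pres x y P Q d n e" for x y P Q n e
      using pres_nonneg[OF p] False min[of _ _ _ _ "d - 1"] by fastforce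
    interpret minimal_pres S d "int m"
    proof
      show "int m \<le> 2 * e - n * int d" if "pres x y P Q d n e" for x y P Q n e
      proof -
        have "m \<le> nat (2 * e - n * int d)"
          unfolding m_def by (rule Least_le) (unfold B_def, use that in blast)
        then show ?thesis using nonneg[OF that] by simp
      qed
    qed (use False min in auto)
    obtain x y P Q n e where p: "pres x y P Q d n e" and "nat (2 * e - n * int d) = m" using m by (auto simp: B_def)
    then have "opt x y P Q n e" unfolding opt_def using nonneg[OF p] by simp
    then show ?thesis using no_opt by blast
  qed
qed

end

section \<open>Algebraic quotients and the return to \<open>t1\<close>, \<open>t2\<close>\<close>

lemma field_poly_coprime_decompose:
  fixes A B :: "'a::field poly"
  assumes "B \<noteq> 0"
  shows "\<exists>D A' B'. A = D * A' \<and> B = D * B' \<and> (\<forall>R. irreducible R \<longrightarrow> \<not> (R dvd A' \<and> R dvd B'))"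
  using assms
proof (induction "degree B" arbitrary: A B rule: less_induct)
  case (less B A)
  show ?case
  proof (cases "\<exists>R. irreducible R \<and> R dvd A \<and> R dvd B")
    case False
    then show ?thesis by (intro exI[of _ 1] exI[of _ A] exI[of _ B]) auto
  next
    case True
    then obtain R A1 B1 where R: "irreducible R" "A = R * A1" "B = R * B1" by (auto elim!: dvdE)
    have "R \<noteq> 0" "\<not> is_unit R" using R(1) by (auto simp: irreducible_def)
    then have "degree R > 0" by (simp add: is_unit_iff_degree)
    moreover have B1: "B1 \<noteq> 0" using R less.prems by auto
    ultimately have "degree B1 < degree B" using \<open>R \<noteq> 0\<close> R by (simp add: degree_mult_eq)
    from less.hyps[OF this B1, of A1] obtain D A' B' where
      "A1 = D * A'" "B1 = D * B'" "\<forall>R. irreducible R \<longrightarrow> \<not> (R dvd A' \<and> R dvd B')" by blast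
    then show ?thesis using R by (intro exI[of _ "R * D"] exI[of _ A'] exI[of _ B']) (simp add: mult.assoc)
  qed
qed

lemma field_poly_coprime_dvd:
  fixes A B C :: "'a::field poly"
  assumes "\<And>R. irreducible R \<Longrightarrow> \<not> (R dvd A \<and> R dvd B)" "B dvd C * A ^ e" "B \<noteq> 0"
  shows "B dvd C"
  using assms
proof (induction "degree B" arbitrary: B C rule: less_induct)
  case less
  show ?case
  proof (cases "degree B = 0")
    case True
    then have "is_unit B" using less.prems by (simp add: is_unit_iff_degree)
    then show ?thesis by (rule unit_imp_dvd)
  next
    case False
    then obtain R B1 where R: "irreducible R" "B = R * B1" using irreducible_monic_factor[of B] by auto
    have R': "R \<noteq> 0" "\<not> is_unit R" using R(1) by (auto simp: irreducible_def)
    then have "degree R > 0" by (simp add: is_unit_iff_degree)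
    moreover have B1: "B1 \<noteq> 0" using R less.prems by auto
    ultimately have deg: "degree B1 < degree B" using R' R by (simp add: degree_mult_eq)
    have prime: "prime_elem R" using R(1) by (rule field_poly_irreducible_imp_prime)
    have "R dvd C * A ^ e" using less.prems(2) R(2) by (meson dvd_mult_left)
    moreover have "\<not> R dvd A" using less.prems(1)[OF R(1)] unfolding R(2) by simp
    ultimately have "R dvd C" using prime prime_elem_dvd_power[OF prime, of A e] by (auto simp: prime_elem_dvd_mult_iff)
    then obtain C1 where C1: "C = R * C1" by (elim dvdE)
    have dvd1: "B1 dvd C1 * A ^ e" using less.prems(2) R' unfolding R(2) C1 by (simp add: mult.assoc)
    have cop1: "\<not> (R' dvd A \<and> R' dvd B1)" if "irreducible R'" for R'
      using less.prems(1)[OF that] dvd_mult[of R' B1 R] unfolding R(2) by blast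
    have "B1 dvd C1" by (rule less.hyps[OF deg cop1 dvd1 B1])
    then show ?thesis by (simp add: R(2) C1)
  qed
qed

text \<open>All terms but the last contain \<open>B\<close>, so \<open>B\<close> divides
  \<open>c e * A ^ e\<close>, and \<open>A\<close> shares no prime with it: the rational root
  theorem in homogeneous form.\<close>

lemma homogeneous_dvd:
  fixes A B :: "'a::field poly"
  assumes "\<And>R. irreducible R \<Longrightarrow> \<not> (R dvd A \<and> R dvd B)"
    and "B \<noteq> 0" "(\<Sum>j\<le>e. c j * A ^ j * B ^ (e - j)) = 0"
  shows "B dvd c e"
proof -
  have "(\<Sum>j\<le>e. c j * A ^ j * B ^ (e - j)) = (\<Sum>j<e. c j * A ^ j * B ^ (e - j)) + c e * A ^ e"
    by (simp only: lessThan_Suc_atMost[symmetric] sum.lessThan_Suc) simp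
  then have "c e * A ^ e = - (\<Sum>j<e. c j * A ^ j * B ^ (e - j))" unfolding assms(3) by (simp add: eq_neg_iff_add_eq_0 add.commute)
  moreover have "B dvd (\<Sum>j<e. c j * A ^ j * B ^ (e - j))"
    by (rule dvd_sum) (auto intro!: dvd_mult dvd_power)
  ultimately have "B dvd c e * A ^ e" by simp
  from field_poly_coprime_dvd[OF assms(1) this assms(2)] show ?thesis .
qed

text \<open>A quotient of polynomials satisfying an algebraic equation with coefficients of degree at
  most \<open>D\<close> has numerator and denominator of degree at most \<open>D\<close>: in lowest terms they divide the
  extreme coefficients.\<close>

lemma algebraic_quotient_degree:
  fixes E :: "'a::field poly \<Rightarrow> 'l::field" and C :: "'a poly poly"
  assumes "inj_comm_ring_hom E"
    and y: "y = E A / E B" "B \<noteq> 0"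
    and C: "C \<noteq> 0" "poly (map_poly E C) y = 0" "\<And>j. degree (coeff C j) \<le> D"
  obtains A B where "degree A \<le> D" "degree B \<le> D" "B \<noteq> 0" "y = E A / E B"
proof (cases "y = 0")
  case True
  interpret E: inj_comm_ring_hom E by fact
  show ?thesis using that[of 0 1] True by simp
next
  case False
  interpret E: inj_comm_ring_hom E by fact
  \<comment> \<open>Since \<open>y \<noteq> 0\<close>, powers of the variable can be cancelled from
    \<open>C\<close>, making both extreme coefficients nonzero.\<close>
  have "\<exists>C. coeff C 0 \<noteq> 0 \<and> poly (map_poly E C) y = 0 \<and> (\<forall>j. degree (coeff C j) \<le> D)"
    using C
  proof (induction C)
    case (pCons c C)
    show ?case
    proof (cases "c = 0")
      case True
      with pCons.prems False have "C \<noteq> 0" "poly (map_poly E C) y = 0" by (auto simp: E.map_poly_pCons_hom)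
      moreover have "degree (coeff C j) \<le> D" for j using pCons.prems(3)[of "Suc j"] by simp
      ultimately show ?thesis by (rule pCons.IH)
    qed (use pCons.prems in \<open>intro exI[of _ "pCons c C"], auto\<close>)
  qed simp
  then obtain C where C0: "coeff C 0 \<noteq> 0" and Cy: "poly (map_poly E C) y = 0"
    and CD: "\<And>j. degree (coeff C j) \<le> D" by blast
  define e where "e = degree C"
  have Ce: "coeff C e \<noteq> 0" using C0 by (auto simp: e_def)
  obtain F A' B' where AB: "A = F * A'" "B = F * B'" and cop: "\<And>R. irreducible R \<Longrightarrow> \<not> (R dvd A' \<and> R dvd B')"
    using field_poly_coprime_decompose[OF y(2), of A] by blast
  have F0: "F \<noteq> 0" and B'0: "B' \<noteq> 0" using AB y by auto
  have y': "y = E A' / E B'" using y F0 by (simp add: AB E.hom_mult)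
  then have A'0: "A' \<noteq> 0" using False by auto
  have yB: "y * E B' = E A'" using y' B'0 by simp
  have "E (\<Sum>j\<le>e. coeff C j * A' ^ j * B' ^ (e - j)) = (\<Sum>j\<le>e. E (coeff C j) * y ^ j) * E B' ^ e"
    unfolding E.hom_sum sum_distrib_right
  proof (rule sum.cong)
    fix j assume "j \<in> {..e}"
    then have "E B' ^ e = E B' ^ j * E B' ^ (e - j)" by (simp flip: power_add)
    then show "E (coeff C j * A' ^ j * B' ^ (e - j)) = E (coeff C j) * y ^ j * E B' ^ e"
      by (simp add: E.hom_mult E.hom_power yB[symmetric] power_mult_distrib mult_ac)
  qed simp
  also have "(\<Sum>j\<le>e. E (coeff C j) * y ^ j) = poly (map_poly E C) y"
    by (simp add: poly_altdef e_def)
  finally have sum: "(\<Sum>j\<le>e. coeff C j * A' ^ j * B' ^ (e - j)) = 0" using Cy by simp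
  have "B' dvd coeff C e" by (rule homogeneous_dvd[OF cop B'0 sum])
  then have "degree B' \<le> D" using Ce CD[of e] by (metis dvd_imp_degree_le le_trans)
  \<comment> \<open>Reversing the coefficients exchanges the roles of \<open>A'\<close> and
    \<open>B'\<close>.\<close>
  have "(\<Sum>j\<le>e. coeff C (e - j) * B' ^ j * A' ^ (e - j)) = (\<Sum>j\<le>e. coeff C j * A' ^ j * B' ^ (e - j))"
    by (rule sum.reindex_bij_witness[of _ "\<lambda>j. e - j" "\<lambda>j. e - j"]) (auto simp: mult_ac)
  with sum have "(\<Sum>j\<le>e. coeff C (e - j) * B' ^ j * A' ^ (e - j)) = 0" by simp
  then have "A' dvd coeff C (e - e)"
    by (rule homogeneous_dvd[where c = "\<lambda>j. coeff C (e - j)" and e = e, OF _ A'0, rotated]) (use cop in blast)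
  then have "degree A' \<le> D" using C0 CD[of 0] by (metis diff_self_eq_0 dvd_imp_degree_le le_trans)
  from that[OF this \<open>degree B' \<le> D\<close> B'0 y'] show thesis .
qed

text \<open>The inclusion of \<open>K(t1)\<close>, a type of its own, into
  \<open>K(t1,t2)\<close>.\<close>

definition iota :: "'k::field poly fract \<Rightarrow> 'k ratfun2"
  where "iota f = ev1 t1 (num f) / ev1 t1 (den f)"

lemma ev1_t1: "ev1 t1 p = to_fract [:p:]"
  using ev_t1_t2[of "[:p:]"] by simp

lemma ev1_t1_eq_0_iff [simp]: "ev1 t1 p = 0 \<longleftrightarrow> p = 0"
  by (simp add: ev1_t1)

lemma iota_eq: "b \<noteq> 0 \<Longrightarrow> iota (to_fract a / to_fract b) = ev1 t1 a / ev1 t1 b"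
proof -
  assume b: "b \<noteq> 0"
  have "num (to_fract a / to_fract b) * b = a * den (to_fract a / to_fract b)"
    by (rule num_den_cross[OF b refl])
  then have "ev1 t1 (num (to_fract a / to_fract b)) * ev1 t1 b = ev1 t1 a * ev1 t1 (den (to_fract a / to_fract b))"
    by (metis ev1.hom_mult)
  then show ?thesis using b by (simp add: iota_def frac_eq_eq)
qed

lemma iota_to_fract: "iota (to_fract a) = ev1 t1 a"
  using iota_eq[of 1 a] by simp

lemma field_hom_iota: "field_hom iota"
proof
  show "iota 0 = 0" "iota 1 = 1" using iota_to_fract[of 0] iota_to_fract[of 1] by simp_all
  fix f g :: "'a poly fract"
  obtain a b where f: "f = to_fract a / to_fract b" "b \<noteq> 0" by (rule that[of "num f" "den f"]) (simp_all add: num_den_eq)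
  obtain c d where g: "g = to_fract c / to_fract d" "d \<noteq> 0" by (rule that[of "num g" "den g"]) (simp_all add: num_den_eq)
  have "f * g = to_fract (a * c) / to_fract (b * d)" by (simp add: f g)
  then have "iota (f * g) = ev1 t1 (a * c) / ev1 t1 (b * d)" by (simp only:) (rule iota_eq, use f(2) g(2) in simp)
  then show "iota (f * g) = iota f * iota g" using f(2) g(2) unfolding f(1) g(1) by (simp add: iota_eq ev1.hom_mult)
  have "f + g = to_fract (a * d + c * b) / to_fract (b * d)" using f(2) g(2) unfolding f(1) g(1) by (simp add: field_simps)
  then have "iota (f + g) = ev1 t1 (a * d + c * b) / ev1 t1 (b * d)" by (simp only:) (rule iota_eq, use f(2) g(2) in simp)
  then show "iota (f + g) = iota f + iota g"
    using f(2) g(2) unfolding f(1) g(1) by (simp add: iota_eq ev1.hom_mult ev1.hom_add add_frac_eq)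
qed

interpretation iota: field_hom iota by (rule field_hom_iota)
interpretation map_iota: map_poly_comm_ring_hom iota ..

text \<open>\<open>K(t1)[t2]\<close> as a subring of \<open>K(t1,t2)\<close>, so that degrees in
  \<open>t2\<close> are taken over a field.\<close>

definition evk :: "'k::field poly fract poly \<Rightarrow> 'k ratfun2"
  where "evk A = poly (map_poly iota A) t2"

lemma evk_pCons [simp]: "evk (pCons f A) = iota f + t2 * evk A"
  by (simp add: evk_def hom_distribs)

lemma evk_fract_poly: "evk (fract_poly P) = ev t1 t2 P"
  by (induction P) (simp_all add: map_poly_pCons iota_to_fract evk_def)

lemma inj_comm_ring_hom_evk: "inj_comm_ring_hom evk"
proof
  show "evk 0 = 0" "evk 1 = 1" by (simp_all add: evk_def)
  show "evk (A + B) = evk A + evk B" "evk (A * B) = evk A * evk B" for A B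
    by (simp_all add: evk_def hom_distribs)
  fix A :: "'a poly fract poly" assume A: "evk A = 0"
  obtain c Q where c: "c \<noteq> 0" "fract_poly Q = Polynomial.smult (to_fract c) A" by (rule clear_denominators)
  have "evk (fract_poly Q) = iota (to_fract c) * evk A" by (simp add: c evk_def hom_distribs)
  then have "Q = 0" by (simp add: A evk_fract_poly)
  then show "A = 0" using c by simp
qed

lemma inj_comm_ring_hom_ev1_t1: "inj_comm_ring_hom (ev1 t1)"
  by unfold_locales simp

lemma evk_cases:
  obtains A B where "B \<noteq> 0" "f = evk A / evk B"
proof -
  obtain A B where "B \<noteq> 0" "f = ev t1 t2 A / ev t1 t2 B" by (rule ratfun2_cases)
  then show thesis using that[of "fract_poly B" "fract_poly A"] by (simp add: evk_fract_poly)
qed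

text \<open>Solving \<open>w = (a\<^sub>1 z + a\<^sub>0) / (b\<^sub>1 z + b\<^sub>0)\<close> for \<open>z\<close> takes only translations, scalings and
  inversions over the subfield \<open>G\<close>.\<close>

lemma mobius_closed:
  fixes G :: "'l::field set" and R :: "'l \<Rightarrow> bool"
  assumes add: "\<And>a b. a \<in> G \<Longrightarrow> b \<in> G \<Longrightarrow> a + b \<in> G"
    and G: "\<And>a b. a \<in> G \<Longrightarrow> b \<in> G \<Longrightarrow> a * b \<in> G" "\<And>a. a \<in> G \<Longrightarrow> - a \<in> G" "\<And>a. a \<in> G \<Longrightarrow> inverse a \<in> G"
    and R: "\<And>w f. R w \<Longrightarrow> f \<in> G \<Longrightarrow> R (w + f)" "\<And>w f. R w \<Longrightarrow> f \<in> G \<Longrightarrow> f \<noteq> 0 \<Longrightarrow> R (w * f)"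
      "\<And>w. R w \<Longrightarrow> R (inverse w)" "\<not> R 0"
    and w: "R w" "w = (a1 * z + a0) / (b1 * z + b0)" "a0 \<in> G" "a1 \<in> G" "b0 \<in> G" "b1 \<in> G"
  shows "R z"
proof -
  have div: "a / b \<in> G" if "a \<in> G" "b \<in> G" for a b using that G by (simp add: divide_inverse)
  \<comment> \<open>A zero denominator would give \<open>w = 0\<close> by the convention for
    division, which \<open>R\<close> excludes.\<close>
  have nz: "b1 * z + b0 \<noteq> 0" using w R(4) by auto
  show ?thesis
  proof (cases "b1 = 0")
    case True
    have "R (w + - (a0 / b0))" by (intro R(1) w G(2) div)
    also have "w + - (a0 / b0) = z * (a1 / b0)" using nz True by (simp add: w(2) field_simps)
    finally have 1: "R (z * (a1 / b0))" .
    then have "a1 / b0 \<noteq> 0" using R(4) by auto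
    then have "R (z * (a1 / b0) * inverse (a1 / b0))" by (intro R(2)[OF 1] G(3) div w) simp
    then show ?thesis using \<open>a1 / b0 \<noteq> 0\<close> by simp
  next
    case False
    have "R (w + - (a1 / b1))" by (intro R(1) w G(2) div)
    also have eq: "w + - (a1 / b1) = (a0 * b1 - a1 * b0) / b1 / (b1 * z + b0)"
      using nz False by (simp add: w(2) field_simps)
    finally have 1: "R ((a0 * b1 - a1 * b0) / b1 / (b1 * z + b0))" .
    define c where "c = (a0 * b1 - a1 * b0) / b1"
    \<comment> \<open>\<open>c\<close> is, up to sign, the determinant divided by \<open>b1\<close>;
      were it zero, \<open>R 0\<close> would follow.\<close>
    have c0: "c \<noteq> 0" using 1 R(4) by (auto simp: c_def)
    have "inverse (c / (b1 * z + b0)) = (b1 * z + b0) / c" by simp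
    then have "R ((b1 * z + b0) / c)" using R(3)[OF 1] unfolding c_def by metis
    moreover have "(b1 * z + b0) / c = (z + b0 / b1) * (b1 / c)"
    proof -
      have "b0 / b1 * b1 = b0" using False by simp
      then have "(z + b0 / b1) * b1 = b1 * z + b0" by (simp only: distrib_right mult.commute[of z])
      then show ?thesis by (metis times_divide_eq_right)
    qed
    ultimately have 2: "R ((z + b0 / b1) * (b1 / c))" by (simp only:)
    have "a0 * b1 + - (a1 * b0) \<in> G" by (intro add G w)
    then have "c \<in> G" unfolding c_def using div[OF _ w(6)] by simp
    then have "inverse (b1 / c) \<in> G" by (intro G(3) div w(6))
    then have "R ((z + b0 / b1) * (b1 / c) * inverse (b1 / c))"
      by (rule R(2)[OF 2]) (use False c0 in simp)
    then have "R (z + b0 / b1)" using False c0 by simp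
    then have "R (z + b0 / b1 + - (b0 / b1))" by (rule R(1)) (intro G(2) div w)
    then show ?thesis by simp
  qed
qed

text \<open>Rewrites a relation \<open>p(x) = u * q(x)\<close> as one polynomial equation for
  \<open>x\<close> whose coefficients are linear in a preimage of \<open>u\<close>, the shape needed
  for \<open>algebraic_quotient_degree\<close>.\<close>

lemma poly_map_poly_relation:
  assumes E: "comm_ring_hom E" and g: "\<And>a. E (g a) = h a" "\<And>a. E (g' a) = u * h a" "g 0 = 0" "g' 0 = 0" "h 0 = (0::'l::comm_ring_1)"
  shows "poly (map_poly E (map_poly g p - map_poly g' q)) x = poly (map_poly h p) x - u * poly (map_poly h q) x"
proof -
  interpret E: comm_ring_hom E by fact
  interpret mE: map_poly_comm_ring_hom E ..
  have "map_poly E (map_poly g p) = map_poly h p"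
    by (rule poly_eqI) (simp add: coeff_map_poly g)
  moreover have "map_poly E (map_poly g' q) = Polynomial.smult u (map_poly h q)"
    by (rule poly_eqI) (simp add: coeff_map_poly g)
  ultimately show ?thesis by (simp add: mE.hom_minus)
qed

context move_closed
begin

text \<open>Inversions and translations by \<open>k\<close> and \<open>- 1 / k\<close> compose to
  \<open>y \<mapsto> - k^2 / y\<close>; one more inversion gives multiplication by
  \<open>- 1 / k^2\<close>, which is \<open>c\<close> for \<open>a^2 = - 1 / c\<close>.\<close>

lemma basis_scale:
  assumes "basis x y" "c \<noteq> 0"
  shows "basis x (y * ratfun2_const c)"
proof -
  obtain a where a: "a ^ 2 = - inverse c" using nth_root_exists[of 2 "- inverse c"] by auto
  define k where "k = ratfun2_const a"
  have k2: "k ^ 2 * ratfun2_const c = - 1"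
    using assms(2) by (simp add: k_def a const.hom_uminus flip: const.hom_power const.hom_mult)
  then have k0: "k \<noteq> 0" by auto
  have b1: "basis x (y + k)" unfolding k_def by (rule basis_add[OF assms(1)])
  have "basis x (inverse (y + k) + ratfun2_const (- inverse a))" by (rule basis_add[OF basis_inverse[OF b1]])
  also have "inverse (y + k) + ratfun2_const (- inverse a) = - y / (k * (y + k))"
    using basis_nonzero[OF b1] k0 by (simp add: const.hom_uminus const.hom_inverse flip: k_def) (simp add: field_simps)
  finally have "basis x (inverse (- y / (k * (y + k))) + k)" unfolding k_def by (intro basis_add basis_inverse)
  also have "inverse (- y / (k * (y + k))) + k = - (k ^ 2 / y)"
    using basis_nonzero[OF assms(1)] by (simp add: field_simps power2_eq_square)
  finally have "basis x (inverse (- (k ^ 2 / y)))" by (rule basis_inverse)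
  also have "inverse (- (k ^ 2 / y)) = y * ratfun2_const c"
    using k2 k0 basis_nonzero[OF assms(1)] by (simp add: field_simps)
  finally show ?thesis .
qed

lemma basis_mult_linear:
  assumes "basis x y"
  shows "basis x (y * (x - ratfun2_const a))"
proof -
  have "basis (x - ratfun2_const a) (y * (x - ratfun2_const a))"
    using basis_mult[OF basis_diff[OF assms, of a 0]] by simp
  from basis_diff[OF this, of "- a" 0] show ?thesis by (simp add: const.hom_uminus)
qed

lemma basis_mult_ev1:
  assumes "basis x y" "p \<noteq> 0"
  shows "basis x (y * ev1 x p)"
proof -
  from alg_closed_imp_factorization[OF \<open>p \<noteq> 0\<close>]
  obtain A where A: "p = Polynomial.smult (lead_coeff p) (\<Prod>x\<in>#A. [:- x, 1:])" by blast
  have *: "basis x (y * ev1 x (\<Prod>x\<in>#A. [:- x, 1:]))"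
  proof (induction A)
    case empty
    then show ?case using assms by simp
  next
    case (add a A)
    from basis_mult_linear[OF add, of a] show ?case
      by (simp add: ev1.hom_mult const.hom_uminus mult_ac del: mult_pCons_left)
  qed
  have eq: "y * ev1 x p = y * ev1 x (\<Prod>x\<in>#A. [:- x, 1:]) * ratfun2_const (lead_coeff p)"
    by (subst A) (simp add: ev1_def hom_distribs)
  show ?thesis by (subst eq) (rule basis_scale[OF *], use assms in simp)
qed

lemma basis_divide_ev1:
  assumes "basis x y" "p \<noteq> 0"
  shows "basis x (y / ev1 x p)"
  using basis_inverse[OF basis_mult_ev1[OF basis_inverse[OF assms(1)] assms(2)]] by (simp add: divide_inverse)

lemma basis_mult_iota:
  assumes "basis t1 y" "f \<noteq> 0"
  shows "basis t1 (y * iota f)"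
  using basis_divide_ev1[OF basis_mult_ev1[OF assms(1), of "num f"], of "den f"] assms(2)
  by (simp add: iota_def)

text \<open>Translation by \<open>f\<close> is translation by 1 conjugated by multiplication by
  \<open>f\<close>.\<close>

lemma basis_add_iota:
  assumes "basis t1 y"
  shows "basis t1 (y + iota f)"
proof (cases "f = 0")
  case False
  have "basis t1 ((y * iota (inverse f) + ratfun2_const 1) * iota f)"
    using False assms by (intro basis_mult_iota basis_add) auto
  also have "(y * iota (inverse f) + ratfun2_const 1) * iota f = y + iota f"
    using False by (simp add: iota.hom_inverse distrib_right mult.assoc)
  finally show ?thesis .
qed (use assms in simp)

lemma basis_quotient:
  assumes "basis x y"
  obtains A B where "B \<noteq> 0" "ev x y A = f * ev x y B"
proof -
  from assms obtain \<phi> where \<phi>: "\<phi> \<in> S" "ratfun2_hom \<phi>" "\<phi> t1 = x" "\<phi> t2 = y" by (rule basisE)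
  then have "bij \<phi>" using subset_Cr2 by (auto simp: carrier_Cr2)
  interpret ratfun2_hom \<phi> by fact
  obtain g where g: "\<phi> g = f" using \<open>bij \<phi>\<close> by (metis bij_pointE)
  obtain A B where AB: "B \<noteq> 0" "g = ev t1 t2 A / ev t1 t2 B" by (rule ratfun2_cases)
  have "f = ev x y A / ev x y B"
    unfolding g[symmetric] by (simp add: AB hom_div hom_ev \<phi>)
  then have "ev x y A = f * ev x y B"
    using ev_basis_eq_0_iff[OF assms, of B] AB(1) by simp
  with AB(1) show thesis by (rule that)
qed

text \<open>With \<open>d = 0\<close>, \<open>t1 = p(x) / q(x)\<close>, so \<open>x\<close> is a
  root of \<open>p - t1 q\<close>. The coefficients are constant in \<open>t2\<close>, which puts
  \<open>x\<close> into \<open>K(t1)\<close>, and linear in \<open>t1\<close>, which makes it a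
  Moebius transform.\<close>

lemma basis_t1:
  assumes "S \<noteq> {}"
  obtains y where "basis t1 y"
proof -
  obtain x y P Q n e where "pres x y P Q 0 n e" using ex_pres_degree_0[OF assms] by blast
  then have b: "basis x y" and rel: "ev x y P = t1 * ev x y Q" and Q: "Q \<noteq> 0"
    and s: "\<And>i j. (i, j) \<in> supp P \<union> supp Q \<Longrightarrow> j = 0"
    by (auto simp: pres_def)
  define p q where "p = coeff P 0" "q = coeff Q 0"
  have const: "F = [:coeff F 0:]" if "supp F \<subseteq> supp P \<union> supp Q" for F
  proof (rule poly_eqI, rule poly_eqI)
    fix j i show "coeff (coeff F j) i = coeff (coeff [:coeff F 0:] j) i"
      using s[of i j] that by (cases j) (auto simp: supp_def)
  qed
  have P: "P = [:p:]" and Q': "Q = [:q:]" unfolding p_q_def by (rule const; simp)+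
  have q0: "q \<noteq> 0" using Q Q' by auto
  then obtain j where qj: "coeff q j \<noteq> 0" by (auto simp: poly_eq_iff)
  have rel: "ev1 x p - t1 * ev1 x q = 0" using rel by (simp add: P Q')
  interpret evk: inj_comm_ring_hom evk by (rule inj_comm_ring_hom_evk)
  obtain A B where "degree A \<le> 0" "degree B \<le> 0" "B \<noteq> 0" and x: "x = evk A / evk B"
  proof -
    obtain A B where AB: "B \<noteq> 0" "x = evk A / evk B" by (rule evk_cases)
    define C where "C = map_poly (\<lambda>a. [:to_fract [:a:]:]) p - map_poly (\<lambda>a. [:to_fract [:0, a:]:]) q"
    have C: "coeff C i = [:to_fract [:coeff p i, - coeff q i:]:]" for i
      by (simp add: C_def coeff_map_poly flip: to_fract_diff)
    show thesis
    proof (rule algebraic_quotient_degree[OF inj_comm_ring_hom_evk AB(2,1)])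
      show "C \<noteq> 0" using C[of j] qj by auto
      show "degree (coeff C i) \<le> 0" for i by (simp add: C)
      show "poly (map_poly evk C) x = 0"
        unfolding C_def using rel unfolding ev1_def
        by (subst poly_map_poly_relation[where h = ratfun2_const and u = t1])
          (simp_all add: evk.comm_ring_hom_axioms iota_to_fract)
    qed (rule that)
  qed
  then obtain f g where "A = [:f:]" "B = [:g:]" by (auto elim!: degree_eq_zeroE)
  then have "x = iota (f / g)" by (simp add: x iota.hom_div)
  then have x: "x = ev1 t1 (num (f / g)) / ev1 t1 (den (f / g))" by (simp only: iota_def)
  obtain A B where AB: "degree A \<le> 1" "degree B \<le> 1" "B \<noteq> 0" and x: "x = ev1 t1 A / ev1 t1 B"
  proof -
    define C where "C = map_poly (\<lambda>a. [:a:]) p - map_poly (\<lambda>a. [:0, a:]) q"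
    have C: "coeff C i = [:coeff p i, - coeff q i:]" for i
      by (simp add: C_def coeff_map_poly)
    show thesis
    proof (rule algebraic_quotient_degree[OF inj_comm_ring_hom_ev1_t1 x])
      show "C \<noteq> 0" using C[of j] qj by auto
      show "degree (coeff C i) \<le> 1" for i by (simp add: C)
      show "poly (map_poly (ev1 t1) C) x = 0"
        unfolding C_def using rel unfolding ev1_def[of x]
        by (subst poly_map_poly_relation[where h = ratfun2_const and u = t1])
          (simp_all add: ev1.comm_ring_hom_axioms)
    qed (use that in auto)
  qed
  have lin: "F = [:coeff F 0, coeff F 1:]" if "degree F \<le> 1" for F :: "'k poly"
    using that by (intro poly_eqI) (auto simp: coeff_pCons coeff_eq_0 split: nat.splits)
  have "x = (ratfun2_const (coeff A 1) * t1 + ratfun2_const (coeff A 0)) / (ratfun2_const (coeff B 1) * t1 + ratfun2_const (coeff B 0))"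
    unfolding x
    by (rule arg_cong2[where f = "(/)"]; subst lin[OF AB(1)] lin[OF AB(2)]) (simp_all add: algebra_simps)
  from this have "basis y t1"
  proof (rule mobius_closed[where G = "range ratfun2_const" and R = "basis y", rotated -5])
    show "basis y x" by (rule basis_swap[OF b])
    show "basis y (w + f)" if "basis y w" "f \<in> range ratfun2_const" for w f
      using that basis_add by auto
    show "basis y (w * f)" if "basis y w" "f \<in> range ratfun2_const" "f \<noteq> 0" for w f
      using that basis_scale by auto
    show "basis y (inverse w)" if "basis y w" for w
      by (rule basis_inverse[OF that])
    show "\<not> basis y 0" using basis_nonzero by blast
  qed (auto simp flip: const.hom_mult const.hom_add const.hom_uminus const.hom_inverse)
  then show thesis using that basis_swap by blast
qed

text \<open>Writing \<open>t2\<close> as a quotient of polynomials in \<open>t1\<close> and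
  \<open>y\<close> yields an equation for \<open>y\<close> over \<open>K(t1)[t2]\<close> with
  coefficients linear in \<open>t2\<close>.\<close>

lemma basis_t1_t2:
  assumes "S \<noteq> {}"
  shows "basis t1 t2"
proof -
  obtain y where b: "basis t1 y" using basis_t1[OF assms] .
  obtain P Q where Q: "Q \<noteq> 0" and rel: "ev t1 y P = t2 * ev t1 y Q" by (rule basis_quotient[OF b])
  obtain j where qj: "coeff Q j \<noteq> 0" using Q by (auto simp: poly_eq_iff)
  interpret evk: inj_comm_ring_hom evk by (rule inj_comm_ring_hom_evk)
  obtain A B where AB: "degree A \<le> 1" "degree B \<le> 1" "B \<noteq> 0" and y: "y = evk A / evk B"
  proof -
    obtain A B where AB: "B \<noteq> 0" "y = evk A / evk B" by (rule evk_cases)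
    define C where "C = map_poly (\<lambda>a. [:to_fract a:]) P - map_poly (\<lambda>a. [:0, to_fract a:]) Q"
    have C: "coeff C i = [:to_fract (coeff P i), - to_fract (coeff Q i):]" for i
      by (simp add: C_def coeff_map_poly)
    show thesis
    proof (rule algebraic_quotient_degree[OF inj_comm_ring_hom_evk AB(2,1)])
      show "C \<noteq> 0" using C[of j] qj by auto
      show "degree (coeff C i) \<le> 1" for i by (simp add: C)
      show "poly (map_poly evk C) y = 0"
        unfolding C_def using rel unfolding ev_def
        by (subst poly_map_poly_relation[where h = "ev1 t1" and u = t2])
          (simp_all add: evk.comm_ring_hom_axioms iota_to_fract)
    qed (use that in auto)
  qed
  have lin: "F = [:coeff F 0, coeff F 1:]" if "degree F \<le> 1" for F :: "'k poly fract poly"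
    using that by (intro poly_eqI) (auto simp: coeff_pCons coeff_eq_0 split: nat.splits)
  have "y = (iota (coeff A 1) * t2 + iota (coeff A 0)) / (iota (coeff B 1) * t2 + iota (coeff B 0))"
    unfolding y
    by (rule arg_cong2[where f = "(/)"]; subst lin[OF AB(1)] lin[OF AB(2)]) (simp_all add: algebra_simps)
  from this show "basis t1 t2"
  proof (rule mobius_closed[where G = "range iota" and R = "basis t1", rotated -5])
    show "basis t1 y" by (rule b)
    show "basis t1 (w + f)" if "basis t1 w" "f \<in> range iota" for w f
      using that basis_add_iota by auto
    show "basis t1 (w * f)" if "basis t1 w" "f \<in> range iota" "f \<noteq> 0" for w f
      using that basis_mult_iota by auto
    show "basis t1 (inverse w)" if "basis t1 w" for w
      by (rule basis_inverse[OF that])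
    show "\<not> basis t1 0" using basis_nonzero by blast
  qed (auto simp flip: iota.hom_mult iota.hom_add iota.hom_uminus iota.hom_inverse)
qed

theorem noether_castelnuovo: "S \<noteq> {} \<Longrightarrow> id \<in> S"
proof -
  assume "S \<noteq> {}"
  then obtain \<phi> where \<phi>: "\<phi> \<in> S" "ratfun2_hom \<phi>" "\<phi> t1 = t1" "\<phi> t2 = t2"
    using basisE[OF basis_t1_t2] by metis
  then have "\<phi> = id" by (intro ratfun2_hom_ext ratfun2_hom_id) simp_all
  with \<phi>(1) show ?thesis by simp
qed

end

section \<open>Relations between matrices\<close>

text \<open>Horner evaluation of \<open>p\<close> at the matrix \<open>C\<close>; relations
  satisfied by \<open>C\<close> become divisibilities of polynomials, see
  \<open>mpoly_ideal\<close>.\<close>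

definition mpoly :: "nat \<Rightarrow> 'f::field mat \<Rightarrow> 'f poly \<Rightarrow> 'f mat"
  where "mpoly n C p = fold_coeffs (\<lambda>a M. a \<cdot>\<^sub>m 1\<^sub>m n + M * C) p (0\<^sub>m n n)"

context
  fixes n :: nat and C :: "'f::field mat"
  assumes C: "C \<in> carrier_mat n n"
begin

lemma mpoly_0 [simp]: "mpoly n C 0 = 0\<^sub>m n n"
  by (simp add: mpoly_def)

lemma mpoly_pCons: "mpoly n C (pCons a p) = a \<cdot>\<^sub>m 1\<^sub>m n + mpoly n C p * C"
proof (cases "a = 0 \<and> p = 0")
  case True
  have "0 \<cdot>\<^sub>m 1\<^sub>m n + 0\<^sub>m n n * C = 0\<^sub>m n n" using C by (intro eq_matI) auto
  with True show ?thesis by simp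
qed (auto simp: mpoly_def)

lemma mpoly_carrier [simp]: "mpoly n C p \<in> carrier_mat n n"
  by (induction p) (use C in \<open>auto simp: mpoly_pCons\<close>)

lemma mpoly_dim [simp]: "dim_row (mpoly n C p) = n" "dim_col (mpoly n C p) = n"
  using carrier_matD[OF mpoly_carrier[of p]] by simp_all

lemma mpoly_times_carrier [simp]: "mpoly n C p * C \<in> carrier_mat n n"
  by (rule mult_carrier_mat[OF mpoly_carrier C])

lemma mpoly_add: "mpoly n C (p + q) = mpoly n C p + mpoly n C q"
proof (induction p q rule: poly_induct2)
  case (pCons a p b q)
  have "mpoly n C (pCons a p + pCons b q) = (a + b) \<cdot>\<^sub>m 1\<^sub>m n + (mpoly n C p + mpoly n C q) * C"
    by (simp add: mpoly_pCons pCons)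
  also have "(mpoly n C p + mpoly n C q) * C = mpoly n C p * C + mpoly n C q * C"
    by (rule add_mult_distrib_mat[OF mpoly_carrier mpoly_carrier C])
  also have "(a + b) \<cdot>\<^sub>m 1\<^sub>m n + \<dots> = mpoly n C (pCons a p) + mpoly n C (pCons b q)"
    unfolding mpoly_pCons using C by (intro eq_matI) (auto simp: algebra_simps)
  finally show ?case .
qed simp

lemma mpoly_smult: "mpoly n C (Polynomial.smult c p) = c \<cdot>\<^sub>m mpoly n C p"
proof (induction p)
  case 0
  show ?case by (intro eq_matI) auto
next
  case (pCons a p)
  have "(c \<cdot>\<^sub>m mpoly n C p) * C = c \<cdot>\<^sub>m (mpoly n C p * C)"
    by (rule mult_smult_assoc_mat[OF mpoly_carrier C])
  then show ?case
    using C pCons by (simp add: mpoly_pCons) (intro eq_matI, auto simp: algebra_simps)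
qed

lemma mpoly_mult: "mpoly n C (p * q) = mpoly n C p * mpoly n C q"
proof -
  have comm: "C * mpoly n C q = mpoly n C q * C" for q
  proof (induction q)
    case 0
    show ?case using C by simp
  next
    case (pCons a q)
    have "C * mpoly n C (pCons a q) = C * (a \<cdot>\<^sub>m 1\<^sub>m n) + C * (mpoly n C q * C)"
      unfolding mpoly_pCons using C by (intro mult_add_distrib_mat) auto
    also have "C * (a \<cdot>\<^sub>m 1\<^sub>m n) = (a \<cdot>\<^sub>m 1\<^sub>m n) * C"
      using C by (simp add: mult_smult_distrib[of C n n "1\<^sub>m n" n] mult_smult_assoc_mat[of "1\<^sub>m n" n n C n])
    also have "C * (mpoly n C q * C) = (mpoly n C q * C) * C"
      unfolding assoc_mult_mat[OF C mpoly_carrier C, symmetric] pCons.IH ..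
    also have "(a \<cdot>\<^sub>m 1\<^sub>m n) * C + (mpoly n C q * C) * C = mpoly n C (pCons a q) * C"
      unfolding mpoly_pCons using C by (intro add_mult_distrib_mat[symmetric]) auto
    finally show ?case .
  qed
  show ?thesis
  proof (induction p)
    case 0
    show ?case by simp
  next
    case (pCons a p)
    have "mpoly n C (pCons a p * q) = a \<cdot>\<^sub>m mpoly n C q + mpoly n C p * mpoly n C q * C"
      by (simp add: mpoly_add mpoly_smult mpoly_pCons pCons) (intro eq_matI, use C in auto)
    also have "a \<cdot>\<^sub>m mpoly n C q = (a \<cdot>\<^sub>m 1\<^sub>m n) * mpoly n C q"
      by (simp add: mult_smult_assoc_mat[OF one_carrier_mat mpoly_carrier])
    also have "mpoly n C p * mpoly n C q * C = mpoly n C p * C * mpoly n C q"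
      unfolding assoc_mult_mat[OF mpoly_carrier mpoly_carrier C] assoc_mult_mat[OF mpoly_carrier C mpoly_carrier] comm ..
    also have "(a \<cdot>\<^sub>m 1\<^sub>m n) * mpoly n C q + mpoly n C p * C * mpoly n C q = mpoly n C (pCons a p) * mpoly n C q"
      unfolding mpoly_pCons using C by (intro add_mult_distrib_mat[symmetric]) auto
    finally show ?case .
  qed
qed

lemma mpoly_1 [simp]: "mpoly n C 1 = 1\<^sub>m n"
  unfolding one_pCons mpoly_pCons using C by (intro eq_matI) auto

lemma mpoly_X: "mpoly n C [:0, 1:] = C"
  unfolding mpoly_pCons using C by (intro eq_matI) auto

lemma mpoly_diff: "mpoly n C (p - q) = mpoly n C p - mpoly n C q"
proof -
  have "mpoly n C (p - q) = mpoly n C p + (- 1) \<cdot>\<^sub>m mpoly n C q"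
    using mpoly_add[of p "- q"] mpoly_smult[of "- 1" q] by simp
  also have "\<dots> = mpoly n C p - mpoly n C q"
    using mpoly_carrier[of p] mpoly_carrier[of q] by (intro eq_matI) auto
  finally show ?thesis .
qed

lemma mpoly_commute:
  assumes B: "B \<in> carrier_mat n n" and BC: "B * C = C * B"
  shows "B * mpoly n C p = mpoly n C p * B"
proof (induction p)
  case 0
  show ?case using B by simp
next
  case (pCons a p)
  have "B * mpoly n C (pCons a p) = B * (a \<cdot>\<^sub>m 1\<^sub>m n) + B * (mpoly n C p * C)"
    unfolding mpoly_pCons using B C by (intro mult_add_distrib_mat) auto
  also have "B * (a \<cdot>\<^sub>m 1\<^sub>m n) = (a \<cdot>\<^sub>m 1\<^sub>m n) * B"
    using B by (simp add: mult_smult_distrib[of B n n "1\<^sub>m n" n] mult_smult_assoc_mat[of "1\<^sub>m n" n n B n])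
  also have "B * (mpoly n C p * C) = (mpoly n C p * C) * B"
    unfolding assoc_mult_mat[OF B mpoly_carrier C, symmetric] pCons.IH
      assoc_mult_mat[OF mpoly_carrier B C] assoc_mult_mat[OF mpoly_carrier C B] BC ..
  also have "(a \<cdot>\<^sub>m 1\<^sub>m n) * B + (mpoly n C p * C) * B = mpoly n C (pCons a p) * B"
    unfolding mpoly_pCons using B C by (intro add_mult_distrib_mat[symmetric]) auto
  finally show ?case .
qed

lemma mpoly_ideal: "mpoly n C p = 0\<^sub>m n n \<Longrightarrow> p dvd q \<Longrightarrow> mpoly n C q = 0\<^sub>m n n"
  by (elim dvdE) (simp add: mpoly_mult right_mult_zero_mat[OF mpoly_carrier] left_mult_zero_mat[OF mpoly_carrier])

end

text \<open>A vanishing sum of \<open>n \<times> n\<close> matrices, stated entrywise so that it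
  needs only sums in the field.\<close>

definition zero_sum :: "nat \<Rightarrow> nat \<Rightarrow> (nat \<Rightarrow> 'f::field mat) \<Rightarrow> bool"
  where "zero_sum n r Y \<longleftrightarrow> (\<forall>a<n. \<forall>b<n. (\<Sum>i\<le>r. Y i $$ (a, b)) = 0)"

lemma zero_sum_mult_left:
  assumes "zero_sum n r Y" "Z \<in> carrier_mat n n" "\<And>i. Y i \<in> carrier_mat n n"
  shows "zero_sum n r (\<lambda>i. Z * Y i)"
  unfolding zero_sum_def
proof (intro allI impI)
  fix a b assume ab: "a < n" "b < n"
  have "(Z * Y i) $$ (a, b) = (\<Sum>k<n. Z $$ (a, k) * Y i $$ (k, b))" for i
    using ab assms(2) assms(3)[of i] by (simp add: scalar_prod_def atLeast0LessThan)
  then have "(\<Sum>i\<le>r. (Z * Y i) $$ (a, b)) = (\<Sum>k<n. Z $$ (a, k) * (\<Sum>i\<le>r. Y i $$ (k, b)))"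
    by (simp add: sum_distrib_left) (rule sum.swap)
  also have "\<dots> = 0" using assms(1) ab by (intro sum.neutral) (auto simp: zero_sum_def)
  finally show "(\<Sum>i\<le>r. (Z * Y i) $$ (a, b)) = 0" .
qed

lemma zero_sum_mult_right:
  assumes "zero_sum n r Y" "Z \<in> carrier_mat n n" "\<And>i. Y i \<in> carrier_mat n n"
  shows "zero_sum n r (\<lambda>i. Y i * Z)"
  unfolding zero_sum_def
proof (intro allI impI)
  fix a b assume ab: "a < n" "b < n"
  have "(Y i * Z) $$ (a, b) = (\<Sum>k<n. Y i $$ (a, k) * Z $$ (k, b))" for i
    using ab assms(2) assms(3)[of i] by (simp add: scalar_prod_def atLeast0LessThan)
  then have "(\<Sum>i\<le>r. (Y i * Z) $$ (a, b)) = (\<Sum>k<n. (\<Sum>i\<le>r. Y i $$ (a, k)) * Z $$ (k, b))"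
    by (simp add: sum_distrib_right) (rule sum.swap)
  also have "\<dots> = 0" using assms(1) ab by (intro sum.neutral) (auto simp: zero_sum_def)
  finally show "(\<Sum>i\<le>r. (Y i * Z) $$ (a, b)) = 0" .
qed

lemma zero_sum_diff:
  assumes "zero_sum n r Y" "zero_sum n r Z" "\<And>i. Y i \<in> carrier_mat n n" "\<And>i. Z i \<in> carrier_mat n n"
  shows "zero_sum n r (\<lambda>i. Y i - Z i)"
  using assms(1,2) assms(3)[THEN carrier_matD(1)] assms(3)[THEN carrier_matD(2)]
    assms(4)[THEN carrier_matD(1)] assms(4)[THEN carrier_matD(2)]
  by (simp add: zero_sum_def sum_subtractf)

text \<open>Dimension count: \<open>n\<^sup>2 + 1\<close> powers lie in an \<open>n\<^sup>2\<close>-dimensional space.\<close>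

lemma powers_dependent:
  fixes A :: "'f::field mat"
  assumes A: "A \<in> carrier_mat n n"
  shows "\<exists>r b. b r \<noteq> 0 \<and> zero_sum n r (\<lambda>i. b i \<cdot>\<^sub>m (A ^\<^sub>m i))"
proof -
  let ?N = "Suc (n * n)"
  \<comment> \<open>The added zero row makes the matrix square and its determinant zero.\<close>
  define M where "M = mat ?N ?N (\<lambda>(q, i). if q < n * n then (A ^\<^sub>m i) $$ (q div n, q mod n) else 0)"
  have M: "M \<in> carrier_mat ?N ?N" by (simp add: M_def)
  have "transpose_mat M *\<^sub>v unit_vec ?N (n * n) = 0\<^sub>v ?N"
    by (intro eq_vecI) (auto simp: M_def scalar_prod_right_unit)
  moreover have "unit_vec ?N (n * n) \<noteq> (0\<^sub>v ?N :: 'f vec)" by simp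
  ultimately have "det (transpose_mat M) = 0"
    using det_0_iff_vec_prod_zero[of "transpose_mat M" ?N] M by (metis transpose_carrier_mat unit_vec_carrier)
  then have "det M = 0" using det_transpose[OF M] by simp
  then obtain v where v: "v \<in> carrier_vec ?N" "v \<noteq> 0\<^sub>v ?N" "M *\<^sub>v v = 0\<^sub>v ?N"
    using det_0_iff_vec_prod_zero[OF M] by blast
  define I where "I = {i. i < ?N \<and> v $ i \<noteq> 0}"
  have "I \<noteq> {}"
  proof
    assume "I = {}"
    then have "v = 0\<^sub>v ?N" using v(1) by (intro eq_vecI) (auto simp: I_def)
    with v(2) show False by simp
  qed
  moreover have finI: "finite I" by (simp add: I_def)
  \<comment> \<open>Cutting the relation off at its last nonzero coefficient gives
    \<open>b r \<noteq> 0\<close>.\<close>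
  ultimately have mem: "Max I \<in> I" by simp
  have "zero_sum n (Max I) (\<lambda>i. v $ i \<cdot>\<^sub>m (A ^\<^sub>m i))"
    unfolding zero_sum_def
  proof (intro allI impI)
    fix a b assume ab: "a < n" "b < n"
    let ?q = "a * n + b"
    have q: "?q < n * n"
    proof -
      have "?q < a * n + n" using ab by simp
      also have "\<dots> = Suc a * n" by simp
      also have "\<dots> \<le> n * n" using ab by (intro mult_le_mono1) simp
      finally show ?thesis .
    qed
    have dm: "?q div n = a" "?q mod n = b" using ab by auto
    have "0 = (M *\<^sub>v v) $ ?q" using v(3) q by simp
    also have "\<dots> = (\<Sum>i<?N. (A ^\<^sub>m i) $$ (a, b) * v $ i)"
      using q v(1) by (simp add: M_def scalar_prod_def dm ab atLeast0LessThan del: sum.lessThan_Suc)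
    also have "\<dots> = (\<Sum>i\<le>Max I. (A ^\<^sub>m i) $$ (a, b) * v $ i)"
    proof (rule sum.mono_neutral_right)
      show "{..Max I} \<subseteq> {..<?N}" using mem by (auto simp: I_def)
      show "\<forall>i\<in>{..<?N} - {..Max I}. (A ^\<^sub>m i) $$ (a, b) * v $ i = 0"
      proof
        fix i assume i: "i \<in> {..<?N} - {..Max I}"
        then have "i \<notin> I" using Max_ge[OF finI, of i] by auto
        with i show "(A ^\<^sub>m i) $$ (a, b) * v $ i = 0" by (auto simp: I_def)
      qed
    qed simp
    also have "\<dots> = (\<Sum>i\<le>Max I. (v $ i \<cdot>\<^sub>m (A ^\<^sub>m i)) $$ (a, b))"
      using ab A by (intro sum.cong) auto
    finally show "(\<Sum>i\<le>Max I. (v $ i \<cdot>\<^sub>m (A ^\<^sub>m i)) $$ (a, b)) = 0" by simp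
  qed
  moreover have "v $ Max I \<noteq> 0" using mem by (simp add: I_def)
  ultimately show ?thesis by (intro exI[of _ "Max I"] exI[of _ "\<lambda>i. v $ i"]) simp
qed

context
  fixes n :: nat and A Ai B Bi C :: "'f::field mat"
  assumes carrier: "A \<in> carrier_mat n n" "Ai \<in> carrier_mat n n" "B \<in> carrier_mat n n" "Bi \<in> carrier_mat n n"
      "C \<in> carrier_mat n n"
    and inv: "A * Ai = 1\<^sub>m n" "B * Bi = 1\<^sub>m n"
    and comm: "A * C = C * A" "B * C = C * B"
    and rel: "B * A = C * (A * B)"
begin

lemmas square = assoc_mult_mat[of _ n n _ n _ n] mult_carrier_mat[of _ n n _ n]

text \<open>Moving \<open>B\<close> past each of the \<open>i\<close> factors \<open>A\<close> costs
  one \<open>C\<close>, and the \<open>C\<close> can be collected because they commute with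
  \<open>A\<close>.\<close>

lemma conjugate_power: "B * (A ^\<^sub>m i) = mpoly n C ([:0, 1:] ^ i) * ((A ^\<^sub>m i) * B)"
proof (induction i)
  case 0
  show ?case using carrier by simp
next
  case (Suc i)
  have Ai: "A ^\<^sub>m i \<in> carrier_mat n n" using carrier by simp
  let ?X = "[:0, 1:] :: 'f poly"
  let ?M = "mpoly n C (?X ^ i)"
  note [simp] = mpoly_carrier[OF carrier(5)]
  have comm_i: "A ^\<^sub>m i * C = C * A ^\<^sub>m i"
  proof (induction i)
    case (Suc j)
    have "A ^\<^sub>m j * A * C = A ^\<^sub>m j * (C * A)" using carrier by (simp add: square comm)
    also have "\<dots> = A ^\<^sub>m j * C * A" using carrier by (simp add: square)
    also have "\<dots> = C * (A ^\<^sub>m j * A)" unfolding Suc using carrier by (simp add: square)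
    finally show ?case by simp
  qed (use carrier in simp)
  have "B * (A ^\<^sub>m Suc i) = B * A ^\<^sub>m i * A" using carrier by (simp add: square)
  also have "\<dots> = ?M * (A ^\<^sub>m i * (B * A))" unfolding Suc using carrier by (simp add: square)
  also have "\<dots> = ?M * (A ^\<^sub>m i * C * (A * B))" unfolding rel using carrier by (simp add: square)
  also have "\<dots> = ?M * C * (A ^\<^sub>m i * A * B)" unfolding comm_i using carrier by (simp add: square)
  also have "?M * C = mpoly n C (?X ^ Suc i)"
    unfolding power_Suc2 mpoly_mult[OF carrier(5)] mpoly_X[OF carrier(5)] ..
  finally show ?case by simp
qed

text \<open>Subtracting its conjugate by \<open>B\<close> from a relation between powers of \<open>A\<close> removes the constant
  term.\<close>

lemma eliminate_powers:
  assumes "zero_sum n r (\<lambda>i. mpoly n C (x i) * (A ^\<^sub>m i))"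
  shows "mpoly n C (x r * (\<Prod>k=1..r. [:0, 1:] ^ k - 1)) = 0\<^sub>m n n"
  using assms
proof (induction r arbitrary: x)
  case 0
  have "mpoly n C (x 0) = 0\<^sub>m n n"
    using 0 mpoly_dim[OF carrier(5), of "x 0"] mpoly_carrier[OF carrier(5), of "x 0"] carrier
    by (intro eq_matI) (auto simp: zero_sum_def)
  then show ?case by simp
next
  case (Suc r)
  let ?X = "[:0, 1:] :: 'f poly"
  let ?m = "mpoly n C"
  note [simp] = mpoly_carrier[OF carrier(5)]
  define Y where "Y = (\<lambda>i. ?m (x i) * (A ^\<^sub>m i))"
  have A: "A ^\<^sub>m i \<in> carrier_mat n n" for i using carrier by simp
  have Y: "Y i \<in> carrier_mat n n" for i unfolding Y_def by (rule mult_carrier_mat[OF _ A]) simp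
  have "B * Y i * Bi = ?m (x i * ?X ^ i) * (A ^\<^sub>m i)" for i
  proof -
    have "B * Y i * Bi = ?m (x i) * (B * A ^\<^sub>m i) * Bi"
      unfolding Y_def using carrier A mpoly_commute[OF carrier(5,3) comm(2), of "x i"]
      by (simp add: mult_carrier_mat[of _ n n _ n] flip: assoc_mult_mat[of _ n n _ n _ n])
    also have "\<dots> = ?m (x i) * ?m (?X ^ i) * A ^\<^sub>m i * (B * Bi)"
      unfolding conjugate_power using carrier A by (simp add: square)
    finally show ?thesis using carrier A by (simp add: inv mpoly_mult[OF carrier(5)])
  qed
  then have 1: "zero_sum n (Suc r) (\<lambda>i. ?m (x i * ?X ^ i) * (A ^\<^sub>m i))"
    using zero_sum_mult_right[OF zero_sum_mult_left[OF Suc.prems[folded Y_def] carrier(3) Y] carrier(4)]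
      carrier Y by simp
  have "?m (x i * ?X ^ i) * (A ^\<^sub>m i) - Y i = ?m (x i * (?X ^ i - 1)) * (A ^\<^sub>m i)" for i
    unfolding Y_def
    by (subst minus_mult_distrib_mat[symmetric, OF mpoly_carrier[OF carrier(5)] mpoly_carrier[OF carrier(5)] A])
      (simp add: mpoly_diff[OF carrier(5), symmetric] algebra_simps)
  moreover have "?m p * (A ^\<^sub>m i) \<in> carrier_mat n n" for p i
    by (rule mult_carrier_mat[OF _ A]) simp
  ultimately have 2: "zero_sum n (Suc r) (\<lambda>i. ?m (x i * (?X ^ i - 1)) * (A ^\<^sub>m i))"
    using zero_sum_diff[OF 1 Suc.prems[folded Y_def] _ Y] by simp
  have "zero_sum n (Suc r) (\<lambda>i. ?m (x i * (?X ^ i - 1)) * (A ^\<^sub>m i) * Ai)"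
    by (rule zero_sum_mult_right[OF 2 carrier(2)]) (rule mult_carrier_mat[OF _ A], simp)
  \<comment> \<open>The term \<open>i = 0\<close> carries the factor \<open>X^0 - 1 = 0\<close>;
    multiplication by \<open>Ai\<close> lowers the other exponents by one.\<close>
  then have "zero_sum n r (\<lambda>i. ?m (x (Suc i) * (?X ^ Suc i - 1)) * (A ^\<^sub>m Suc i) * Ai)"
    using carrier by (simp add: zero_sum_def sum.atMost_Suc_shift mpoly_0[OF carrier(5)] del: sum.atMost_Suc power_Suc)
  moreover have "?m p * (A ^\<^sub>m Suc i) * Ai = ?m p * (A ^\<^sub>m i)" for p i
    using carrier A by (simp add: square inv)
  ultimately have "zero_sum n r (\<lambda>i. ?m (x (Suc i) * (?X ^ Suc i - 1)) * (A ^\<^sub>m i))"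
    by (simp only:)
  from Suc.IH[of "\<lambda>i. x (Suc i) * (?X ^ Suc i - 1)", OF this] show ?case
    by (simp add: mult.assoc mult.commute mult.left_commute del: power_Suc)
qed

end

lemma diff_one_dvd_power_diff_one: "(a::'a::comm_ring_1) - 1 dvd a ^ k - 1"
proof (induction k)
  case (Suc k)
  have eq: "a ^ Suc k - 1 = a * (a ^ k - 1) + (a - 1)" by (simp add: algebra_simps)
  show ?case unfolding eq by (rule dvd_add) (use Suc in simp_all)
qed simp

text \<open>\<open>Y^l - 1 = (Y - 1) * (l + (Y - 1) * V)\<close> with \<open>l\<close> invertible.
  Multiplied by a power of \<open>Y - 1\<close>, this lowers the exponent of nilpotency by one as
  long as it exceeds 1.\<close>

lemma mpoly_unipotent_finite_order:
  fixes C :: "'f::field mat"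
  assumes C: "C \<in> carrier_mat n n" and l: "(of_nat l :: 'f) \<noteq> 0"
    and "mpoly n C (Y ^ l - 1) = 0\<^sub>m n n" "mpoly n C ((Y - 1) ^ r) = 0\<^sub>m n n"
  shows "mpoly n C (Y - 1) = 0\<^sub>m n n"
  using assms(4)
proof (induction r rule: less_induct)
  case (less r)
  show ?case
  proof (cases "r \<le> 1")
    case True
    then have "(Y - 1) ^ r dvd Y - 1" by (cases r) auto
    then show ?thesis by (rule mpoly_ideal[OF C less.prems])
  next
    case False
    then obtain s where s: "r = Suc (Suc s)" by (metis One_nat_def not_less_eq_eq old.nat.exhaust zero_le)
    have "Y - 1 dvd (\<Sum>j<l. Y ^ j) - of_nat l"
    proof -
      have "Y - 1 dvd (\<Sum>j<l. (Y ^ j - 1))" by (intro dvd_sum diff_one_dvd_power_diff_one)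
      then show ?thesis by (simp add: sum_subtractf)
    qed
    then obtain V where V: "(\<Sum>j<l. Y ^ j) - of_nat l = (Y - 1) * V" by (elim dvdE)
    have "Y ^ l - 1 = (Y - 1) * (\<Sum>j<l. Y ^ j)" by (rule power_diff_1_eq)
    also have "(\<Sum>j<l. Y ^ j) = of_nat l + (Y - 1) * V" using V by (simp add: algebra_simps)
    finally have h: "Y ^ l - 1 = (Y - 1) * (of_nat l + (Y - 1) * V)" .
    have eq: "(Y - 1) ^ Suc s * of_nat l = (Y - 1) ^ s * (Y ^ l - 1) - (Y - 1) ^ r * V"
      unfolding h s by (simp add: distrib_left mult_ac)
    have "mpoly n C ((Y - 1) ^ s * (Y ^ l - 1)) = 0\<^sub>m n n" by (rule mpoly_ideal[OF C assms(3)]) simp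
    moreover have "mpoly n C ((Y - 1) ^ r * V) = 0\<^sub>m n n" by (rule mpoly_ideal[OF C less.prems]) simp
    ultimately have "mpoly n C ((Y - 1) ^ Suc s * of_nat l) = 0\<^sub>m n n"
      unfolding eq mpoly_diff[OF C] by simp
    moreover have "(Y - 1) ^ Suc s * of_nat l dvd (Y - 1) ^ Suc s"
      using l by (intro dvdI[of _ _ "[:inverse (of_nat l):]"]) (simp add: of_nat_poly mult.assoc flip: one_pCons)
    ultimately have "mpoly n C ((Y - 1) ^ Suc s) = 0\<^sub>m n n" by (rule mpoly_ideal[OF C])
    then show ?thesis using less.IH[of "Suc s"] s by simp
  qed
qed

lemma numeral_nonzero_field:
  "(2::'c::field) \<noteq> 0 \<or> (3::'c) \<noteq> 0 \<and> (5::'c) \<noteq> 0" "(3::'c) \<noteq> 0 \<or> (5::'c) \<noteq> 0"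
proof -
  have e: "(3::'c) = 2 + 1" "(5::'c) = 2 + 2 + 1" "(5::'c) = 3 + 3 - 1" by simp_all
  show "(2::'c) \<noteq> 0 \<or> (3::'c) \<noteq> 0 \<and> (5::'c) \<noteq> 0" using e(1,2) by force
  show "(3::'c) \<noteq> 0 \<or> (5::'c) \<noteq> 0" using e(3) by force
qed

text \<open>A field annihilates at most one of the pairwise coprime numbers 2, 3, 5, so two fields
  leave one of them.\<close>

lemma ex_nat_nonzero_both:
  "\<exists>l>1. (of_nat l :: 'a::field) \<noteq> 0 \<and> (of_nat l :: 'b::field) \<noteq> 0"
proof -
  have "(2::'a) \<noteq> 0 \<and> (2::'b) \<noteq> 0 \<or> (3::'a) \<noteq> 0 \<and> (3::'b) \<noteq> 0 \<or> (5::'a) \<noteq> 0 \<and> (5::'b) \<noteq> 0"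
    using numeral_nonzero_field[where 'c = 'a] numeral_nonzero_field[where 'c = 'b] by blast
  then show ?thesis
    by (elim disjE) (rule exI[of _ 2], simp, rule exI[of _ 3], simp, rule exI[of _ 5], simp)
qed

text \<open>A root of \<open>1 + X + ... + X^(l-1)\<close>; it differs from 1 because that
  polynomial takes the nonzero value \<open>l\<close> there.\<close>

lemma ex_root_of_unity:
  assumes "l > 1" "(of_nat l :: 'k::alg_closed_field) \<noteq> 0"
  obtains c :: "'k::alg_closed_field" where "c ^ l = 1" "c \<noteq> 1"
proof -
  obtain c :: 'k where c: "(\<Sum>k\<le>l - 1. 1 * c ^ k) = 0"
    using alg_closed[of "l - 1" "\<lambda>_. 1"] assms by auto
  have "{..l - 1} = {..<l}" using assms by auto
  with c have s: "(\<Sum>k<l. c ^ k) = 0" by simp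
  have "c ^ l - 1 = (c - 1) * (\<Sum>k<l. c ^ k)" by (rule power_diff_1_eq)
  then have "c ^ l = 1" using s by simp
  moreover have "c \<noteq> 1" using s assms by auto
  ultimately show thesis by (rule that)
qed

section \<open>Finite-dimensional representations\<close>

locale Cr2_rep =
  fixes h :: "('k::alg_closed_field ratfun2 \<Rightarrow> 'k ratfun2) \<Rightarrow> 'f::field mat" and n :: nat
  assumes hom: "h \<in> hom Cr2 (GL n)"
begin

lemma h_carrier: "\<phi> \<in> carrier Cr2 \<Longrightarrow> h \<phi> \<in> carrier_mat n n"
  using hom by (auto simp: hom_def carrier_GL)

lemma h_comp: "\<phi> \<in> carrier Cr2 \<Longrightarrow> \<psi> \<in> carrier Cr2 \<Longrightarrow> h (\<phi> \<circ> \<psi>) = h \<phi> * h \<psi>"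
  using hom by (auto simp: hom_def)

lemma h_id: "h id = 1\<^sub>m n"
proof -
  interpret g: group_hom Cr2 "GL n" h
    by (intro group_hom.intro group_hom_axioms.intro group_Cr2 group_GL hom)
  show ?thesis using g.hom_one by simp
qed

lemma comp_closed [intro]: "\<phi> \<in> carrier Cr2 \<Longrightarrow> \<psi> \<in> carrier Cr2 \<Longrightarrow> \<phi> \<circ> \<psi> \<in> carrier Cr2"
  using monoid.m_closed[OF group.is_monoid[OF group_Cr2], of \<phi> \<psi>] by simp

definition ker :: "('k ratfun2 \<Rightarrow> 'k ratfun2) set"
  where "ker = {\<phi> \<in> carrier Cr2. h \<phi> = 1\<^sub>m n}"

lemma kerD: "\<phi> \<in> ker \<Longrightarrow> \<phi> \<in> carrier Cr2" "\<phi> \<in> ker \<Longrightarrow> h \<phi> = 1\<^sub>m n"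
  by (simp_all add: ker_def)

lemma ker_comp: "\<phi> \<in> ker \<Longrightarrow> \<psi> \<in> ker \<Longrightarrow> \<phi> \<circ> \<psi> \<in> ker"
  by (auto simp: ker_def h_comp)

lemma ker_cancel:
  assumes "\<phi> \<in> carrier Cr2" "\<psi> \<in> carrier Cr2" "h (\<phi> \<circ> \<psi>) = h \<psi>"
  shows "\<phi> \<in> ker"
proof -
  interpret GL: group "GL n :: 'f mat monoid" by (rule group_GL)
  have "h \<phi> \<otimes>\<^bsub>GL n\<^esub> h \<psi> = \<one>\<^bsub>GL n\<^esub> \<otimes>\<^bsub>GL n\<^esub> h \<psi>"
    using assms h_carrier[of \<psi>] by (simp add: h_comp)
  moreover have "h \<phi> \<in> carrier (GL n)" "h \<psi> \<in> carrier (GL n)" using hom assms by (auto simp: hom_def)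
  ultimately have "h \<phi> = \<one>\<^bsub>GL n\<^esub>" by (simp only: GL.right_cancel GL.one_closed)
  with assms(1) show ?thesis by (simp add: ker_def)
qed

lemma ker_conjugate:
  assumes "\<phi> \<in> carrier Cr2" "\<phi>' \<in> carrier Cr2" "\<phi> \<circ> \<phi>' = id" "\<psi> \<in> ker"
  shows "\<phi> \<circ> \<psi> \<circ> \<phi>' \<in> ker"
proof -
  have "h (\<phi> \<circ> \<psi> \<circ> \<phi>') = h \<phi> * h \<phi>'"
    using assms h_carrier[of \<phi>] by (simp add: h_comp comp_closed kerD)
  also have "\<dots> = h (\<phi> \<circ> \<phi>')" by (rule h_comp[symmetric]) fact+
  finally show ?thesis using assms by (auto simp: ker_def h_id)
qed

end

lemma ratfun2_hom_scale_y: "c \<noteq> 0 \<Longrightarrow> ratfun2_hom (scale_y c)"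
  by (rule ratfun2_hom_moves)

lemma id_Cr2: "id \<in> carrier Cr2"
  by (simp add: carrier_Cr2 ratfun2_hom_id)

lemma Cr2_ext:
  assumes "\<phi> \<in> carrier Cr2" "\<psi> \<in> carrier Cr2" "\<phi> t1 = \<psi> t1" "\<phi> t2 = \<psi> t2"
  shows "\<phi> = \<psi>"
  using assms by (intro ratfun2_hom_ext) (auto simp: carrier_Cr2)

section \<open>Elementary transformations in the kernel\<close>

context Cr2_rep
begin

lemma h_scale_power:
  assumes "c \<noteq> 0"
  shows "h (scale_y (c ^ k)) = mpoly n (h (scale_y c)) ([:0, 1:] ^ k)"
proof (induction k)
  case 0
  interpret s: ratfun2_hom "scale_y (1::'k)" by (rule ratfun2_hom_scale_y) simp
  have "scale_y (1::'k) = id" by (rule ratfun2_hom_ext) (simp_all add: s.ratfun2_hom_axioms ratfun2_hom_id)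
  then show ?case by (simp only: power_0 h_id mpoly_1[OF h_carrier[OF scale_y_Cr2[OF assms]]])
next
  case (Suc k)
  interpret s: ratfun2_hom "scale_y (c ^ k)" by (rule ratfun2_hom_scale_y) (simp add: assms)
  note C = h_carrier[OF scale_y_Cr2[OF assms]]
  have eq: "scale_y (c ^ Suc k) = scale_y (c ^ k) \<circ> scale_y c"
    using assms by (intro Cr2_ext comp_closed) (simp_all add: s.hom_mult const.hom_mult)
  have "h (scale_y (c ^ Suc k)) = h (scale_y (c ^ k)) * h (scale_y c)"
    unfolding eq by (rule h_comp) (use assms in simp_all)
  also have "\<dots> = mpoly n (h (scale_y c)) ([:0, 1:] ^ Suc k)"
    unfolding power_Suc2 mpoly_mult[OF C] mpoly_X[OF C] Suc ..
  finally show ?case .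
qed

lemma ex_scale_in_ker:
  obtains c where "c \<noteq> 0" "c \<noteq> 1" "scale_y c \<in> ker"
proof -
  obtain l where l: "l > 1" "(of_nat l :: 'k) \<noteq> 0" "(of_nat l :: 'f) \<noteq> 0"
    using ex_nat_nonzero_both[where 'a = 'k and 'b = 'f] by blast
  obtain c :: 'k where c: "c ^ l = 1" "c \<noteq> 1" by (rule ex_root_of_unity[OF l(1,2)])
  define A where "A = h mul_xy"
  define div_xy where "div_xy = inv_y \<circ> mul_xy \<circ> (inv_y :: 'k ratfun2 \<Rightarrow> _)"
  have div: "div_xy \<in> carrier Cr2" unfolding div_xy_def by (intro comp_closed) simp_all
  have A: "A \<in> carrier_mat n n" unfolding A_def by (rule h_carrier) simp
  have md: "mul_xy \<circ> div_xy = id"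
    by (intro Cr2_ext comp_closed div id_Cr2 mul_xy_Cr2)
      (simp_all add: div_xy_def inv_y.hom_inverse inv_y.hom_mult mul_xy.hom_inverse mul_xy.hom_mult)
  obtain r b where r: "b r \<noteq> 0" "zero_sum n r (\<lambda>i. b i \<cdot>\<^sub>m (A ^\<^sub>m i))"
    using powers_dependent[OF A] by blast
  obtain c' where c': "c' ^ fact r = c" using nth_root_exists[of "fact r" c] by auto
  have c0: "c \<noteq> 0"
  proof
    assume "c = 0"
    with c(1) l(1) show False by (simp add: power_0_left)
  qed
  then have c'0: "c' \<noteq> 0" using c' by (auto simp: power_0_left)
  define C where "C = h (scale_y c')"
  have C: "C \<in> carrier_mat n n" unfolding C_def by (rule h_carrier) (simp add: c'0)
  define sx sx' where "sx = swap \<circ> scale_y c' \<circ> swap" "sx' = swap \<circ> scale_y (inverse c') \<circ> swap"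
  have sx: "sx \<in> carrier Cr2" "sx' \<in> carrier Cr2" unfolding sx_sx'_def using c'0 by (auto intro!: comp_closed)
  interpret s: ratfun2_hom "scale_y c'" by (rule ratfun2_hom_scale_y) fact
  interpret s': ratfun2_hom "scale_y (inverse c')" by (rule ratfun2_hom_scale_y) (simp add: c'0)
  have sx_t: "sx t1 = ratfun2_const c' * t1" "sx t2 = t2" unfolding sx_sx'_def using c'0 by (simp_all add: swap.hom_mult)
  have sx'_t: "sx' t1 = ratfun2_const (inverse c') * t1" "sx' t2 = t2" unfolding sx_sx'_def using c'0 by (simp_all add: swap.hom_mult)
  interpret sx: ratfun2_hom sx using sx by (simp add: carrier_Cr2)
  have "sx \<circ> sx' = id"
    using c'0 by (intro Cr2_ext comp_closed sx id_Cr2) (simp_all add: sx_t sx'_t sx.hom_mult sx.hom_inverse const.hom_inverse)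
  then have B: "h sx * h sx' = 1\<^sub>m n" using sx by (simp flip: h_comp add: h_id)
  have eqs: "sx \<circ> mul_xy = scale_y c' \<circ> (mul_xy \<circ> sx)" "mul_xy \<circ> scale_y c' = scale_y c' \<circ> mul_xy"
      "sx \<circ> scale_y c' = scale_y c' \<circ> sx"
    using c'0 sx by (auto intro!: Cr2_ext comp_closed simp: sx_t sx.hom_mult mul_xy.hom_mult s.hom_mult mult_ac)
  have "h sx * A = C * (A * h sx)" "A * C = C * A" "h sx * C = C * h sx"
    unfolding A_def C_def using arg_cong[OF eqs(1), of h] arg_cong[OF eqs(2), of h] arg_cong[OF eqs(3), of h] sx c'0
    by (simp_all add: h_comp comp_closed)
  note cm = this
  have AA: "A * h div_xy = 1\<^sub>m n" unfolding A_def using md div by (simp flip: h_comp add: h_id)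
  have "(\<lambda>i. b i \<cdot>\<^sub>m (A ^\<^sub>m i)) = (\<lambda>i. mpoly n C [:b i:] * (A ^\<^sub>m i))"
  proof
    fix i
    have "mpoly n C [:b i:] = b i \<cdot>\<^sub>m 1\<^sub>m n" unfolding mpoly_pCons[OF C] mpoly_0[OF C] using C by simp
    then show "b i \<cdot>\<^sub>m (A ^\<^sub>m i) = mpoly n C [:b i:] * (A ^\<^sub>m i)"
      using A by (simp add: mult_smult_assoc_mat[of "1\<^sub>m n" n n "A ^\<^sub>m i" n])
  qed
  with r(2) have "zero_sum n r (\<lambda>i. mpoly n C [:b i:] * (A ^\<^sub>m i))" by simp
  from eliminate_powers[OF A h_carrier[OF div] h_carrier[OF sx(1)] h_carrier[OF sx(2)] C AA B cm(2,3,1) this]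
  have 0: "mpoly n C ([:b r:] * (\<Prod>k=1..r. [:0, 1:] ^ k - 1)) = 0\<^sub>m n n" .
  \<comment> \<open>Every \<open>X^k - 1\<close> with \<open>1 \<le> k \<le> r\<close> divides
    \<open>Y - 1\<close>, so \<open>Y\<close> evaluates to a unipotent matrix, namely the image of
    \<open>scale_y c\<close>.\<close>
  define Y where "Y = ([:0, 1:] ^ fact r :: 'f poly)"
  have "(\<Prod>k=1..r. [:0, 1:] ^ k - 1) dvd (\<Prod>k=1..r. Y - 1)"
  proof (rule prod_dvd_prod)
    fix k assume "k \<in> {1..r}"
    then have "k dvd fact r" by (intro dvd_fact) auto
    then obtain m where "fact r = k * m" by (elim dvdE)
    then show "[:0, 1:] ^ k - 1 dvd Y - 1" by (simp add: Y_def power_mult diff_one_dvd_power_diff_one)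
  qed
  moreover have "[:b r:] * (\<Prod>k=1..r. [:0, 1:] ^ k - 1) dvd 1 * (\<Prod>k=1..r. [:0, 1:] ^ k - 1)"
    by (rule mult_dvd_mono) (use r(1) in \<open>simp_all add: is_unit_const_poly_iff dvd_field_iff\<close>)
  ultimately have "[:b r:] * (\<Prod>k=1..r. [:0, 1:] ^ k - 1) dvd (Y - 1) ^ r"
    by (simp add: dvd_trans)
  then have 1: "mpoly n C ((Y - 1) ^ r) = 0\<^sub>m n n" by (rule mpoly_ideal[OF C 0])
  have "mpoly n C (Y ^ l) = h (scale_y (c' ^ (fact r * l)))"
    unfolding h_scale_power[OF c'0] C_def Y_def by (simp add: power_mult)
  also have "c' ^ (fact r * l) = c' ^ 0" by (simp add: power_mult c' c)
  also have "h (scale_y (c' ^ 0)) = 1\<^sub>m n"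
    unfolding h_scale_power[OF c'0] by (simp add: mpoly_1[OF C[unfolded C_def]])
  finally have "mpoly n C (Y ^ l - 1) = 0\<^sub>m n n" by (simp add: mpoly_diff[OF C] mpoly_1[OF C])
  from mpoly_unipotent_finite_order[OF C l(3) this 1] have "mpoly n C Y - 1\<^sub>m n = 0\<^sub>m n n"
    by (simp add: mpoly_diff[OF C] mpoly_1[OF C])
  then have "mpoly n C Y = 1\<^sub>m n"
    using mpoly_dim[OF C, of Y] by (metis (no_types, lifting) C eq_iff_diff_eq_0 index_minus_mat(1) index_one_mat index_zero_mat eq_matI mpoly_dim)
  moreover have "h (scale_y c) = mpoly n C Y" unfolding c'[symmetric] h_scale_power[OF c'0] C_def Y_def by simp
  ultimately have "scale_y c \<in> ker" using c0 by (simp add: ker_def)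
  with c0 c(2) show thesis by (rule that)
qed

text \<open>Conjugating translation by \<open>a\<close> with scaling by \<open>c\<close> gives
  translation by a multiple of \<open>a\<close>; in the quotient by the kernel both agree, and their
  difference \<open>(c - 1) * a\<close> is any \<open>b\<close>, as
  \<open>c \<noteq> 1\<close>.\<close>

lemma add_y_in_ker: "add_y b \<in> ker"
proof -
  obtain c where c: "c \<noteq> 0" "c \<noteq> 1" "scale_y c \<in> ker" by (rule ex_scale_in_ker)
  define a where "a = b / (c - 1)"
  have ac: "a * c = b + a" using c(2) by (simp add: a_def field_simps)
  interpret s: ratfun2_hom "scale_y c" by (rule ratfun2_hom_scale_y) fact
  have "scale_y c \<circ> add_y (a * c) = add_y a \<circ> scale_y c"
    using c(1) by (intro Cr2_ext comp_closed) (simp_all add: s.hom_add s.hom_mult add_y.hom_mult const.hom_mult algebra_simps)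
  then have "h (scale_y c) * h (add_y (a * c)) = h (add_y a) * h (scale_y c)"
    using c(1) by (metis h_comp add_y_Cr2 scale_y_Cr2)
  then have "h (add_y (b + a)) = h (add_y a)"
    using kerD(2)[OF c(3)] h_carrier[OF add_y_Cr2[of "b + a"]] h_carrier[OF add_y_Cr2[of a]] by (simp add: ac)
  moreover have "add_y b \<circ> add_y a = add_y (b + a)"
    by (intro Cr2_ext comp_closed) (simp_all add: add_y.hom_add const.hom_add)
  ultimately show ?thesis by (intro ker_cancel[of "add_y b" "add_y a"]) simp_all
qed

text \<open>The product of an upper, a lower and an upper unipotent matrix that is antidiagonal. It
  gives the inversion for \<open>a^2 = - 1\<close> and its negative for
  \<open>a = 1\<close>.\<close>

lemma inv_y_conj_add_y:
  assumes "a \<noteq> 0"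
  defines "w \<equiv> add_y a \<circ> (inv_y \<circ> add_y (- inverse a) \<circ> inv_y) \<circ> add_y a"
  shows "w \<in> ker" "w t1 = t1" "w t2 = - (ratfun2_const (a ^ 2) * inverse t2)"
proof -
  have ii: "inv_y \<circ> inv_y = (id :: 'k ratfun2 \<Rightarrow> _)"
    by (intro Cr2_ext comp_closed id_Cr2) (simp_all add: inv_y.hom_inverse)
  show "w \<in> ker" unfolding w_def by (intro ker_comp ker_conjugate add_y_in_ker ii inv_y_Cr2)
  show "w t1 = t1" by (simp add: w_def)
  let ?a = "ratfun2_const a"
  have nz: "t2 + ?a \<noteq> 0" using add_y_inj[of "[:0, 1:]" a] by simp
  have a: "?a \<noteq> 0" using assms by simp
  have "w t2 = inverse (inverse (t2 + ?a) - inverse ?a) + ?a"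
    by (simp add: w_def inv_y.hom_add inv_y.hom_inverse add_y.hom_add add_y.hom_inverse
        const.hom_uminus const.hom_inverse inv_y.hom_uminus add_y.hom_uminus inv_y.hom_minus add_y.hom_minus)
  also have "inverse (t2 + ?a) - inverse ?a = - t2 / (?a * (t2 + ?a))"
    using nz a by (simp add: field_simps)
  also have "inverse \<dots> + ?a = - (?a ^ 2 * inverse t2)"
    by (simp add: field_simps power2_eq_square)
  finally show "w t2 = - (ratfun2_const (a ^ 2) * inverse t2)" by (simp add: const.hom_power)
qed

lemma inv_y_in_ker: "inv_y \<in> ker"
proof -
  obtain a :: 'k where a: "a ^ 2 = - 1" using nth_root_exists[of 2 "- 1"] by auto
  then have "a \<noteq> 0" by auto
  note w = inv_y_conj_add_y[OF this]
  have "add_y a \<circ> (inv_y \<circ> add_y (- inverse a) \<circ> inv_y) \<circ> add_y a = inv_y"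
    by (rule Cr2_ext[OF kerD(1)[OF w(1)]]) (simp_all only: w(2,3) a, simp_all add: const.hom_uminus)
  with w(1) show ?thesis by simp
qed

lemma scale_y_minus_1_in_ker: "scale_y (- 1) \<in> ker"
proof -
  note w = inv_y_conj_add_y[OF one_neq_zero]
  let ?w = "add_y 1 \<circ> (inv_y \<circ> add_y (- inverse 1) \<circ> inv_y) \<circ> (add_y 1 :: 'k ratfun2 \<Rightarrow> _)"
  interpret w: ratfun2_hom ?w using kerD(1)[OF w(1)] by (simp add: carrier_Cr2)
  have "?w \<circ> inv_y = scale_y (- 1)"
    by (intro Cr2_ext comp_closed kerD(1)[OF w(1)])
      (simp_all only: comp_apply[of ?w] moves_t1 moves_t2 w.hom_inverse w(2,3), simp_all add: const.hom_uminus)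
  then show ?thesis using ker_comp[OF w(1) inv_y_in_ker] by simp
qed

lemma swap_conj_in_ker:
  assumes "\<phi> \<in> ker"
  shows "swap \<circ> \<phi> \<circ> swap \<in> ker"
proof (rule ker_conjugate[OF swap_Cr2 swap_Cr2 _ assms])
  show "swap \<circ> swap = (id :: 'k ratfun2 \<Rightarrow> _)" by (intro Cr2_ext comp_closed id_Cr2) simp_all
qed

text \<open>Modulo the kernel, \<open>mul_xy\<close> equals its conjugates under Moebius maps of
  \<open>t1\<close>. Two of these multiply \<open>t2\<close> by \<open>t1 - 1\<close> and by
  \<open>t1 / (t1 - 1)\<close>, and their composite is \<open>mul_xy\<close> itself, so its image is
  idempotent in the group.\<close>

lemma mul_xy_in_ker: "mul_xy \<in> ker"
proof -
  define X where "X = (\<lambda>b. swap \<circ> add_y b \<circ> (swap :: 'k ratfun2 \<Rightarrow> _))"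
  define I where "I = swap \<circ> inv_y \<circ> (swap :: 'k ratfun2 \<Rightarrow> _)"
  have X: "X b \<in> ker" for b unfolding X_def by (rule swap_conj_in_ker[OF add_y_in_ker])
  have I: "I \<in> ker" unfolding I_def by (rule swap_conj_in_ker[OF inv_y_in_ker])
  interpret X: ratfun2_hom "X b" for b using kerD(1)[OF X] by (simp add: carrier_Cr2)
  interpret I: ratfun2_hom I using kerD(1)[OF I] by (simp add: carrier_Cr2)
  have X_t: "X b t1 = t1 + ratfun2_const b" "X b t2 = t2" for b
    by (simp_all add: X_def swap.hom_add)
  have I_t: "I t1 = inverse t1" "I t2 = t2" by (simp_all add: I_def swap.hom_inverse)
  define \<sigma> where "\<sigma> = X (- 1) \<circ> I \<circ> X 1"
  have \<sigma>: "\<sigma> \<in> ker" unfolding \<sigma>_def by (intro ker_comp X I)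
  interpret \<sigma>: ratfun2_hom \<sigma> using kerD(1)[OF \<sigma>] by (simp add: carrier_Cr2)
  have nz: "t1 - 1 \<noteq> (0 :: 'k ratfun2)"
  proof
    assume "t1 - 1 = (0 :: 'k ratfun2)"
    then have "X 1 (t1 - 1) = 0" by simp
    then show False by (simp add: X.hom_minus X_t)
  qed
  have "\<sigma> t1 = inverse (t1 - 1) + 1"
    by (simp add: \<sigma>_def X_t I_t X.hom_add I.hom_add X.hom_inverse const.hom_uminus)
  then have \<sigma>_t: "\<sigma> t1 = t1 / (t1 - 1)" "\<sigma> t2 = t2"
    using nz by (simp_all add: \<sigma>_def X_t I_t field_simps)
  have m: "mul_xy \<in> carrier (Cr2 :: ('k ratfun2 \<Rightarrow> _) monoid)" by simp
  define \<tau> \<rho> where "\<tau> = \<sigma> \<circ> mul_xy \<circ> \<sigma>" "\<rho> = X (- 1) \<circ> mul_xy \<circ> X 1"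
  have cl: "\<tau> \<in> carrier Cr2" "\<rho> \<in> carrier Cr2"
    unfolding \<tau>_\<rho>_def by (intro comp_closed kerD(1) \<sigma> X m)+
  have h: "h \<tau> = h mul_xy" "h \<rho> = h mul_xy"
    unfolding \<tau>_\<rho>_def using h_carrier[OF m] kerD[OF \<sigma>] kerD[OF X]
    by (simp_all add: h_comp comp_closed)
  interpret \<rho>: ratfun2_hom \<rho> using cl by (simp add: carrier_Cr2)
  have \<sigma>\<sigma>: "\<sigma> (t1 / (t1 - 1)) = t1"
    using nz by (simp add: \<sigma>.hom_div \<sigma>.hom_minus \<sigma>_t) (simp add: field_simps)
  have \<tau>_t: "\<tau> t1 = t1" "\<tau> t2 = t1 / (t1 - 1) * t2"
    using \<sigma>\<sigma> by (simp_all add: \<tau>_\<rho>_def \<sigma>_t mul_xy.hom_div mul_xy.hom_minus \<sigma>.hom_mult)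
  have \<rho>_t: "\<rho> t1 = t1" "\<rho> t2 = (t1 - 1) * t2"
    by (simp_all add: \<tau>_\<rho>_def X_t mul_xy.hom_add X.hom_add X.hom_mult const.hom_uminus)
  have "\<rho> \<circ> \<tau> = mul_xy"
    using nz by (intro Cr2_ext comp_closed cl m) (simp_all add: \<tau>_t \<rho>_t \<rho>.hom_mult \<rho>.hom_div \<rho>.hom_minus)
  then have "h (\<rho> \<circ> \<tau>) = h \<tau>" using h by simp
  from ker_cancel[OF cl(2,1) this] show ?thesis using h(2) by (simp add: ker_def)
qed

text \<open>Conjugating translations by \<open>mul_xy\<close> gives the shears
  \<open>t2 \<mapsto> t2 + b t1\<close>; the swap is a product of three shears and a sign, as for
  the permutation matrix of size 2.\<close>

lemma swap_in_ker: "swap \<in> ker"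
proof -
  define D where "D = inv_y \<circ> mul_xy \<circ> (inv_y :: 'k ratfun2 \<Rightarrow> _)"
  have D: "D \<in> ker" unfolding D_def by (intro ker_comp inv_y_in_ker mul_xy_in_ker)
  interpret D: ratfun2_hom D using kerD(1)[OF D] by (simp add: carrier_Cr2)
  have D_t: "D t1 = t1" "D t2 = t2 / t1"
    by (simp_all add: D_def inv_y.hom_inverse inv_y.hom_mult mul_xy.hom_inverse mul_xy.hom_mult divide_inverse mult.commute)
  define E where "E = (\<lambda>b. D \<circ> add_y b \<circ> mul_xy)"
  have E: "E b \<in> ker" for b unfolding E_def by (intro ker_comp D add_y_in_ker mul_xy_in_ker)
  interpret E: ratfun2_hom "E b" for b using kerD(1)[OF E] by (simp add: carrier_Cr2)
  have E_t: "E b t1 = t1" "E b t2 = t2 + ratfun2_const b * t1" for b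
    by (simp_all add: E_def D_t add_y.hom_mult D.hom_mult D.hom_add field_simps)
  define F where "F = swap \<circ> E (- 1) \<circ> swap"
  have F: "F \<in> ker" unfolding F_def by (rule swap_conj_in_ker[OF E])
  interpret F: ratfun2_hom F using kerD(1)[OF F] by (simp add: carrier_Cr2)
  have F_t: "F t1 = t1 - t2" "F t2 = t2"
    by (simp_all add: F_def E_t swap.hom_add swap.hom_mult swap.hom_minus const.hom_uminus)
  interpret N: ratfun2_hom "scale_y (- 1 :: 'k)" by (rule ratfun2_hom_scale_y) simp
  have "scale_y (- 1) \<circ> (E 1 \<circ> (F \<circ> E 1)) = swap"
    by (intro Cr2_ext comp_closed kerD(1) E F scale_y_minus_1_in_ker swap_Cr2)
      (simp_all add: E_t F_t E.hom_add E.hom_minus F.hom_add N.hom_add N.hom_minus const.hom_uminus N.hom_uminus)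
  moreover have "scale_y (- 1) \<circ> (E 1 \<circ> (F \<circ> E 1)) \<in> ker"
    by (intro ker_comp E F scale_y_minus_1_in_ker)
  ultimately show ?thesis by simp
qed

lemma trivial: "\<phi> \<in> carrier Cr2 \<Longrightarrow> h \<phi> = 1\<^sub>m n"
proof (rule ccontr)
  assume \<phi>: "\<phi> \<in> carrier Cr2" "h \<phi> \<noteq> 1\<^sub>m n"
  define S where "S = carrier Cr2 - ker"
  have S: "\<phi> \<circ> \<psi> \<in> S" if "\<phi> \<in> S" "\<psi> \<in> ker" for \<phi> \<psi>
    using that h_carrier[of \<phi>] by (auto simp: S_def ker_def h_comp)
  interpret move_closed S
    by unfold_locales
      (auto simp: S_def[symmetric] intro!: S swap_in_ker inv_y_in_ker add_y_in_ker mul_xy_in_ker, auto simp: S_def)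
  have "\<phi> \<in> S" using \<phi> by (simp add: S_def ker_def)
  then have "id \<in> S" using noether_castelnuovo by blast
  then show False by (simp add: S_def ker_def h_id)
qed

end

theorem proposition2p5:
  fixes h :: "('k::alg_closed_field ratfun2 \<Rightarrow> 'k ratfun2) \<Rightarrow> 'f::field mat"
    and n :: nat
  assumes "n \<ge> 1"
    and "h \<in> hom Cr2 (GL n)"
  shows "\<forall>\<phi> \<in> carrier Cr2. h \<phi> = \<one>\<^bsub>GL n\<^esub>"
proof -
  interpret Cr2_rep h n by unfold_locales (rule assms(2))
  show ?thesis using trivial by simp
qed

end
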